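(* Let $\mathcal{C}$ be a half-line CMV matrix with Verblunsky coefficients $\{\alpha_n\}_{n=0}^\infty$, $|\alpha_n|<1$, and let $\Sigma_{\rm ac}(\mathcal{C})$ be the essential support of the absolutely continuous part of its spectral measure. Then every right limit of $\mathcal{C}$ is reflectionless on $\Sigma_{\rm ac}(\mathcal{C})$.
   Context: Let $\mathbb{D}$ be the open unit disc. A probability measure $\mu$ on $\partial\mathbb{D}$ with infinite support has monic orthogonal polynomials $\Phi_n$ satisfying $\Phi_{n+1}(z)=z\Phi_n(z)-\overline{\alpha_n}\,\Phi_n^*(z)$, with $\Phi_n^*(z)=z^n\overline{\Phi_n(1/\bar z)}$; the numbers $\alpha_n\in\mathbb{D}$ are the Verblunsky coefficients of $\mu$, and $\mu\leftrightarrow\{\alpha_n\}_{n\ge0}\in\mathbb{D}^{\mathbb{Z}_+}$ is a bijection. The half-line CMV matrix $\mathcal{C}$ of $\{\alpha_n\}_{n\ge 0}$ is the unitary operator on $\ell^2(\mathbb{Z}_+)$ given by $\mathcal{C}=\mathcal{L}\mathcal{M}$, $\mathcal{L}=\Theta_0\oplus\Theta_2\oplus\cdots$, $\mathcal{M}=(1)\oplus\Theta_1\oplus\Theta_3\oplus\cdots$, $\Theta_k=\begin{pmatrix}\bar\alpha_k&\rho_k\\ \rho_k&-\alpha_k\end{pmatrix}$, $\rho_k=(1-|\alpha_k|^2)^{1/2}$; $\mu$ is its spectral measure. Writing $d\mu=w(\theta)\,d\theta+d\mu_{\rm sing}$, set $\Sigma_{\rm ac}(\mathcal{C})=\{\theta: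 w(\theta)>0\}$ (up to Lebesgue null sets; $\partial\mathbb{D}\cong[0,2\pi)$). Right limits: a sequence $\{\widetilde\alpha_n\}_{n\in\mathbb{Z}}$ with $|\widetilde\alpha_n|\le1$ is a right limit of $\{\alpha_n\}_{n\ge 0}$ if there are integers $n_j\to\infty$ with $\widetilde\alpha_n=\lim_{j\to\infty}\alpha_{n+n_j}$ for every $n\in\mathbb{Z}$. The corresponding whole-line CMV matrix $\mathcal{E}$ (on $\ell^2(\mathbb{Z})$, $\mathcal{E}=\mathcal{L}\mathcal{M}$ with $\mathcal{L}$ the direct sum of blocks $\Theta_{2k}$ acting on coordinates $2k,2k+1$, and $\mathcal{M}$ the direct sum of blocks $\Theta_{2k-1}$ acting on coordinates $2k-1,2k$, $k\in\mathbb{Z}$, with $\Theta_k$ formed from $\widetilde\alpha_k$) is then called a right limit of $\mathcal{C}$. Schur functions: a Schur function is an analytic $f$ on $\mathbb{D}$ with $|f|\le1$; its radial boundary values exist a.e. on $\partial\mathbb{D}$. $f(z;\gamma_0,\gamma_1,\dots)$ denotes the Schur function $f=f_0$ with Schur parameters $\gamma_n$, i.e. $\gamma_n=f_n(0)$ and $zf_{n+1}(z)=\frac{f_n(z)-\gamma_n}{1-\bar\gamma_nf_n(z)}$; if some $|\gamma_n|=1$ the algorithm stops there ($f_n\equiv\gamma_n$) and $f$ is a finite Blaschke product. Reflectionless: for a doubly infinite sequence $\{\alpha_n\}_{n\in\mathbb{Z}}$, $|\alpha_n|\le1$, put $f_+(z,n)=f(z;\alpha_n,\alpha_{n+1},\dots)$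 and $f_-(z,n)=f(z;-\overline{\alpha_{n-1}},-\overline{\alpha_{n-2}},\dots)$. The associated whole-line CMV matrix is reflectionless on a Borel set $A\subseteq\partial\mathbb{D}$ if for all $n\in\mathbb{Z}$, $zf_+(z,n)=\overline{f_-(z,n)}$ for Lebesgue a.e. $z\in A$. *)

theory Defs
  imports "HOL-Complex_Analysis.Complex_Analysis" "HOL-Probability.Probability"
begin

section \<open>CMV matrices\<close>

text \<open>CMV matrices are banded, so they act on arbitrary sequences, not only on the
  square-summable ones; they are rendered as operators on all sequences. The operator on
  \<open>\<ell>\<^sup>2\<close> is the restriction, and carries the same information (the matrix entries).\<close>

definition cmv_rho :: "complex \<Rightarrow> complex" where
  "cmv_rho a = of_real (sqrt (1 - (norm a)\<^sup>2))"

text \<open>First and second row of the block \<open>\<Theta>(a) = ((cnj a, rho), (rho, - a))\<close> applied to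
  the column \<open>(x, y)\<close>.\<close>

definition Theta_fst :: "complex \<Rightarrow> complex \<Rightarrow> complex \<Rightarrow> complex" where
  "Theta_fst a x y = cnj a * x + cmv_rho a * y"

definition Theta_snd :: "complex \<Rightarrow> complex \<Rightarrow> complex \<Rightarrow> complex" where
  "Theta_snd a x y = cmv_rho a * x - a * y"

definition half_L :: "(nat \<Rightarrow> complex) \<Rightarrow> (nat \<Rightarrow> complex) \<Rightarrow> nat \<Rightarrow> complex" where
  "half_L \<alpha> u m =
     (if even m then Theta_fst (\<alpha> m) (u m) (u (m + 1))
      else Theta_snd (\<alpha> (m - 1)) (u (m - 1)) (u m))"

definition half_M :: "(nat \<Rightarrow> complex) \<Rightarrow> (nat \<Rightarrow> complex) \<Rightarrow> nat \<Rightarrow> complex" where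
  "half_M \<alpha> u m =
     (if m = 0 then u 0
      else if odd m then Theta_fst (\<alpha> m) (u m) (u (m + 1))
      else Theta_snd (\<alpha> (m - 1)) (u (m - 1)) (u m))"

definition half_line_cmv :: "(nat \<Rightarrow> complex) \<Rightarrow> (nat \<Rightarrow> complex) \<Rightarrow> (nat \<Rightarrow> complex)" where
  "half_line_cmv \<alpha> = half_L \<alpha> \<circ> half_M \<alpha>"

definition whole_L :: "(int \<Rightarrow> complex) \<Rightarrow> (int \<Rightarrow> complex) \<Rightarrow> int \<Rightarrow> complex" where
  "whole_L a u m =
     (if even m then Theta_fst (a m) (u m) (u (m + 1))
      else Theta_snd (a (m - 1)) (u (m - 1)) (u m))"

definition whole_M :: "(int \<Rightarrow> complex) \<Rightarrow> (int \<Rightarrow> complex) \<Rightarrow> int \<Rightarrow> complex" where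
  "whole_M a u m =
     (if odd m then Theta_fst (a m) (u m) (u (m + 1))
      else Theta_snd (a (m - 1)) (u (m - 1)) (u m))"

definition whole_line_cmv :: "(int \<Rightarrow> complex) \<Rightarrow> (int \<Rightarrow> complex) \<Rightarrow> (int \<Rightarrow> complex)" where
  "whole_line_cmv a = whole_L a \<circ> whole_M a"

definition whole_line_coeffs :: "(int \<Rightarrow> complex) \<Rightarrow> ((int \<Rightarrow> complex) \<Rightarrow> (int \<Rightarrow> complex)) \<Rightarrow> bool" where
  "whole_line_coeffs a E \<longleftrightarrow> (\<forall>n. norm (a n) \<le> 1) \<and> E = whole_line_cmv a"

section \<open>Spectral measure and its absolutely continuous part\<close>

definition delta0 :: "nat \<Rightarrow> complex" where
  "delta0 n = (if n = 0 then 1 else 0)"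

text \<open>The spectral measure of the unitary \<open>C\<close> at the cyclic vector \<open>\<delta>\<^sub>0\<close>: the probability
  measure on the unit circle with \<open>\<langle>\<delta>\<^sub>0, C\<^sup>k \<delta>\<^sub>0\<rangle> = \<integral> z\<^sup>k d\<mu>\<close>. The identities for negative \<open>k\<close>
  are the complex conjugates of those for positive \<open>k\<close>.\<close>

definition spectral_measure ::
    "((nat \<Rightarrow> complex) \<Rightarrow> (nat \<Rightarrow> complex)) \<Rightarrow> complex measure \<Rightarrow> bool" where
  "spectral_measure C \<mu> \<longleftrightarrow>
     prob_space \<mu> \<and> sets \<mu> = sets borel \<and> (AE z in \<mu>. z \<in> sphere 0 1) \<and>
     (\<forall>k. (C ^^ k) delta0 0 = (\<integral>z. z ^ k \<partial>\<mu>))"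

text \<open>The measure \<open>d\<theta>\<close> on the circle, of total mass \<open>2\<pi>\<close>.\<close>

definition circle_lebesgue :: "complex measure" where
  "circle_lebesgue = distr (restrict_space lborel {0..<2 * pi}) borel cis"

text \<open>Lebesgue decomposition \<open>d\<mu> = w d\<theta> + d\<mu>\<^sub>s\<close>, with \<open>w\<close> as a function of the point
  \<open>cis \<theta>\<close>; only its values on the circle matter.\<close>

definition ac_density :: "complex measure \<Rightarrow> (complex \<Rightarrow> real) \<Rightarrow> bool" where
  "ac_density \<mu> w \<longleftrightarrow>
     w \<in> borel_measurable borel \<and> (\<forall>z. 0 \<le> w z) \<and>
     (\<exists>\<mu>s N. sets \<mu>s = sets borel \<and> N \<in> null_sets circle_lebesgue \<and> emeasure \<mu>s (- N) = 0 \<and>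
       (\<forall>B \<in> sets borel.
          emeasure \<mu> B = emeasure (density circle_lebesgue (\<lambda>z. ennreal (w z))) B + emeasure \<mu>s B))"

text \<open>\<open>A\<close> is a Borel representative of \<open>\<Sigma>\<^sub>a\<^sub>c\<close>, which is defined up to null sets.\<close>

definition ac_essential_support :: "complex measure \<Rightarrow> complex set \<Rightarrow> bool" where
  "ac_essential_support \<mu> A \<longleftrightarrow>
     A \<in> sets borel \<and> A \<subseteq> sphere 0 1 \<and>
     (\<exists>w. ac_density \<mu> w \<and> (AE z in circle_lebesgue. z \<in> A \<longleftrightarrow> 0 < w z))"

section \<open>Right limits\<close>

text \<open>The truncation in \<open>nat\<close> affects only finitely many \<open>j\<close> for each \<open>n\<close>.\<close>

definition seq_right_limit :: "(nat \<Rightarrow> complex) \<Rightarrow> (int \<Rightarrow> complex) \<Rightarrow> bool" where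
  "seq_right_limit \<alpha> a \<longleftrightarrow>
     (\<forall>n. norm (a n) \<le> 1) \<and>
     (\<exists>s :: nat \<Rightarrow> int. filterlim s at_top sequentially \<and>
        (\<forall>n. (\<lambda>j. \<alpha> (nat (n + s j))) \<longlonglongrightarrow> a n))"

definition cmv_right_limit ::
    "(nat \<Rightarrow> complex) \<Rightarrow> ((int \<Rightarrow> complex) \<Rightarrow> (int \<Rightarrow> complex)) \<Rightarrow> bool" where
  "cmv_right_limit \<alpha> E \<longleftrightarrow> (\<exists>a. seq_right_limit \<alpha> a \<and> E = whole_line_cmv a)"

section \<open>Schur functions\<close>

definition schur :: "(complex \<Rightarrow> complex) \<Rightarrow> bool" where
  "schur f \<longleftrightarrow> f holomorphic_on ball 0 1 \<and> (\<forall>z \<in> ball 0 1. norm (f z) \<le> 1)"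

text \<open>\<open>F n\<close> is the \<open>n\<close>-th Schur iterate of \<open>f\<close>. It is constrained only as long as the
  algorithm has not stopped; if \<open>n\<close> is the first index with \<open>\<bar>\<gamma> n\<bar> = 1\<close>, then \<open>F n\<close> is the
  constant \<open>\<gamma> n\<close> by the maximum principle, and the later parameters are ignored.\<close>

definition has_schur_params :: "(complex \<Rightarrow> complex) \<Rightarrow> (nat \<Rightarrow> complex) \<Rightarrow> bool" where
  "has_schur_params f \<gamma> \<longleftrightarrow>
     (\<exists>F :: nat \<Rightarrow> complex \<Rightarrow> complex. F 0 = f \<and>
        (\<forall>n. (\<forall>k<n. norm (\<gamma> k) < 1) \<longrightarrow> schur (F n) \<and> F n 0 = \<gamma> n) \<and>
        (\<forall>n. (\<forall>k\<le>n. norm (\<gamma> k) < 1) \<longrightarrow>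
           (\<forall>z \<in> ball 0 1. z * F (Suc n) z = (F n z - \<gamma> n) / (1 - cnj (\<gamma> n) * F n z))))"

text \<open>For \<open>\<bar>\<gamma> n\<bar> \<le> 1\<close> such a function exists and is unique on the open unit disc; the
  values off the disc are never used.\<close>

definition schur_fun :: "(nat \<Rightarrow> complex) \<Rightarrow> complex \<Rightarrow> complex" where
  "schur_fun \<gamma> = (SOME f. has_schur_params f \<gamma>)"

definition has_radial_limit :: "(complex \<Rightarrow> complex) \<Rightarrow> complex \<Rightarrow> complex \<Rightarrow> bool" where
  "has_radial_limit f z l \<longleftrightarrow> ((\<lambda>r :: real. f (of_real r * z)) \<longlongrightarrow> l) (at_left 1)"

section \<open>Reflectionless whole-line CMV matrices\<close>

definition f_plus :: "(int \<Rightarrow> complex) \<Rightarrow> int \<Rightarrow> complex \<Rightarrow> complex" where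
  "f_plus a n = schur_fun (\<lambda>k. a (n + int k))"

definition f_minus :: "(int \<Rightarrow> complex) \<Rightarrow> int \<Rightarrow> complex \<Rightarrow> complex" where
  "f_minus a n = schur_fun (\<lambda>k. - cnj (a (n - 1 - int k)))"

definition seq_reflectionless_on :: "(int \<Rightarrow> complex) \<Rightarrow> complex set \<Rightarrow> bool" where
  "seq_reflectionless_on a A \<longleftrightarrow>
     (\<forall>n. AE z in circle_lebesgue. z \<in> A \<longrightarrow>
        (\<exists>u v. has_radial_limit (f_plus a n) z u \<and> has_radial_limit (f_minus a n) z v \<and>
               z * u = cnj v))"

text \<open>The matrix determines its coefficients except in degenerate cases with \<open>\<bar>a n\<bar> = 1\<close>
  for some \<open>n\<close>; then no choice of coefficients is reflectionless on a set of positive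
  measure, so that the condition does not depend on the choice.\<close>

definition cmv_reflectionless_on ::
    "((int \<Rightarrow> complex) \<Rightarrow> (int \<Rightarrow> complex)) \<Rightarrow> complex set \<Rightarrow> bool" where
  "cmv_reflectionless_on E A \<longleftrightarrow>
     (\<exists>a. whole_line_coeffs a E) \<and>
     (\<forall>a. whole_line_coeffs a E \<longrightarrow> seq_reflectionless_on a A)"

end

theory Submission
  imports Defs
begin

text \<open>Let \<open>f\<^sub>n\<close> be the Schur iterates of the Schur function of the spectral measure, and let \<open>b\<^sub>n\<close>
  be the Schur function with parameters \<open>- cnj (\<alpha> (n - 1)), \<dots>, - cnj (\<alpha> 0)\<close> followed by a constant
  \<open>c\<close>, \<open>\<bar>c\<bar> < 1\<close>. On the unit circle \<open>z f\<^sub>n(z)\<close> and \<open>cnj (b\<^sub>n(z))\<close> are transported by the same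
  automorphisms of the disc, so their pseudohyperbolic distance does not depend on \<open>n\<close>. Points of the
  absolutely continuous spectrum satisfy \<open>\<bar>f\<^sub>0(z)\<bar> < 1\<close>, and there the initial distance is small for
  suitable \<open>c\<close>. Inside the disc, along the subsequence defining the right limit, \<open>f\<^sub>n\<close> converges to
  its \<open>f_plus\<close> and \<open>b\<^sub>n\<close>, whatever \<open>c\<close> is, to its \<open>f_minus\<close>: by the Schwarz lemma, Schur functions
  sharing \<open>n\<close> parameters differ by at most \<open>2 \<bar>z\<bar>\<^sup>n\<close>. Bounded convergence in the disc implies weak
  convergence of boundary values, so the averages of \<open>z f_plus - cnj f_minus\<close> over a small piece of
  the spectrum are as small as the initial distance there.\<close>

section \<open>The Schur algorithm\<close>

text \<open>Weak convergence of boundary values does not respect products, so no nonlinear relation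
  between \<open>f_n\<close> and \<open>b_n\<close> passes directly to the limit. A bound on the
  integrals of \<open>z f_n - cnj b_n\<close> over sets does pass, being a bound on expressions
  linear in each function; this is why the invariant pseudohyperbolic bound is first weakened to a
  Euclidean one. The comparison functions must be analytic, so \<open>c\<close> is a constant and
  cannot follow the boundary value of \<open>z f_0\<close> from point to point. For a given accuracy
  the spectrum is covered by the sets on which a fixed \<open>cnj c\<close> is close to that value,
  with \<open>c\<close> from a countable dense subset of the disc, so that only countably many null
  sets are discarded. A boundary value of modulus one is at pseudohyperbolic distance 1 from every
  \<open>cnj c\<close>; this is where absolute continuity enters. That the Verblunsky coefficients
  are the Schur parameters of the spectral measure (Geronimus) is obtained from the matrix itself,
  for small \<open>z\<close>, and then continued analytically. Limits with some
  \<open>norm (a n) = 1\<close> get a separate argument, since the matrix then need not determine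
  its coefficients.\<close>

lemma geometric_tendsto_0:
  fixes c x :: real
  assumes "\<bar>x\<bar> < 1"
  shows "(\<lambda>n. c * x ^ n) \<longlonglongrightarrow> 0"
  using tendsto_mult[OF tendsto_const[of c] LIMSEQ_realpow_zero] assms
  by (intro tendsto_mult_right_zero LIMSEQ_power_zero) simp

text \<open>For |g| < 1 this is a disc automorphism and undoes a Schur step. For |g| = 1 it is
  constantly \<open>g\<close> wherever the denominator is nonzero, so the same formula covers the
  stopped algorithm.\<close>

definition mobius :: "complex \<Rightarrow> complex \<Rightarrow> complex" where
  "mobius g x = (g + x) / (1 + cnj g * x)"

lemma norm_mobius_identity:
  "(norm (1 + cnj g * x))\<^sup>2 - (norm (g + x))\<^sup>2 = (1 - (norm g)\<^sup>2) * (1 - (norm x)\<^sup>2)"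
proof -
  have "of_real ((norm (1 + cnj g * x))\<^sup>2 - (norm (g + x))\<^sup>2)
      = (of_real ((1 - (norm g)\<^sup>2) * (1 - (norm x)\<^sup>2)) :: complex)"
    by (simp only: of_real_diff of_real_mult of_real_1 complex_norm_square)
      (simp add: algebra_simps)
  then show ?thesis by (simp only: of_real_eq_iff)
qed

text \<open>The norm identity compares numerator and denominator; where the denominator vanishes,
  the quotient is 0 by convention.\<close>

lemma norm_mobius_le:
  assumes "norm g \<le> 1" "norm x \<le> 1"
  shows "norm (mobius g x) \<le> 1"
proof -
  have "(1 - (norm g)\<^sup>2) * (1 - (norm x)\<^sup>2) \<ge> 0"
    using assms by (intro mult_nonneg_nonneg) (auto simp: power_le_one)
  then have "(norm (g + x))\<^sup>2 \<le> (norm (1 + cnj g * x))\<^sup>2"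
    using norm_mobius_identity[of g x] by linarith
  then have "norm (g + x) \<le> norm (1 + cnj g * x)"
    by (rule power2_le_imp_le) simp
  then show ?thesis
    by (auto simp: mobius_def norm_divide divide_le_eq_1)
qed

lemma one_plus_nonzero:
  fixes x :: complex
  assumes "norm x < 1"
  shows "1 + x \<noteq> 0"
proof
  assume "1 + x = 0"
  then have "x = - 1" by (simp add: add_eq_0_iff)
  with assms show False by simp
qed

lemma norm_mult3_less_one:
  fixes g z w :: complex
  assumes "norm g \<le> 1" "norm z < 1" "norm w \<le> 1"
  shows "norm (g * (z * w)) < 1"
proof -
  have "norm (g * (z * w)) = norm z * (norm g * norm w)" by (simp add: norm_mult)
  also have "\<dots> \<le> norm z * 1" using assms by (intro mult_left_mono mult_le_one) auto
  finally show ?thesis using assms by simp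
qed

lemma mobius_denominator_nonzero:
  assumes "norm g \<le> 1" "norm z < 1" "norm w \<le> 1"
  shows "1 + cnj g * (z * w) \<noteq> 0"
  using norm_mult3_less_one[of "cnj g" z w] assms by (intro one_plus_nonzero) simp

lemma mobius_denominator_nonzero':
  assumes "norm g < 1" "norm x \<le> 1"
  shows "1 + cnj g * x \<noteq> 0"
  using norm_mult3_less_one[of 1 "cnj g" x] assms by (intro one_plus_nonzero) simp

lemma mobius_diff:
  assumes "1 + cnj g * x \<noteq> 0" "1 + cnj g * y \<noteq> 0"
  shows "mobius g x - mobius g y
    = (1 - cnj g * g) * (x - y) / ((1 + cnj g * x) * (1 + cnj g * y))"
  using assms by (simp add: mobius_def divide_simps) (simp add: algebra_simps)

lemma schur_const: "norm w \<le> 1 \<Longrightarrow> schur (\<lambda>_. w)"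
  by (simp add: schur_def)

lemma schur_mobius:
  assumes "norm g \<le> 1" "schur f"
  shows "schur (\<lambda>z. mobius g (z * f z))"
proof -
  have "(\<lambda>z. mobius g (z * f z)) holomorphic_on ball 0 1"
    unfolding mobius_def
    using assms mobius_denominator_nonzero[OF assms(1)]
    by (intro holomorphic_intros) (auto simp: schur_def)
  moreover have "norm (mobius g (z * f z)) \<le> 1" if "z \<in> ball 0 1" for z
  proof (rule norm_mobius_le[OF assms(1)])
    show "norm (z * f z) \<le> 1"
      using that assms(2) unfolding norm_mult by (intro mult_le_one) (auto simp: schur_def)
  qed
  ultimately show ?thesis by (simp add: schur_def)
qed

text \<open>Inverse Schur steps for \<open>n\<close> parameters, started from \<open>w\<close> in
  place of the \<open>n\<close>-th iterate. The value \<open>w\<close> may vary with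
  \<open>z\<close>, so that the true iterate of a function can be inserted.\<close>

fun schur_approx :: "nat \<Rightarrow> (nat \<Rightarrow> complex) \<Rightarrow> complex \<Rightarrow> complex \<Rightarrow> complex" where
  "schur_approx 0 \<gamma> w z = w"
| "schur_approx (Suc n) \<gamma> w z = mobius (\<gamma> 0) (z * schur_approx n (\<gamma> \<circ> Suc) w z)"

lemma schur_schur_approx:
  assumes "\<forall>k. norm (\<gamma> k) \<le> 1" "schur u"
  shows "schur (\<lambda>z. schur_approx n \<gamma> (u z) z)"
  using assms(1)
proof (induction n arbitrary: \<gamma>)
  case 0
  then show ?case using assms by simp
next
  case (Suc n)
  have g: "\<forall>k. norm ((\<gamma> \<circ> Suc) k) \<le> 1" using Suc.prems by simp
  show ?case
    using schur_mobius[OF _ Suc.IH[OF g], of "\<gamma> 0"] Suc.prems by (simp add: o_def)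
qed

text \<open>By \<open>mobius_diff\<close>, each inverse step multiplies the difference by
  \<open>z\<close> and by a factor without poles in the disc. The zero of order \<open>n\<close> is
  recorded as a holomorphic quotient, to which the maximum principle applies.\<close>

lemma schur_approx_diff_factor:
  assumes "\<forall>k. norm (\<gamma> k) \<le> 1" "schur u" "schur v"
  shows "\<exists>h. h holomorphic_on ball 0 1 \<and>
    (\<forall>z \<in> ball 0 1. schur_approx n \<gamma> (u z) z - schur_approx n \<gamma> (v z) z = z ^ n * h z)"
  using assms(1)
proof (induction n arbitrary: \<gamma>)
  case 0
  have "(\<lambda>z. u z - v z) holomorphic_on ball 0 1"
    using assms by (intro holomorphic_intros) (auto simp: schur_def)
  then show ?case by (intro exI[of _ "\<lambda>z. u z - v z"]) auto
next
  case (Suc n)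
  let ?g = "\<gamma> 0"
  let ?a = "\<lambda>z. schur_approx n (\<gamma> \<circ> Suc) (u z) z"
  let ?b = "\<lambda>z. schur_approx n (\<gamma> \<circ> Suc) (v z) z"
  have ab: "schur ?a" "schur ?b"
    using Suc.prems assms by (auto intro!: schur_schur_approx)
  have g: "\<forall>k. norm ((\<gamma> \<circ> Suc) k) \<le> 1" using Suc.prems by simp
  from Suc.IH[OF g] obtain h where h: "h holomorphic_on ball 0 1"
    "\<And>z. z \<in> ball 0 1 \<Longrightarrow> ?a z - ?b z = z ^ n * h z"
    by blast
  have nz: "1 + cnj ?g * (z * ?a z) \<noteq> 0" "1 + cnj ?g * (z * ?b z) \<noteq> 0" if "z \<in> ball 0 1" for z
    using that ab Suc.prems by (intro mobius_denominator_nonzero; simp add: schur_def)+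
  define H where "H = (\<lambda>z. (1 - cnj ?g * ?g) * h z
    / ((1 + cnj ?g * (z * ?a z)) * (1 + cnj ?g * (z * ?b z))))"
  have "H holomorphic_on ball 0 1"
    unfolding H_def using ab nz h(1) by (intro holomorphic_intros) (auto simp: schur_def)
  moreover have "schur_approx (Suc n) \<gamma> (u z) z - schur_approx (Suc n) \<gamma> (v z) z = z ^ Suc n * H z"
    if z: "z \<in> ball 0 1" for z
  proof -
    have "z * ?a z - z * ?b z = z ^ Suc n * h z"
      using h(2)[OF z] by (simp flip: right_diff_distrib)
    then show ?thesis
      using mobius_diff[OF nz[OF z]] by (simp add: H_def)
  qed
  ultimately show ?case by blast
qed

text \<open>On the circle of radius \<open>r\<close> the hypothesis reads
  \<open>norm (h w) \<le> c / r ^ n\<close>; the maximum principle carries this inside, and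
  \<open>r\<close> tending to 1 removes the power.\<close>

lemma schwarz_power:
  assumes h: "h holomorphic_on ball 0 1"
    and bd: "\<And>z. z \<in> ball 0 1 \<Longrightarrow> norm (z ^ n * h z) \<le> c"
    and z: "z \<in> ball 0 1"
  shows "norm (h z) \<le> c"
proof -
  have main: "norm (h z) * r ^ n \<le> c" if r: "norm z < r" "r < 1" for r :: real
  proof -
    have r0: "r > 0" using r norm_ge_zero[of z] by linarith
    have sub: "cball 0 r \<subseteq> ball (0::complex) 1" using r by auto
    have "norm (h z) \<le> c / r ^ n"
    proof (rule maximum_modulus_frontier[of h "ball 0 r"])
      show "h holomorphic_on interior (ball 0 r)"
        using holomorphic_on_subset[OF h] sub by (simp add: subset_eq)
      show "continuous_on (closure (ball 0 r)) h"
        using holomorphic_on_imp_continuous_on[OF holomorphic_on_subset[OF h sub]] r0 by simp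
      fix w :: complex assume "w \<in> frontier (ball 0 r)"
      then have w: "norm w = r" using r0 by simp
      then show "norm (h w) \<le> c / r ^ n"
        using bd[of w] r r0 by (simp add: norm_mult norm_power field_simps)
    qed (use r in auto)
    then show ?thesis using r0 by (simp add: field_simps)
  qed
  have "((\<lambda>r. norm (h z) * r ^ n) \<longlongrightarrow> norm (h z) * 1 ^ n) (at_left 1)"
    by (intro tendsto_intros)
  moreover have "eventually (\<lambda>r. norm (h z) * r ^ n \<le> c) (at_left 1)"
    using eventually_at_left_real[of "norm z" 1] z by (auto elim!: eventually_mono intro: main)
  ultimately have "norm (h z) * 1 ^ n \<le> c"
    by (intro tendsto_upperbound[of _ _ "at_left (1::real)"]) auto
  then show ?thesis by simp
qed

lemma schur_approx_dist:
  assumes "\<forall>k. norm (\<gamma> k) \<le> 1" "schur u" "schur v" and z: "z \<in> ball 0 1"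
  shows "norm (schur_approx n \<gamma> (u z) z - schur_approx n \<gamma> (v z) z) \<le> 2 * norm z ^ n"
proof -
  from schur_approx_diff_factor[OF assms(1-3)] obtain h where h: "h holomorphic_on ball 0 1"
    "\<And>z. z \<in> ball 0 1 \<Longrightarrow>
      schur_approx n \<gamma> (u z) z - schur_approx n \<gamma> (v z) z = z ^ n * h z"
    by meson
  have "norm (h z) \<le> 2"
  proof (rule schwarz_power[OF h(1) _ z])
    fix w :: complex assume w: "w \<in> ball 0 1"
    show "norm (w ^ n * h w) \<le> 2"
      using schur_schur_approx[of \<gamma> u n] schur_schur_approx[of \<gamma> v n] w assms(1-3)
        norm_triangle_ineq4[of "schur_approx n \<gamma> (u w) w" "schur_approx n \<gamma> (v w) w"]
      unfolding h(2)[OF w, symmetric] schur_def by (smt (verit, best))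
  qed
  then show ?thesis
    using h(2)[OF z] by (simp add: norm_mult norm_power mult_right_mono mult.commute[of 2] mult_left_mono)
qed

lemma norm_schur_approx_le:
  assumes "\<forall>k. norm (\<gamma> k) \<le> 1" "norm w \<le> 1" "z \<in> ball 0 1"
  shows "norm (schur_approx n \<gamma> w z) \<le> 1"
  using schur_schur_approx[OF assms(1) schur_const[OF assms(2)]] assms(3)
  by (auto simp: schur_def)

lemma schur_approx_add:
  "schur_approx (n + k) \<gamma> w z = schur_approx n \<gamma> (schur_approx k (\<lambda>j. \<gamma> (n + j)) w z) z"
  by (induction n arbitrary: \<gamma>) (auto simp: o_def)

lemma schur_approx_dist_const:
  assumes "\<forall>k. norm (\<gamma> k) \<le> 1" "norm u \<le> 1" "norm v \<le> 1" "z \<in> ball 0 1"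
  shows "norm (schur_approx n \<gamma> u z - schur_approx n \<gamma> v z) \<le> 2 * norm z ^ n"
  using schur_approx_dist[OF assms(1) schur_const schur_const, of u v z n] assms by simp

definition schur_lim :: "(nat \<Rightarrow> complex) \<Rightarrow> complex \<Rightarrow> complex" where
  "schur_lim \<gamma> z = lim (\<lambda>n. schur_approx n \<gamma> 0 z)"

text \<open>Approximants of order at least \<open>N\<close> agree in their first \<open>N\<close>
  parameters, so each lies within \<open>2 * norm z ^ N\<close> of the \<open>N\<close>-th, and two
  of them within twice that.\<close>

lemma schur_approx_tendsto:
  assumes "\<forall>k. norm (\<gamma> k) \<le> 1" and z: "z \<in> ball 0 1"
  shows "(\<lambda>n. schur_approx n \<gamma> 0 z) \<longlonglongrightarrow> schur_lim \<gamma> z"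
proof -
  have d: "norm (schur_approx (n + k) \<gamma> 0 z - schur_approx n \<gamma> 0 z) \<le> 2 * norm z ^ n" for n k
    unfolding schur_approx_add
    by (intro schur_approx_dist_const norm_schur_approx_le z) (simp_all add: assms)
  have "Cauchy (\<lambda>n. schur_approx n \<gamma> 0 z)"
  proof (rule CauchyI)
    fix e :: real assume "e > 0"
    have "(\<lambda>n. 4 * norm z ^ n) \<longlonglongrightarrow> 0"
      using z by (intro geometric_tendsto_0) simp
    then obtain N where N: "4 * norm z ^ N < e"
      using \<open>e > 0\<close> order_tendstoD(2)[of "\<lambda>n. 4 * norm z ^ n" 0 sequentially e]
      by (auto simp: eventually_sequentially)
    have "norm (schur_approx m \<gamma> 0 z - schur_approx n \<gamma> 0 z) < e" if "m \<ge> N" "n \<ge> N" for m n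
    proof -
      have "norm (schur_approx m \<gamma> 0 z - schur_approx n \<gamma> 0 z) \<le> 4 * norm z ^ N"
        using d[of N "m - N"] d[of N "n - N"] that
          norm_triangle_ineq4[of "schur_approx m \<gamma> 0 z - schur_approx N \<gamma> 0 z"
            "schur_approx n \<gamma> 0 z - schur_approx N \<gamma> 0 z"]
        by simp
      with N show ?thesis by linarith
    qed
    then show "\<exists>M. \<forall>m\<ge>M. \<forall>n\<ge>M. norm (schur_approx m \<gamma> 0 z - schur_approx n \<gamma> 0 z) < e"
      by blast
  qed
  then show ?thesis
    unfolding schur_lim_def using Cauchy_convergent convergent_LIMSEQ_iff by blast
qed

lemma norm_schur_lim_le:
  assumes "\<forall>k. norm (\<gamma> k) \<le> 1" and z: "z \<in> ball 0 1"
  shows "norm (schur_lim \<gamma> z) \<le> 1"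
  using tendsto_norm[OF schur_approx_tendsto[OF assms]]
  by (rule tendsto_upperbound) (auto intro!: always_eventually norm_schur_approx_le assms)

lemma schur_lim_rec:
  assumes "\<forall>k. norm (\<gamma> k) \<le> 1" and z: "z \<in> ball 0 1"
  shows "schur_lim \<gamma> z = mobius (\<gamma> 0) (z * schur_lim (\<gamma> \<circ> Suc) z)"
proof (rule LIMSEQ_unique)
  have g: "\<forall>k. norm ((\<gamma> \<circ> Suc) k) \<le> 1" using assms by simp
  show "(\<lambda>n. schur_approx (Suc n) \<gamma> 0 z) \<longlonglongrightarrow> schur_lim \<gamma> z"
    using schur_approx_tendsto[OF assms] by (subst filterlim_sequentially_Suc)
  show "(\<lambda>n. schur_approx (Suc n) \<gamma> 0 z) \<longlonglongrightarrow> mobius (\<gamma> 0) (z * schur_lim (\<gamma> \<circ> Suc) z)"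
    unfolding schur_approx.simps mobius_def
    by (intro tendsto_intros schur_approx_tendsto[OF g z] mobius_denominator_nonzero
        norm_schur_lim_le[OF g z]) (use assms in auto)
qed

lemma schur_lim_eq_approx:
  assumes "\<forall>k. norm (\<gamma> k) \<le> 1" and z: "z \<in> ball 0 1"
  shows "schur_lim \<gamma> z = schur_approx n \<gamma> (schur_lim (\<lambda>j. \<gamma> (n + j)) z) z"
  using assms(1)
proof (induction n arbitrary: \<gamma>)
  case 0
  then show ?case by simp
next
  case (Suc n)
  have g: "\<forall>k. norm ((\<gamma> \<circ> Suc) k) \<le> 1" using Suc.prems by simp
  show ?case
    using schur_lim_rec[OF Suc.prems z] Suc.IH[OF g] by (simp add: o_def)
qed

lemma schur_lim_dist:
  assumes "\<forall>k. norm (\<gamma> k) \<le> 1" "norm w \<le> 1" and z: "z \<in> ball 0 1"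
  shows "norm (schur_approx n \<gamma> w z - schur_lim \<gamma> z) \<le> 2 * norm z ^ n"
  by (subst schur_lim_eq_approx[OF assms(1) z, of n])
     (intro schur_approx_dist_const norm_schur_lim_le assms, simp_all add: assms)

lemma schur_schur_lim:
  assumes g: "\<forall>k. norm (\<gamma> k) \<le> 1"
  shows "schur (schur_lim \<gamma>)"
proof -
  have "schur_lim \<gamma> holomorphic_on ball 0 1"
  proof (rule holomorphic_uniform_sequence)
    show "(\<lambda>z. schur_approx n \<gamma> 0 z) holomorphic_on ball 0 1" for n
      using schur_schur_approx[OF g schur_const[of 0], of n] by (simp add: schur_def)
    fix x :: complex assume x: "x \<in> ball 0 1"
    define d where "d = (1 - norm x) / 2"
    have d: "d > 0" "norm x + d < 1" using x by (auto simp: d_def field_simps)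
    have sub: "norm y \<le> norm x + d" if "y \<in> cball x d" for y
      using that norm_triangle_sub[of y x] by (auto simp: dist_norm norm_minus_commute)
    have "uniform_limit (cball x d) (\<lambda>n z. schur_approx n \<gamma> 0 z) (schur_lim \<gamma>) sequentially"
    proof (rule uniform_limitI)
      fix e :: real assume "e > 0"
      have "(\<lambda>n. 2 * (norm x + d) ^ n) \<longlonglongrightarrow> 0"
        using d by (intro geometric_tendsto_0) (simp add: add_nonneg_pos)
      then have "eventually (\<lambda>n. 2 * (norm x + d) ^ n < e) sequentially"
        using \<open>e > 0\<close> by (intro order_tendstoD(2)) auto
      then show "eventually (\<lambda>n. \<forall>y\<in>cball x d. dist (schur_approx n \<gamma> 0 y) (schur_lim \<gamma> y) < e)
          sequentially"
      proof eventually_elim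
        case (elim n)
        show ?case
        proof
          fix y assume y: "y \<in> cball x d"
          have "norm (schur_approx n \<gamma> 0 y - schur_lim \<gamma> y) \<le> 2 * norm y ^ n"
            using sub[OF y] d by (intro schur_lim_dist g) auto
          also have "\<dots> \<le> 2 * (norm x + d) ^ n"
            using sub[OF y] by (intro mult_left_mono power_mono) auto
          finally show "dist (schur_approx n \<gamma> 0 y) (schur_lim \<gamma> y) < e"
            using elim by (simp add: dist_norm)
        qed
      qed
    qed
    moreover have "cball x d \<subseteq> ball 0 1" using sub d by fastforce
    ultimately show "\<exists>d>0. cball x d \<subseteq> ball 0 1 \<and>
        uniform_limit (cball x d) (\<lambda>n z. schur_approx n \<gamma> 0 z) (schur_lim \<gamma>) sequentially"
      using d by blast
  qed simp
  with norm_schur_lim_le[OF g] show ?thesis by (simp add: schur_def)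
qed

lemma schur_lim_zero: "(\<forall>k. norm (\<gamma> k) \<le> 1) \<Longrightarrow> schur_lim \<gamma> 0 = \<gamma> 0"
  by (subst schur_lim_rec) (auto simp: mobius_def)

section \<open>Existence and uniqueness of the Schur function with given parameters\<close>

lemma mobius_inverse:
  assumes "norm g < 1" "norm x \<le> 1"
  shows "x = (mobius g x - g) / (1 - cnj g * mobius g x)"
proof -
  have nz: "1 + cnj g * x \<noteq> 0" by (rule mobius_denominator_nonzero'[OF assms])
  have "norm (cnj g * g) < 1"
    using assms norm_mult3_less_one[of 1 g "cnj g"] by (simp add: mult.commute)
  then have nz': "1 - cnj g * g \<noteq> 0" by (metis eq_iff_diff_eq_0 norm_one order_less_irrefl)
  have "mobius g x - g = (1 - cnj g * g) * x / (1 + cnj g * x)"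
    "1 - cnj g * mobius g x = (1 - cnj g * g) / (1 + cnj g * x)"
    using nz by (simp_all add: mobius_def divide_simps) (simp_all add: algebra_simps)
  with nz nz' show ?thesis by simp
qed

lemma mobius_inverse':
  assumes "norm g < 1" "norm y \<le> 1" "x = (y - g) / (1 - cnj g * y)"
  shows "y = mobius g x"
proof -
  have "x = mobius (- g) y" using assms(3) by (simp add: mobius_def)
  then show ?thesis
    using mobius_inverse[of "- g" y] assms by (simp add: mobius_def add.commute)
qed

lemma has_schur_params_schur_lim:
  assumes "\<forall>k. norm (\<gamma> k) \<le> 1"
  shows "has_schur_params (schur_lim \<gamma>) \<gamma>"
proof -
  define F where "F n = schur_lim (\<lambda>j. \<gamma> (n + j))" for n
  have S: "schur (F n)" "F n 0 = \<gamma> n" for n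
    unfolding F_def using schur_schur_lim schur_lim_zero[of "\<lambda>j. \<gamma> (n + j)"] assms by auto
  have "z * F (Suc n) z = (F n z - \<gamma> n) / (1 - cnj (\<gamma> n) * F n z)"
    if "norm (\<gamma> n) < 1" "z \<in> ball 0 1" for n z
  proof -
    have "F n z = mobius (\<gamma> n) (z * F (Suc n) z)"
      unfolding F_def using schur_lim_rec[of "\<lambda>j. \<gamma> (n + j)" z] assms that by (simp add: o_def)
    moreover have "norm (z * F (Suc n) z) \<le> 1"
      using S(1)[of "Suc n"] that(2) unfolding schur_def norm_mult by (intro mult_le_one) auto
    ultimately show ?thesis
      using mobius_inverse[OF that(1)] by simp
  qed
  with S show ?thesis
    unfolding has_schur_params_def by (intro exI[of _ F]) (auto simp: F_def)
qed

lemma schur_unimodular_const: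
  assumes "schur f" "norm (f 0) = 1" "z \<in> ball 0 1"
  shows "f z = f 0"
proof -
  have "f constant_on ball 0 1"
    by (rule maximum_modulus_principle[of f "ball 0 1" "ball 0 1" 0])
       (use assms in \<open>auto simp: schur_def\<close>)
  then show ?thesis using assms(3) by (auto simp: constant_on_def)
qed

text \<open>If the algorithm never stops, both functions share any number of parameters, so their
  distance is at most \<open>2 * norm z ^ n\<close> for all \<open>n\<close>. Otherwise, at the
  first unimodular parameter both iterates are the same constant by the maximum principle; the later
  parameters, which \<open>schur_lim\<close> still reads, have no effect.\<close>

lemma schur_params_unique:
  assumes g: "\<forall>k. norm (\<gamma> k) \<le> 1" and f: "has_schur_params f \<gamma>" and z: "z \<in> ball 0 1"
  shows "f z = schur_lim \<gamma> z"
proof -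
  from f obtain F where F: "F 0 = f"
    "\<And>n. (\<And>k. k < n \<Longrightarrow> norm (\<gamma> k) < 1) \<Longrightarrow> schur (F n) \<and> F n 0 = \<gamma> n"
    "\<And>n z. (\<And>k. k \<le> n \<Longrightarrow> norm (\<gamma> k) < 1) \<Longrightarrow> z \<in> ball 0 1 \<Longrightarrow>
        z * F (Suc n) z = (F n z - \<gamma> n) / (1 - cnj (\<gamma> n) * F n z)"
    unfolding has_schur_params_def by metis
  have iter: "f z = schur_approx n \<gamma> (F n z) z" if "\<And>k. k < n \<Longrightarrow> norm (\<gamma> k) < 1" for n
    using that
  proof (induction n)
    case (Suc n)
    have "norm (F n z) \<le> 1" using F(2)[of n] Suc.prems z by (auto simp: schur_def)
    then have "F n z = mobius (\<gamma> n) (z * F (Suc n) z)"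
      using F(3)[of n z] Suc.prems z by (intro mobius_inverse') auto
    then show ?case
      using Suc schur_approx_add[of n 1 \<gamma> "F (Suc n) z" z] by simp
  qed (use F in auto)
  show ?thesis
  proof (cases "\<forall>k. norm (\<gamma> k) < 1")
    case True
    have "norm (f z - schur_lim \<gamma> z) \<le> 2 * norm z ^ n" for n
      using schur_lim_dist[of \<gamma> "F n z" z n] iter[of n] F(2)[of n] g z True
      by (auto simp: schur_def)
    moreover have "(\<lambda>n. 2 * norm z ^ n) \<longlonglongrightarrow> 0"
      using z by (intro geometric_tendsto_0) simp
    ultimately have "norm (f z - schur_lim \<gamma> z) \<le> 0"
      by (intro tendsto_lowerbound[of "\<lambda>n. 2 * norm z ^ n" _ sequentially]) auto
    then show ?thesis by simp
  next
    case False
    define n where "n = (LEAST k. \<not> norm (\<gamma> k) < 1)"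
    have ex: "\<exists>k. \<not> norm (\<gamma> k) < 1" using False by blast
    have n: "\<not> norm (\<gamma> n) < 1" "\<And>k. k < n \<Longrightarrow> norm (\<gamma> k) < 1"
      using LeastI_ex[OF ex] not_less_Least[of _ "\<lambda>k. \<not> norm (\<gamma> k) < 1"]
      unfolding n_def by blast+
    have 1: "norm (\<gamma> n) = 1" using n(1) spec[OF g, of n] by linarith
    have "F n z = \<gamma> n" using schur_unimodular_const[of "F n" z] F(2)[of n] n(2) 1 z by auto
    moreover have "schur_lim (\<lambda>j. \<gamma> (n + j)) z = \<gamma> n"
      using schur_unimodular_const[of "schur_lim (\<lambda>j. \<gamma> (n + j))" z]
        schur_schur_lim[of "\<lambda>j. \<gamma> (n + j)"] schur_lim_zero[of "\<lambda>j. \<gamma> (n + j)"] g 1 z by auto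
    ultimately show ?thesis
      using iter[OF n(2)] schur_lim_eq_approx[OF g z, of n] by simp
  qed
qed

lemma schur_fun_eq:
  assumes "\<forall>k. norm (\<gamma> k) \<le> 1" "z \<in> ball 0 1"
  shows "schur_fun \<gamma> z = schur_lim \<gamma> z"
  unfolding schur_fun_def
  by (rule schur_params_unique[OF assms(1) _ assms(2)])
     (rule someI[of "\<lambda>f. has_schur_params f \<gamma>"], rule has_schur_params_schur_lim, rule assms)

lemma schur_approx_tendsto_params:
  assumes "\<forall>k. norm (\<gamma> k) \<le> 1" "\<And>j. \<forall>k. norm (G j k) \<le> 1" "norm w \<le> 1" and z: "z \<in> ball 0 1"
    and "\<And>k. k < n \<Longrightarrow> (\<lambda>j. G j k) \<longlonglongrightarrow> \<gamma> k"
  shows "(\<lambda>j. schur_approx n (G j) w z) \<longlonglongrightarrow> schur_approx n \<gamma> w z"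
  using assms(1,2,5)
proof (induction n arbitrary: \<gamma> G)
  case (Suc n)
  have IH: "(\<lambda>j. schur_approx n (G j \<circ> Suc) w z) \<longlonglongrightarrow> schur_approx n (\<gamma> \<circ> Suc) w z"
    by (rule Suc.IH) (use Suc.prems in auto)
  show ?case
    unfolding schur_approx.simps mobius_def
    by (intro tendsto_intros IH Suc.prems(3) mobius_denominator_nonzero norm_schur_approx_le)
       (use Suc.prems assms in auto)
qed simp

text \<open>Exchange of limits by splitting the error in three. The threshold \<open>N n\<close>
  serves approximations of order \<open>n\<close> that are valid only once the \<open>j\<close>-th
  object has at least \<open>n\<close> parameters.\<close>

lemma tendsto_approx_family:
  fixes f :: "nat \<Rightarrow> 'a::real_normed_vector"
  assumes "\<And>n j. j \<ge> N n \<Longrightarrow> norm (p n j - f j) \<le> c n" "\<And>n. norm (q n - l) \<le> c n"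
    and "\<And>n. p n \<longlonglongrightarrow> q n" "c \<longlonglongrightarrow> 0"
  shows "f \<longlonglongrightarrow> l"
proof (rule LIMSEQ_I)
  fix e :: real assume "e > 0"
  then obtain n where n: "c n < e / 3"
    using order_tendstoD(2)[OF assms(4), of "e/3"] by (auto simp: eventually_sequentially)
  obtain M where M: "\<And>j. j \<ge> M \<Longrightarrow> norm (p n j - q n) < e / 3"
    using LIMSEQ_D[OF assms(3)[of n], of "e/3"] \<open>e > 0\<close> by auto
  have "norm (f j - l) < e" if "j \<ge> max M (N n)" for j
  proof -
    have "norm ((p n j - q n) + (q n - l) - (p n j - f j))
        \<le> norm (p n j - q n) + norm (q n - l) + norm (p n j - f j)"
      using norm_triangle_ineq4 norm_triangle_ineq add_mono order_trans
      by (smt (verit))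
    then show ?thesis
      using assms(1)[of n j] assms(2)[of n] M[of j] n that by (simp add: algebra_simps)
  qed
  then show "\<exists>no. \<forall>j\<ge>no. norm (f j - l) < e" by blast
qed

lemma schur_lim_tendsto_params:
  assumes g: "\<forall>k. norm (\<gamma> k) \<le> 1" and G: "\<And>j. \<forall>k. norm (G j k) \<le> 1" and z: "z \<in> ball 0 1"
    and lim: "\<And>k. (\<lambda>j. G j k) \<longlonglongrightarrow> \<gamma> k"
  shows "(\<lambda>j. schur_lim (G j) z) \<longlonglongrightarrow> schur_lim \<gamma> z"
proof (rule tendsto_approx_family[where N = "\<lambda>_. 0"])
  show "norm (schur_approx n (G j) 0 z - schur_lim (G j) z) \<le> 2 * norm z ^ n" for n j
    by (rule schur_lim_dist[OF G _ z]) simp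
  show "norm (schur_approx n \<gamma> 0 z - schur_lim \<gamma> z) \<le> 2 * norm z ^ n" for n
    by (rule schur_lim_dist[OF g _ z]) simp
  show "(\<lambda>j. schur_approx n (G j) 0 z) \<longlonglongrightarrow> schur_approx n \<gamma> 0 z" for n
    by (rule schur_approx_tendsto_params[OF g G _ z lim]) simp
  show "(\<lambda>n. 2 * norm z ^ n) \<longlonglongrightarrow> 0"
    using z by (intro geometric_tendsto_0) simp
qed

section \<open>Boundary behaviour of Poisson integrals\<close>

lemma set_integrable_lborel_bounded:
  fixes f :: "real \<Rightarrow> 'b::{banach,second_countable_topology}"
  assumes [measurable]: "f \<in> borel_measurable borel" and A[measurable]: "A \<in> sets borel"
    and "A \<subseteq> {a..b}" and M: "\<And>x. x \<in> A \<Longrightarrow> norm (f x) \<le> M"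
  shows "set_integrable lborel A f"
  unfolding set_integrable_def
proof (rule integrableI_bounded_set_indicator[where B = M])
  have "emeasure lborel A \<le> emeasure lborel {a..b}"
    by (rule emeasure_mono) (use assms in auto)
  also have "\<dots> < \<infinity>" by (cases "a \<le> b") auto
  finally show "emeasure lborel A < \<infinity>" .
qed (use M in auto)

text \<open>Since \<psi> is merely measurable, its primitive is not differentiated. Instead
  \<open>k t *\<^sub>R \<psi> s\<close> is integrated over the triangle
  \<open>0 \<le> s \<le> t \<le> d\<close> in both orders; the inner integral over \<open>t\<close>
  is evaluated by the fundamental theorem for \<open>p\<close>.\<close>

lemma integral_by_parts_bounded:
  fixes k p :: "real \<Rightarrow> real" and \<psi> :: "real \<Rightarrow> 'b::euclidean_space"
  assumes p: "\<And>t. (p has_real_derivative k t) (at t)" and k: "continuous_on UNIV k"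
    and [measurable]: "\<psi> \<in> borel_measurable borel" and M: "\<And>x. norm (\<psi> x) \<le> M" and d: "0 \<le> d"
  shows "(LBINT s:{0..d}. p s *\<^sub>R \<psi> s)
    = p d *\<^sub>R (LBINT s:{0..d}. \<psi> s) - (LBINT t:{0..d}. k t *\<^sub>R (LBINT s:{0..t}. \<psi> s))"
proof -
  have [measurable]: "k \<in> borel_measurable lborel" "\<psi> \<in> borel_measurable lborel"
    using k by (simp_all add: borel_measurable_continuous_onI)
  have "continuous_on UNIV p"
    using p by (meson DERIV_continuous continuous_at_imp_continuous_on)
  then have [measurable]: "p \<in> borel_measurable borel" and pc: "continuous_on {0..d} p"
    by (auto simp: borel_measurable_continuous_onI intro: continuous_on_subset)
  have M0: "0 \<le> M" using M[of 0] norm_ge_zero order_trans by blast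
  have "compact (k ` {0..d})" "compact (p ` {0..d})"
    using continuous_on_subset[OF k] pc by (auto intro!: compact_continuous_image)
  then obtain K K' where K: "\<And>t. t \<in> {0..d} \<Longrightarrow> norm (k t) \<le> K"
    and K': "\<And>t. t \<in> {0..d} \<Longrightarrow> norm (p t) \<le> K'"
    by (metis (no_types, lifting) bounded_iff compact_imp_bounded image_eqI)
  have K0: "0 \<le> K" using K[of 0] d norm_ge_zero order_trans by fastforce
  define F where "F = (\<lambda>t s. (if 0 \<le> s \<and> s \<le> t \<and> t \<le> d then k t *\<^sub>R \<psi> s else 0))"
  have int: "integrable (lborel \<Otimes>\<^sub>M lborel) (\<lambda>(t, s). F t s)"
  proof (rule integrableI_bounded_set[where A = "{0..d} \<times> {0..d}" and B = "K * M"])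
    show "(\<lambda>(t, s). F t s) \<in> borel_measurable (lborel \<Otimes>\<^sub>M lborel)"
      unfolding F_def by measurable
    show "AE x in lborel \<Otimes>\<^sub>M lborel. x \<notin> {0..d} \<times> {0..d} \<longrightarrow> (case x of (t, s) \<Rightarrow> F t s) = 0"
      by (rule AE_I2) (auto simp: F_def split: if_splits)
    have "norm (F t s) \<le> K * M" for t s
    proof (cases "t \<in> {0..d} \<and> s \<in> {0..t}")
      case True
      then show ?thesis using K[of t] M[of s] K0 by (auto simp: F_def intro!: mult_mono)
    next
      case False
      then show ?thesis using M0 K0 by (auto simp: F_def)
    qed
    then show "AE x in lborel \<Otimes>\<^sub>M lborel. x \<in> {0..d} \<times> {0..d} \<longrightarrow>
        norm (case x of (t, s) \<Rightarrow> F t s) \<le> K * M"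
      by auto
    show "emeasure (lborel \<Otimes>\<^sub>M lborel) ({0..d} \<times> {0..d}) < \<infinity>"
      using d by (subst lborel.emeasure_pair_measure_Times) (auto simp: ennreal_mult_less_top)
  qed auto
  have "(LBINT s. LBINT t. F t s) = (LBINT t. LBINT s. F t s)"
    by (rule lborel_pair.Fubini_integral[OF int])
  also have "(\<lambda>t. LBINT s. F t s)
      = (\<lambda>t. indicator {0..d} t *\<^sub>R k t *\<^sub>R (LBINT s:{0..t}. \<psi> s))"
  proof
    fix t
    have "F t = (\<lambda>s. (indicator {0..d} t * k t) *\<^sub>R (indicator {0..t} s *\<^sub>R \<psi> s))"
      by (auto simp: F_def fun_eq_iff indicator_def)
    then have "(LBINT s. F t s)
        = (indicator {0..d} t * k t) *\<^sub>R (LBINT s. indicator {0..t} s *\<^sub>R \<psi> s)"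
      by (simp only: integral_scaleR_right)
    then show "(LBINT s. F t s) = indicator {0..d} t *\<^sub>R k t *\<^sub>R (LBINT s:{0..t}. \<psi> s)"
      by (simp add: set_lebesgue_integral_def)
  qed
  also have "(LBINT t. indicator {0..d} t *\<^sub>R k t *\<^sub>R (LBINT s:{0..t}. \<psi> s))
      = (LBINT t:{0..d}. k t *\<^sub>R (LBINT s:{0..t}. \<psi> s))"
    by (simp add: set_lebesgue_integral_def)
  also have "(\<lambda>s. LBINT t. F t s) = (\<lambda>s. indicator {0..d} s *\<^sub>R (p d - p s) *\<^sub>R \<psi> s)"
  proof
    fix s
    have "set_integrable lborel {s..d} k"
      by (rule borel_integrable_atLeastAtMost') (rule continuous_on_subset[OF k], simp)
    then have ik: "integrable lborel (\<lambda>t. indicator {s..d} t *\<^sub>R k t)"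
      by (simp only: set_integrable_def)
    have "F t s = (indicator {s..d} t *\<^sub>R k t) *\<^sub>R (indicator {0..d} s *\<^sub>R \<psi> s)" for t
      by (auto simp: F_def indicator_def)
    then have "(LBINT t. F t s) = (LBINT t. indicator {s..d} t *\<^sub>R k t) *\<^sub>R (indicator {0..d} s *\<^sub>R \<psi> s)"
      by (simp only: integral_scaleR_left[OF ik])
    moreover have "(LBINT t. indicator {s..d} t *\<^sub>R k t) = p d - p s" if "s \<in> {0..d}"
      using that p continuous_on_subset[OF k subset_UNIV]
      by (intro integral_FTC_Icc)
        (auto simp: has_real_derivative_iff_has_vector_derivative has_vector_derivative_at_within)
    ultimately show "(LBINT t. F t s) = indicator {0..d} s *\<^sub>R (p d - p s) *\<^sub>R \<psi> s"
      by (cases "s \<in> {0..d}") simp_all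
  qed
  also have "(LBINT s. indicator {0..d} s *\<^sub>R (p d - p s) *\<^sub>R \<psi> s)
      = (LBINT s:{0..d}. p d *\<^sub>R \<psi> s - p s *\<^sub>R \<psi> s)"
    by (simp add: set_lebesgue_integral_def algebra_simps)
  also have "\<dots> = (LBINT s:{0..d}. p d *\<^sub>R \<psi> s) - (LBINT s:{0..d}. p s *\<^sub>R \<psi> s)"
  proof (rule set_integral_diff)
    show "set_integrable lborel {0..d} (\<lambda>s. p d *\<^sub>R \<psi> s)"
      by (rule set_integrable_lborel_bounded[of _ _ 0 d "\<bar>p d\<bar> * M"]) (auto intro!: mult_left_mono M)
    show "set_integrable lborel {0..d} (\<lambda>s. p s *\<^sub>R \<psi> s)"
      by (rule set_integrable_lborel_bounded[of _ _ 0 d "K' * M"])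
        (use K' M M0 in \<open>auto intro!: mult_mono order_trans[OF norm_ge_zero K']\<close>)
  qed
  finally show ?thesis by (simp add: algebra_simps)
qed

text \<open>The Poisson kernel in the angle, without the factor 1/(2 pi); hence the factors
  \<open>2 * pi\<close> in the formulas that use it.\<close>

definition poisson_angle :: "real \<Rightarrow> real \<Rightarrow> real" where
  "poisson_angle r s = (1 - r\<^sup>2) / (1 - 2 * r * cos s + r\<^sup>2)"

lemma poisson_angle_denominator:
  fixes r s :: real
  shows "1 - 2 * r * cos s + r\<^sup>2 = (1 - r)\<^sup>2 + 2 * r * (1 - cos s)"
  by (simp add: power2_eq_square algebra_simps)

lemma poisson_angle_denominator_pos:
  fixes r s :: real
  assumes "0 \<le> r" "r < 1"
  shows "1 - 2 * r * cos s + r\<^sup>2 > 0"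
proof -
  have "(1 - r)\<^sup>2 > 0" using assms by simp
  moreover have "2 * r * (1 - cos s) \<ge> 0" using assms by simp
  ultimately show ?thesis unfolding poisson_angle_denominator by linarith
qed

lemma poisson_angle_nonneg: "0 \<le> r \<Longrightarrow> r < 1 \<Longrightarrow> poisson_angle r s \<ge> 0"
  using poisson_angle_denominator_pos[of r s]
  by (auto simp: poisson_angle_def power_le_one intro!: divide_nonneg_pos)

lemma poisson_angle_DERIV:
  assumes "0 \<le> r" "r < 1"
  shows "(poisson_angle r has_real_derivative
    - ((1 - r\<^sup>2) * (2 * r * sin t) / (1 - 2 * r * cos t + r\<^sup>2)\<^sup>2)) (at t)"
  unfolding poisson_angle_def
  using poisson_angle_denominator_pos[OF assms, of t]
  by (auto intro!: derivative_eq_intros simp: power2_eq_square)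

lemma poisson_angle_measurable [measurable]: "poisson_angle r \<in> borel_measurable borel"
  unfolding poisson_angle_def by measurable

lemma poisson_angle_le:
  assumes "0 \<le> r" "r < 1" "cos s \<le> c" "c < 1" "0 < r"
  shows "poisson_angle r s \<le> (1 - r\<^sup>2) / (2 * r * (1 - c))"
  unfolding poisson_angle_def
proof (rule divide_left_mono)
  have "2 * r * (1 - c) \<le> 2 * r * (1 - cos s)" using assms by (intro mult_left_mono) auto
  then show "2 * r * (1 - c) \<le> 1 - 2 * r * cos s + r\<^sup>2"
    unfolding poisson_angle_denominator using zero_le_power2[of "1 - r"] by linarith
  show "0 \<le> 1 - r\<^sup>2" using assms by (simp add: power_le_one)
  show "0 < (1 - 2 * r * cos s + r\<^sup>2) * (2 * r * (1 - c))"
    using assms poisson_angle_denominator_pos[of r s] by (intro mult_pos_pos) auto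
qed

lemma poisson_angle_bounded:
  assumes "0 \<le> r" "r < 1"
  shows "poisson_angle r s \<le> (1 - r\<^sup>2) / (1 - r)\<^sup>2"
  unfolding poisson_angle_def
proof (rule divide_left_mono)
  show "(1 - r)\<^sup>2 \<le> 1 - 2 * r * cos s + r\<^sup>2"
    unfolding poisson_angle_denominator using assms by simp
qed (use assms poisson_angle_denominator_pos[of r s] in \<open>auto simp: power_le_one\<close>)

lemma poisson_angle_set_integrable:
  fixes \<psi> :: "real \<Rightarrow> 'b::euclidean_space"
  assumes [measurable]: "\<psi> \<in> borel_measurable borel" and M: "\<And>x. norm (\<psi> x) \<le> M"
    and r: "0 \<le> r" "r < 1" and "A \<in> sets borel" "A \<subseteq> {a..b}"
  shows "set_integrable lborel A (\<lambda>s. poisson_angle r s *\<^sub>R \<psi> s)"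
proof (rule set_integrable_lborel_bounded[where M = "(1 - r\<^sup>2) / (1 - r)\<^sup>2 * M"])
  fix x
  show "norm (poisson_angle r x *\<^sub>R \<psi> x) \<le> (1 - r\<^sup>2) / (1 - r)\<^sup>2 * M"
    unfolding norm_scaleR
  proof (rule mult_mono)
    show "\<bar>poisson_angle r x\<bar> \<le> (1 - r\<^sup>2) / (1 - r)\<^sup>2"
      using poisson_angle_bounded[OF r, of x] poisson_angle_nonneg[OF r, of x] by simp
    show "0 \<le> (1 - r\<^sup>2) / (1 - r)\<^sup>2" using r by (simp add: power_le_one)
  qed (use M in auto)
qed (use assms in auto)

text \<open>Integrating by parts against the derivative of the kernel, the identity for \<open>\<psi> = 1\<close>
  evaluates the bound obtained for a general \<open>\<psi>\<close> with small averages.\<close>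

lemma poisson_angle_near_bound:
  fixes \<psi> :: "real \<Rightarrow> 'b::euclidean_space"
  assumes [measurable]: "\<psi> \<in> borel_measurable borel" and M: "\<And>x. norm (\<psi> x) \<le> M"
    and r: "0 \<le> r" "r < 1" and d: "0 < d" "d \<le> pi"
    and small: "\<And>h. 0 < h \<Longrightarrow> h \<le> d \<Longrightarrow> norm (LBINT s:{0..h}. \<psi> s) \<le> e * h"
  shows "norm (LBINT s:{0..d}. poisson_angle r s *\<^sub>R \<psi> s) \<le> e * (LBINT s:{0..d}. poisson_angle r s)"
proof -
  define k where "k = (\<lambda>t. - ((1 - r\<^sup>2) * (2 * r * sin t) / (1 - 2 * r * cos t + r\<^sup>2)\<^sup>2))"
  define \<Psi> where "\<Psi> = (\<lambda>t. LBINT s:{0..t}. \<psi> s)"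
  have DN: "1 - 2 * r * cos t + r\<^sup>2 \<noteq> 0" for t
    using poisson_angle_denominator_pos[OF r, of t] by simp
  have k: "continuous_on UNIV k"
    unfolding k_def using DN by (intro continuous_intros) auto
  have p: "(poisson_angle r has_real_derivative k t) (at t)" for t
    unfolding k_def by (rule poisson_angle_DERIV[OF r])
  \<comment> \<open>The kernel decreases on \<open>{0..pi}\<close>, which is why
    \<open>d \<le> pi\<close> is assumed. As \<open>k\<close> has one sign there, absolute values
    turn into \<open>- k\<close> and no cancellation is lost against the case of the constant
    1.\<close>
  have kneg: "k t \<le> 0" if "t \<in> {0..d}" for t
    using that d r unfolding k_def by (auto intro!: divide_nonneg_nonneg mult_nonneg_nonneg sin_ge_zero simp: power_le_one)
  have [measurable]: "k \<in> borel_measurable borel"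
    using k by (simp add: borel_measurable_continuous_onI)
  have \<Psi>': "norm (\<Psi> t) \<le> e * t" if "t \<in> {0..d}" for t
  proof (cases "t = 0")
    case True
    have "(LBINT s:{0}. \<psi> s) = 0"
      unfolding set_lebesgue_integral_def
      by (rule integral_eq_zero_AE) (use AE_lborel_singleton[of "0::real"] in \<open>auto elim!: eventually_mono\<close>)
    then show ?thesis using True by (simp add: \<Psi>_def)
  qed (use small that in \<open>auto simp: \<Psi>_def\<close>)
  have one: "(LBINT s:{0..d}. poisson_angle r s)
      = poisson_angle r d * d - (LBINT t:{0..d}. k t * t)"
  proof -
    have 1: "(LBINT s:{0..t}. 1) = t" if "t \<in> {0..d}" for t
      using that by (simp add: set_lebesgue_integral_def)
    have "(LBINT s:{0..d}. poisson_angle r s *\<^sub>R (1::real))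
      = poisson_angle r d *\<^sub>R (LBINT s:{0..d}. 1) - (LBINT t:{0..d}. k t *\<^sub>R (LBINT s:{0..t}. 1))"
      by (rule integral_by_parts_bounded[OF p k, of _ 1]) (use d in auto)
    moreover have "(LBINT t:{0..d}. k t *\<^sub>R (LBINT s:{0..t}. 1)) = (LBINT t:{0..d}. k t * t)"
      by (rule set_lebesgue_integral_cong) (auto simp: 1)
    ultimately show ?thesis using 1[of d] d by simp
  qed
  have ki: "set_integrable lborel {0..d} (\<lambda>t. (- k t) * (e * t))"
    using k by (intro borel_integrable_atLeastAtMost' continuous_intros)
      (auto intro: continuous_on_subset)
  have "norm (LBINT t:{0..d}. k t *\<^sub>R \<Psi> t) \<le> (LBINT t:{0..d}. (- k t) * (e * t))"
    unfolding set_lebesgue_integral_def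
  proof (rule order_trans[OF integral_norm_bound integral_mono'])
    show "integrable lborel (\<lambda>x. indicat_real {0..d} x *\<^sub>R (- k x * (e * x)))"
      using ki by (simp add: set_integrable_def)
    show "norm (indicat_real {0..d} x *\<^sub>R k x *\<^sub>R \<Psi> x)
        \<le> indicat_real {0..d} x *\<^sub>R (- k x * (e * x))" for x
    proof (cases "x \<in> {0..d}")
      case True
      have "\<bar>k x\<bar> * norm (\<Psi> x) \<le> (- k x) * (e * x)"
        using kneg[OF True] \<Psi>'[OF True] by (simp add: mult_left_mono_neg)
      then show ?thesis using True by simp
    qed simp
    then show "0 \<le> indicat_real {0..d} x *\<^sub>R (- k x * (e * x))" for x
      using norm_ge_zero order_trans by blast
  qed
  also have "\<dots> = - e * (LBINT t:{0..d}. k t * t)"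
    by (simp add: set_lebesgue_integral_def mult.assoc mult.left_commute[of _ e] flip: integral_mult_right_zero)
  finally have 2: "norm (LBINT t:{0..d}. k t *\<^sub>R \<Psi> t) \<le> - e * (LBINT t:{0..d}. k t * t)" .
  have "(LBINT s:{0..d}. poisson_angle r s *\<^sub>R \<psi> s)
      = poisson_angle r d *\<^sub>R \<Psi> d - (LBINT t:{0..d}. k t *\<^sub>R \<Psi> t)"
    unfolding \<Psi>_def by (rule integral_by_parts_bounded[OF p k _ M]) (use d in auto)
  then have "norm (LBINT s:{0..d}. poisson_angle r s *\<^sub>R \<psi> s)
      \<le> poisson_angle r d * norm (\<Psi> d) + norm (LBINT t:{0..d}. k t *\<^sub>R \<Psi> t)"
    using norm_triangle_ineq4[of "poisson_angle r d *\<^sub>R \<Psi> d" "LBINT t:{0..d}. k t *\<^sub>R \<Psi> t"]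
      poisson_angle_nonneg[OF r, of d] by simp
  also have "\<dots> \<le> poisson_angle r d * (e * d) + (- e * (LBINT t:{0..d}. k t * t))"
    using 2 \<Psi>'[of d] d poisson_angle_nonneg[OF r, of d] by (intro add_mono mult_left_mono) auto
  also have "\<dots> = e * (LBINT s:{0..d}. poisson_angle r s)"
    unfolding one by (simp add: algebra_simps)
  finally show ?thesis .
qed

section \<open>The Poisson formula for functions continuous on the closed disc\<close>

lemma circle_cauchy_has_integral:
  fixes f :: "complex \<Rightarrow> complex"
  assumes f: "continuous_on (cball 0 1) f" "f holomorphic_on ball 0 1" and w: "norm w < 1"
  shows "((\<lambda>t. f (cis t) * cis t / (cis t - w)) has_integral 2 * pi * f w) {0..2 * pi}"
proof -
  have "((\<lambda>u. f u / (u - w)) has_contour_integral 2 * of_real pi * \<i> * f w) (circlepath 0 1)"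
    using Cauchy_integral_circlepath[OF f, of w] w by simp
  then have "((\<lambda>t. f (0 + of_real 1 * cis t) / (0 + of_real 1 * cis t - w) * of_real 1 * \<i> * cis t)
      has_integral 2 * of_real pi * \<i> * f w) {0..2 * pi}"
    unfolding circlepath_def by (subst (asm) has_contour_integral_part_circlepath_iff) auto
  from has_integral_mult_right[OF this, of "- \<i>"]
  show ?thesis by (simp add: algebra_simps)
qed

lemma cis_continuous_on_compose:
  assumes "continuous_on (cball 0 1) f"
  shows "continuous_on A (\<lambda>t. f (cis t))"
  by (rule continuous_on_compose2[OF assms]) (auto intro!: continuous_intros)

lemma norm_cis_diff_square:
  "(norm (cis t - of_real r * cis \<theta>))\<^sup>2 = 1 - 2 * r * cos (t - \<theta>) + r\<^sup>2"
proof -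
  have "(norm (cis t - of_real r * cis \<theta>))\<^sup>2
      = (cos t - r * cos \<theta>)\<^sup>2 + (sin t - r * sin \<theta>)\<^sup>2"
    by (simp add: cmod_power2)
  also have "\<dots> = ((cos t)\<^sup>2 + (sin t)\<^sup>2) + r\<^sup>2 * ((cos \<theta>)\<^sup>2 + (sin \<theta>)\<^sup>2)
      - 2 * r * (cos t * cos \<theta> + sin t * sin \<theta>)"
    by (simp add: power2_diff power_mult_distrib algebra_simps
        del: sin_cos_squared_add sin_cos_squared_add2)
  finally show ?thesis by (simp add: cos_diff sin_cos_squared_add2)
qed

lemma poisson_formula:
  fixes f :: "complex \<Rightarrow> complex"
  assumes f: "continuous_on (cball 0 1) f" "f holomorphic_on ball 0 1" and r: "0 \<le> r" "r < 1"
  shows "(LBINT t:{0..2 * pi}. poisson_angle r (t - \<theta>) *\<^sub>R f (cis t)) = (2 * pi) *\<^sub>R f (of_real r * cis \<theta>)"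
proof -
  define w where "w = of_real r * cis \<theta>"
  have w: "norm w < 1" using r by (simp add: w_def norm_mult)
  have nz: "1 - cnj w * u \<noteq> 0" if "u \<in> cball 0 1" for u
  proof -
    have "norm (cnj w * u) \<le> norm w * 1"
      using that unfolding norm_mult complex_mod_cnj by (intro mult_left_mono) auto
    then have "cnj w * u \<noteq> 1" using w by (metis mult.right_neutral norm_one not_le)
    then show ?thesis by simp
  qed
  \<comment> \<open>Cauchy's formula at \<open>w\<close> is applied to \<open>G\<close> instead of
    \<open>f\<close>. The extra factor is 1 at \<open>w\<close> because
    \<open>cnj w * w = r\<^sup>2\<close>, and on the circle it turns the Cauchy kernel into the
    Poisson kernel.\<close>
  define G where "G = (\<lambda>u. f u * of_real (1 - r\<^sup>2) / (1 - cnj w * u))"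
  have G: "continuous_on (cball 0 1) G" "G holomorphic_on ball 0 1"
    unfolding G_def using f nz by (auto intro!: continuous_intros holomorphic_intros)
  have ww: "cnj w * w = of_real (r\<^sup>2)"
    by (simp add: w_def power2_eq_square cis_cnj cis_mult mult.left_commute mult.assoc flip: of_real_mult)
  have "1 - of_real (r\<^sup>2) \<noteq> (0::complex)"
    using r abs_square_less_1[of r] by (metis abs_of_nonneg diff_gt_0_iff_gt less_numeral_extra(3) of_real_1 of_real_diff of_real_eq_0_iff)
  then have Gw: "G w = f w" by (simp add: G_def ww)
  have pointwise: "G (cis t) * cis t / (cis t - w) = poisson_angle r (t - \<theta>) *\<^sub>R f (cis t)" for t
  proof -
    have "1 - cnj w * cis t = cis t * cnj (cis t - w)"
      by (simp add: algebra_simps cis_cnj cis_mult)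
    then have "cis t / ((1 - cnj w * cis t) * (cis t - w)) = 1 / ((cis t - w) * cnj (cis t - w))"
      by (simp add: mult.commute)
    also have "\<dots> = of_real (1 / (1 - 2 * r * cos (t - \<theta>) + r\<^sup>2))"
      unfolding complex_norm_square[symmetric] w_def norm_cis_diff_square by simp
    finally have *: "cis t / ((1 - cnj w * cis t) * (cis t - w))
        = of_real (1 / (1 - 2 * r * cos (t - \<theta>) + r\<^sup>2))" .
    have "G (cis t) * cis t / (cis t - w)
        = f (cis t) * of_real (1 - r\<^sup>2) * (cis t / ((1 - cnj w * cis t) * (cis t - w)))"
      by (simp add: G_def)
    then show ?thesis
      unfolding * by (simp add: poisson_angle_def scaleR_conv_of_real mult.commute)
  qed
  have hi: "((\<lambda>t. poisson_angle r (t - \<theta>) *\<^sub>R f (cis t)) has_integral 2 * pi * f w) {0..2 * pi}"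
    using circle_cauchy_has_integral[OF G w] unfolding pointwise Gw .
  have "continuous_on {0..2 * pi} (\<lambda>t. poisson_angle r (t - \<theta>) *\<^sub>R f (cis t))"
    unfolding poisson_angle_def
    using poisson_angle_denominator_pos[OF r]
    by (intro continuous_intros cis_continuous_on_compose f) (metis less_irrefl)
  then have "set_integrable lborel {0..2 * pi} (\<lambda>t. poisson_angle r (t - \<theta>) *\<^sub>R f (cis t))"
    by (rule borel_integrable_atLeastAtMost')
  from set_borel_integral_eq_integral(2)[OF this] integral_unique[OF hi]
  show ?thesis by (simp add: w_def scaleR_conv_of_real)
qed

lemma poisson_angle_integral:
  assumes r: "0 \<le> r" "r < 1"
  shows "(LBINT t:{0..2 * pi}. poisson_angle r (t - \<theta>)) = 2 * pi"
proof -
  have "(LBINT t:{0..2 * pi}. complex_of_real (poisson_angle r (t - \<theta>))) = of_real (2 * pi)"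
    using poisson_formula[OF _ _ r, of "\<lambda>_. 1" \<theta>] by (simp add: scaleR_conv_of_real)
  then show ?thesis
    by (simp only: set_integral_complex_of_real of_real_eq_iff)
qed

lemma poisson_angle_partial_le:
  assumes r: "0 \<le> r" "r < 1" and L: "L \<le> 2 * pi"
  shows "(LBINT t:{0..L}. poisson_angle r t) \<le> 2 * pi"
proof -
  have "(LBINT t:{0..L}. poisson_angle r t) \<le> (LBINT t:{0..2 * pi}. poisson_angle r t)"
    unfolding set_lebesgue_integral_def
  proof (rule integral_mono')
    show "integrable lborel (\<lambda>x. indicat_real {0..2 * pi} x *\<^sub>R poisson_angle r x)"
      using poisson_angle_set_integrable[of "\<lambda>_. 1::real" 1 r "{0..2*pi}" 0 "2 * pi"] r
      by (simp add: set_integrable_def)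
  qed (use L r in \<open>auto simp: indicator_def poisson_angle_nonneg\<close>)
  then show ?thesis using poisson_angle_integral[OF r, of 0] by simp
qed

text \<open>Near 0 the small averages of \<psi> are used, farther out the kernel tends to 0
  uniformly. \<open>L\<close> may exceed pi because the base interval \<open>{0..2 * pi}\<close> is
  not centred at the point considered.\<close>

lemma poisson_half_limit:
  fixes \<psi> :: "real \<Rightarrow> 'b::euclidean_space"
  assumes [measurable]: "\<psi> \<in> borel_measurable borel" and M: "\<And>x. norm (\<psi> x) \<le> M"
    and small: "\<And>e. 0 < e \<Longrightarrow> \<exists>d>0. \<forall>h. 0 < h \<and> h < d \<longrightarrow> norm (LBINT s:{0..h}. \<psi> s) \<le> e * h"
    and L: "0 \<le> L" "L < 2 * pi"
  shows "((\<lambda>r. LBINT s:{0..L}. poisson_angle r s *\<^sub>R \<psi> s) \<longlongrightarrow> 0) (at_left 1)"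
proof (rule tendstoI)
  fix e :: real assume e: "e > 0"
  have M0: "0 \<le> M" using M[of 0] norm_ge_zero order_trans by blast
  \<comment> \<open>The kernel has mass at most \<open>2 * pi\<close> on the interval, so the part
    near 0 contributes at most \<open>e' * (2 * pi) < e / 2\<close>.\<close>
  define e' where "e' = e / (4 * pi + 1)"
  have e': "e' > 0" "e' * (2 * pi) < e / 2"
    using e pi_gt_zero by (auto simp: e'_def field_simps add_pos_pos)
  obtain d0 where d0: "d0 > 0" "\<And>h. 0 < h \<Longrightarrow> h < d0 \<Longrightarrow> norm (LBINT s:{0..h}. \<psi> s) \<le> e' * h"
    using small[OF e'(1)] by blast
  define d where "d = min (d0 / 2) 1"
  have d: "0 < d" "d \<le> pi" "d < d0" using d0(1) pi_gt3 by (auto simp: d_def)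
  \<comment> \<open>Cosine falls up to pi and rises afterwards, so on \<open>{d..L}\<close> it is
    largest at an endpoint. \<open>L < 2 * pi\<close> keeps this maximum below 1.\<close>
  define c where "c = max (cos d) (cos L)"
  have cd: "cos d < 1" using cos_monotone_0_pi[of 0 d] d by simp
  show "eventually (\<lambda>r. dist (LBINT s:{0..L}. poisson_angle r s *\<^sub>R \<psi> s) 0 < e) (at_left 1)"
  proof (cases "L \<le> d")
    case True
    have "dist (LBINT s:{0..L}. poisson_angle r s *\<^sub>R \<psi> s) 0 < e" if r: "0 < r" "r < 1" for r
    proof (cases "L = 0")
      case True
      have "(LBINT s:{0..L}. poisson_angle r s *\<^sub>R \<psi> s) = 0"
        unfolding set_lebesgue_integral_def True
        by (rule integral_eq_zero_AE) (use AE_lborel_singleton[of "0::real"] in \<open>auto elim!: eventually_mono\<close>)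
      then show ?thesis using e by simp
    next
      case False
      have "norm (LBINT s:{0..L}. poisson_angle r s *\<^sub>R \<psi> s) \<le> e' * (LBINT s:{0..L}. poisson_angle r s)"
        by (rule poisson_angle_near_bound[OF _ M]) (use r L False \<open>L \<le> d\<close> d d0 in auto)
      also have "\<dots> \<le> e' * (2 * pi)"
        using poisson_angle_partial_le[of r L] L r e' by (intro mult_left_mono) auto
      finally show ?thesis using e' e by simp
    qed
    then show ?thesis
      using eventually_at_left_real[of 0 "1::real"] by (auto elim!: eventually_mono)
  next
    case False
    have cL: "cos L < 1"
    proof -
      have "cos L \<noteq> 1"
      proof
        assume "cos L = 1"
        then obtain n :: int where "L = of_int n * 2 * pi" by (auto simp: cos_one_2pi_int)
        moreover have "0 < L" "L < 2 * pi" using False d L by auto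
        ultimately have "0 < real_of_int n" "real_of_int n < 1"
          by (auto simp: zero_less_mult_iff) 
        then show False by simp
      qed
      then show ?thesis using cos_le_one[of L] by linarith
    qed
    have c1: "c < 1" using cd cL by (simp add: c_def)
    have cosc: "cos s \<le> c" if "s \<in> {d..L}" for s
    proof (cases "s \<le> pi")
      case True
      then have "cos s \<le> cos d" using that d by (intro cos_monotone_0_pi_le) auto
      then show ?thesis by (simp add: c_def)
    next
      case False
      have "cos (2 * pi - s) \<le> cos (2 * pi - L)"
        using that False L by (intro cos_monotone_0_pi_le) auto
      then show ?thesis by (simp add: c_def cos_diff)
    qed
    define b where "b = (\<lambda>r. (1 - r\<^sup>2) / (2 * r * (1 - c)) * M * (2 * pi))"
    have "(b \<longlongrightarrow> (1 - 1\<^sup>2) / (2 * 1 * (1 - c)) * M * (2 * pi)) (at_left 1)"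
      unfolding b_def using c1 by (intro tendsto_intros) auto
    then have "(b \<longlongrightarrow> 0) (at_left 1)" by simp
    then have "eventually (\<lambda>r. b r < e / 2) (at_left 1)"
      using e by (intro order_tendstoD(2)) auto
    moreover have "eventually (\<lambda>r. r \<in> {0<..<1}) (at_left (1::real))"
      using eventually_at_left_real[of 0 "1::real"] by auto
    ultimately show ?thesis
    proof eventually_elim
      case (elim r)
      then have r: "0 < r" "r < 1" "0 \<le> r" by auto
      have si: "set_integrable lborel A (\<lambda>s. poisson_angle r s *\<^sub>R \<psi> s)"
        if "A \<in> sets borel" "A \<subseteq> {0..L}" for A
        by (rule poisson_angle_set_integrable[OF _ M]) (use that r in auto)
      have "(LBINT s:{0..d} \<union> {d<..L}. poisson_angle r s *\<^sub>R \<psi> s)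
          = (LBINT s:{0..d}. poisson_angle r s *\<^sub>R \<psi> s) + (LBINT s:{d<..L}. poisson_angle r s *\<^sub>R \<psi> s)"
        using False d(1) by (intro set_integral_Un si) auto
      moreover have "{0..d} \<union> {d<..L} = {0..L}" using False d by auto
      moreover have "norm (LBINT s:{0..d}. poisson_angle r s *\<^sub>R \<psi> s) < e / 2"
      proof -
        have "norm (LBINT s:{0..d}. poisson_angle r s *\<^sub>R \<psi> s) \<le> e' * (LBINT s:{0..d}. poisson_angle r s)"
          by (rule poisson_angle_near_bound[OF _ M]) (use r d d0 in auto)
        also have "\<dots> \<le> e' * (2 * pi)"
          using poisson_angle_partial_le[of r d] d r e' by (intro mult_left_mono) auto
        finally show ?thesis using e' by simp
      qed
      moreover have "norm (LBINT s:{d<..L}. poisson_angle r s *\<^sub>R \<psi> s) \<le> b r"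
      proof -
        have "norm (LBINT s:{d<..L}. poisson_angle r s *\<^sub>R \<psi> s)
            \<le> (LBINT s:{d<..L}. (1 - r\<^sup>2) / (2 * r * (1 - c)) * M)"
          unfolding set_lebesgue_integral_def
        proof (rule order_trans[OF integral_norm_bound integral_mono'])
          show "integrable lborel (\<lambda>s. indicat_real {d<..L} s *\<^sub>R ((1 - r\<^sup>2) / (2 * r * (1 - c)) * M))"
            unfolding set_integrable_def[symmetric]
            by (rule set_integrable_lborel_bounded[where a = d and b = L
                  and M = "\<bar>(1 - r\<^sup>2) / (2 * r * (1 - c)) * M\<bar>"]) auto
          have "norm (poisson_angle r s *\<^sub>R \<psi> s) \<le> (1 - r\<^sup>2) / (2 * r * (1 - c)) * M" if "s \<in> {d<..L}" for s
            unfolding norm_scaleR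
          proof (rule mult_mono)
            show "\<bar>poisson_angle r s\<bar> \<le> (1 - r\<^sup>2) / (2 * r * (1 - c))"
              using poisson_angle_le[of r s c] poisson_angle_nonneg[of r s] cosc[of s] that r c1 by auto
            show "0 \<le> (1 - r\<^sup>2) / (2 * r * (1 - c))"
              using r c1 by (intro divide_nonneg_nonneg) (auto simp: power_le_one)
          qed (use M in auto)
          then show "norm (indicat_real {d<..L} s *\<^sub>R poisson_angle r s *\<^sub>R \<psi> s)
              \<le> indicat_real {d<..L} s *\<^sub>R ((1 - r\<^sup>2) / (2 * r * (1 - c)) * M)" for s
            by (auto simp: indicator_def)
          then show "0 \<le> indicat_real {d<..L} s *\<^sub>R ((1 - r\<^sup>2) / (2 * r * (1 - c)) * M)" for s
            using norm_ge_zero order_trans by blast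
        qed
        also have "\<dots> = (1 - r\<^sup>2) / (2 * r * (1 - c)) * M * (L - d)"
          using False by (simp add: set_lebesgue_integral_def)
        also have "\<dots> \<le> b r"
          unfolding b_def using False d L M0 r c1
          by (intro mult_left_mono mult_nonneg_nonneg divide_nonneg_nonneg) (auto simp: power_le_one)
        finally show ?thesis .
      qed
      ultimately show ?case
        using elim norm_triangle_ineq[of "LBINT s:{0..d}. poisson_angle r s *\<^sub>R \<psi> s"
            "LBINT s:{d<..L}. poisson_angle r s *\<^sub>R \<psi> s"] by simp
    qed
  qed
qed

section \<open>Limits of Poisson integrals at Lebesgue points\<close>

lemma set_lborel_affine:
  fixes f :: "real \<Rightarrow> 'b::euclidean_space"
  assumes "\<bar>c\<bar> = 1"
  shows "(LBINT u:A. f u) = (LBINT s:{s. x + c * s \<in> A}. f (x + c * s))"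
  unfolding set_lebesgue_integral_def
  by (subst lborel_integral_real_affine[of c _ x]) (use assms in \<open>auto simp: indicator_def\<close>)

text \<open>Lebesgue differentiation along the intervals from \<open>x\<close> to
  \<open>x + h\<close>, with the increment as variable of integration. Averages on the left are
  obtained by applying the same result to the reflected function.\<close>

lemma one_sided_lebesgue_points:
  fixes \<phi> :: "real \<Rightarrow> 'b::euclidean_space"
  assumes [measurable]: "\<phi> \<in> borel_measurable borel" and M: "\<And>x. norm (\<phi> x) \<le> M"
  obtains N where "negligible N"
    "\<And>x e. x \<notin> N \<Longrightarrow> 0 < e \<Longrightarrow>
      \<exists>d>0. \<forall>h. 0 < h \<and> h < d \<longrightarrow> norm (LBINT s:{0..h}. \<phi> (x + s) - \<phi> x) \<le> e * h"
proof -
  have si: "set_integrable lborel {a..b} \<phi>" for a b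
    by (rule set_integrable_lborel_bounded[OF _ _ _ M]) auto
  then have "\<phi> integrable_on cbox a b" for a b
    using set_borel_integral_eq_integral(1) by auto
  from integrable_ccontinuous_explicit[OF this] obtain N where N: "negligible N"
    "\<And>x e. x \<notin> N \<Longrightarrow> 0 < e \<Longrightarrow> \<exists>d>0. \<forall>h. 0 < h \<and> h < d \<longrightarrow>
       norm (integral (cbox x (x + h *\<^sub>R One)) \<phi> /\<^sub>R h ^ DIM(real) - \<phi> x) < e"
    by blast
  show ?thesis
  proof (rule that[OF N(1)])
    fix x e :: real assume "x \<notin> N" "0 < e"
    then obtain d where d: "d > 0" "\<And>h. 0 < h \<Longrightarrow> h < d \<Longrightarrow>
        norm (integral (cbox x (x + h *\<^sub>R One)) \<phi> /\<^sub>R h ^ DIM(real) - \<phi> x) < e"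
      using N(2)[OF \<open>x \<notin> N\<close> \<open>0 < e\<close>] by blast
    have "norm (LBINT s:{0..h}. \<phi> (x + s) - \<phi> x) \<le> e * h" if h: "0 < h" "h < d" for h
    proof -
      have si': "set_integrable lborel {0..h} (\<lambda>s. \<phi> (x + s))"
        by (rule set_integrable_lborel_bounded[OF _ _ _ M]) auto
      have "(LBINT s:{0..h}. \<phi> (x + s) - \<phi> x) = (LBINT s:{0..h}. \<phi> (x + s)) - h *\<^sub>R \<phi> x"
        using h by (subst set_integral_diff)
          (auto intro!: si' set_integrable_lborel_bounded[of "\<lambda>_. \<phi> x" "{0..h}" 0 h "norm (\<phi> x)"]
            simp: set_lebesgue_integral_def)
      also have "(LBINT s:{0..h}. \<phi> (x + s)) = (LBINT u:{x..x + h}. \<phi> u)"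
      proof -
        have "{s. x + 1 * s \<in> {x..x + h}} = {0..h}" by auto
        then show ?thesis using set_lborel_affine[of 1 "{x..x + h}" \<phi> x] by simp
      qed
      also have "\<dots> = integral {x..x + h} \<phi>"
        by (rule set_borel_integral_eq_integral(2)[OF si])
      finally have "(LBINT s:{0..h}. \<phi> (x + s) - \<phi> x) = integral {x..x + h} \<phi> - h *\<^sub>R \<phi> x" .
      also have "\<dots> = h *\<^sub>R (integral {x..x + h} \<phi> /\<^sub>R h - \<phi> x)"
        using h by (simp add: scaleR_diff_right)
      finally show ?thesis using d(2)[OF h] h by (simp add: mult.commute)
    qed
    with d(1) show "\<exists>d>0. \<forall>h. 0 < h \<and> h < d \<longrightarrow>
        norm (LBINT s:{0..h}. \<phi> (x + s) - \<phi> x) \<le> e * h" by blast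
  qed
qed

lemma poisson_angle_minus [simp]: "poisson_angle r (- s) = poisson_angle r s"
  by (simp add: poisson_angle_def)

text \<open>The constant \<open>\<phi> \<theta>\<close> contributes exactly its multiple by
  \<open>2 * pi\<close>. The remainder has small averages on both sides of almost every
  \<open>\<theta>\<close>; cutting the interval at \<open>\<theta>\<close> and reflecting the left
  piece gives two instances of the half-interval limit.\<close>

lemma poisson_integral_limit_AE:
  fixes \<phi> :: "real \<Rightarrow> 'b::euclidean_space"
  assumes [measurable]: "\<phi> \<in> borel_measurable borel" and M: "\<And>x. norm (\<phi> x) \<le> M"
  shows "AE \<theta> in lborel. \<theta> \<in> {0<..<2 * pi} \<longrightarrow>
    ((\<lambda>r. LBINT t:{0..2 * pi}. poisson_angle r (t - \<theta>) *\<^sub>R \<phi> t) \<longlongrightarrow> (2 * pi) *\<^sub>R \<phi> \<theta>) (at_left 1)"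
proof -
  obtain N1 where N1: "negligible N1"
    "\<And>x e. x \<notin> N1 \<Longrightarrow> 0 < e \<Longrightarrow>
      \<exists>d>0. \<forall>h. 0 < h \<and> h < d \<longrightarrow> norm (LBINT s:{0..h}. \<phi> (x + s) - \<phi> x) \<le> e * h"
    by (rule one_sided_lebesgue_points[OF assms(1) M]) blast
  \<comment> \<open>A forward average of the reflected function at \<open>- \<theta>\<close> is a
    backward average of \<phi> at \<open>\<theta>\<close>; hence the exceptional set
    \<open>N2\<close> enters below with its sign reversed.\<close>
  have "(\<lambda>x. \<phi> (- x)) \<in> borel_measurable borel" by measurable
  from one_sided_lebesgue_points[OF this M] obtain N2 where N2: "negligible N2"
    "\<And>x e. x \<notin> N2 \<Longrightarrow> 0 < e \<Longrightarrow>
      \<exists>d>0. \<forall>h. 0 < h \<and> h < d \<longrightarrow> norm (LBINT s:{0..h}. \<phi> (- (x + s)) - \<phi> (- x)) \<le> e * h"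
    by blast
  have "negligible (N1 \<union> uminus ` N2)"
    using N1(1) N2(1) by (intro negligible_Un negligible_differentiable_image_negligible) (auto intro!: derivative_intros)
  then have "AE \<theta> in completion lborel. \<theta> \<notin> N1 \<union> uminus ` N2"
    by (intro AE_not_in) (simp add: negligible_iff_null_sets)
  then have "AE \<theta> in lborel. \<theta> \<notin> N1 \<union> uminus ` N2"
    by (simp only: AE_completion_iff)
  then show ?thesis
  proof eventually_elim
    case (elim \<theta>)
    then have \<theta>N: "\<theta> \<notin> N1" "- \<theta> \<notin> N2" by force+
    show ?case
    proof
      assume \<theta>: "\<theta> \<in> {0<..<2 * pi}"
      define \<psi> where "\<psi> = (\<lambda>s. \<phi> (\<theta> + s) - \<phi> \<theta>)"
      have [measurable]: "\<psi> \<in> borel_measurable borel" unfolding \<psi>_def by measurable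
      have \<psi>M: "norm (\<psi> s) \<le> 2 * M" for s
        unfolding \<psi>_def using norm_triangle_ineq4[of "\<phi> (\<theta> + s)" "\<phi> \<theta>"] M[of "\<theta> + s"] M[of \<theta>] by linarith
      have R: "((\<lambda>r. LBINT s:{0..2 * pi - \<theta>}. poisson_angle r s *\<^sub>R \<psi> s) \<longlongrightarrow> 0) (at_left 1)"
        using \<theta> N1(2)[OF \<theta>N(1)] by (intro poisson_half_limit[OF _ \<psi>M]) (auto simp: \<psi>_def)
      have L: "((\<lambda>r. LBINT s:{0..\<theta>}. poisson_angle r s *\<^sub>R \<psi> (- s)) \<longlongrightarrow> 0) (at_left 1)"
        using \<theta> N2(2)[OF \<theta>N(2)] by (intro poisson_half_limit[OF _ \<psi>M]) (auto simp: \<psi>_def)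
      have "((\<lambda>r. (LBINT s:{0..\<theta>}. poisson_angle r s *\<^sub>R \<psi> (- s))
          + (LBINT s:{0..2 * pi - \<theta>}. poisson_angle r s *\<^sub>R \<psi> s) + (2 * pi) *\<^sub>R \<phi> \<theta>)
          \<longlongrightarrow> 0 + 0 + (2 * pi) *\<^sub>R \<phi> \<theta>) (at_left 1)"
        by (intro tendsto_intros R L)
      moreover have "eventually (\<lambda>r. (LBINT s:{0..\<theta>}. poisson_angle r s *\<^sub>R \<psi> (- s))
          + (LBINT s:{0..2 * pi - \<theta>}. poisson_angle r s *\<^sub>R \<psi> s) + (2 * pi) *\<^sub>R \<phi> \<theta>
          = (LBINT t:{0..2 * pi}. poisson_angle r (t - \<theta>) *\<^sub>R \<phi> t)) (at_left 1)"
        using eventually_at_left_real[of 0 "1::real"]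
      proof (rule eventually_mono)
        fix r :: real assume "r \<in> {0<..<1}"
        then have r: "0 \<le> r" "r < 1" by auto
        have pk: "(\<lambda>t. poisson_angle r (t - \<theta>)) \<in> borel_measurable borel" by measurable
        have shift_integrable: "set_integrable lborel A (\<lambda>t. poisson_angle r (t - \<theta>) *\<^sub>R f t)"
          if "f \<in> borel_measurable borel" "\<And>t. norm (f t) \<le> K" "A \<in> sets borel" "A \<subseteq> {0..2 * pi}"
          for f :: "real \<Rightarrow> 'b" and K A
        proof (rule set_integrable_lborel_bounded[where M = "(1 - r\<^sup>2) / (1 - r)\<^sup>2 * K"])
          fix x
          show "norm (poisson_angle r (x - \<theta>) *\<^sub>R f x) \<le> (1 - r\<^sup>2) / (1 - r)\<^sup>2 * K"
            unfolding norm_scaleR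
          proof (rule mult_mono)
            show "\<bar>poisson_angle r (x - \<theta>)\<bar> \<le> (1 - r\<^sup>2) / (1 - r)\<^sup>2"
              using poisson_angle_bounded[OF r] poisson_angle_nonneg[OF r] by simp
            show "0 \<le> (1 - r\<^sup>2) / (1 - r)\<^sup>2" using r by (simp add: power_le_one)
          qed (use that in auto)
        qed (use that pk in auto)
        have "(LBINT t:{0..2 * pi}. poisson_angle r (t - \<theta>) *\<^sub>R \<phi> t)
            = (LBINT t:{0..2 * pi}. poisson_angle r (t - \<theta>) *\<^sub>R (\<phi> t - \<phi> \<theta>) + poisson_angle r (t - \<theta>) *\<^sub>R \<phi> \<theta>)"
          by (simp flip: scaleR_add_right)
        also have "\<dots> = (LBINT t:{0..2 * pi}. poisson_angle r (t - \<theta>) *\<^sub>R (\<phi> t - \<phi> \<theta>))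
            + (LBINT t:{0..2 * pi}. poisson_angle r (t - \<theta>) *\<^sub>R \<phi> \<theta>)"
          using \<psi>M[of "_ - \<theta>"] by (intro set_integral_add shift_integrable[where K = "2 * M"] shift_integrable[where K = "norm (\<phi> \<theta>)"])
            (auto simp: \<psi>_def)
        also have "(LBINT t:{0..2 * pi}. poisson_angle r (t - \<theta>) *\<^sub>R \<phi> \<theta>) = (2 * pi) *\<^sub>R \<phi> \<theta>"
        proof -
          have "set_integrable lborel {0..2 * pi} (\<lambda>t. poisson_angle r (t - \<theta>))"
            by (rule set_integrable_lborel_bounded[where M = "(1 - r\<^sup>2) / (1 - r)\<^sup>2", OF pk])
              (use poisson_angle_bounded[OF r] poisson_angle_nonneg[OF r] in auto)
          then have "(LBINT t:{0..2 * pi}. poisson_angle r (t - \<theta>) *\<^sub>R \<phi> \<theta>)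
              = (LBINT t:{0..2 * pi}. poisson_angle r (t - \<theta>)) *\<^sub>R \<phi> \<theta>"
            unfolding set_lebesgue_integral_def set_integrable_def
            by (subst integral_scaleR_left[symmetric]) auto
          then show ?thesis using poisson_angle_integral[OF r] by simp
        qed
        also have "(LBINT t:{0..2 * pi}. poisson_angle r (t - \<theta>) *\<^sub>R (\<phi> t - \<phi> \<theta>))
            = (LBINT t:{0..<\<theta>} \<union> {\<theta>..2 * pi}. poisson_angle r (t - \<theta>) *\<^sub>R (\<phi> t - \<phi> \<theta>))"
          using \<theta> by (intro arg_cong2[where f = "set_lebesgue_integral lborel"]) auto
        also have "\<dots> = (LBINT t:{0..<\<theta>}. poisson_angle r (t - \<theta>) *\<^sub>R (\<phi> t - \<phi> \<theta>))
            + (LBINT t:{\<theta>..2 * pi}. poisson_angle r (t - \<theta>) *\<^sub>R (\<phi> t - \<phi> \<theta>))"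
          using \<psi>M[of "_ - \<theta>"] \<theta> by (intro set_integral_Un shift_integrable[where K = "2 * M"]) (auto simp: \<psi>_def)
        also have "(LBINT t:{\<theta>..2 * pi}. poisson_angle r (t - \<theta>) *\<^sub>R (\<phi> t - \<phi> \<theta>))
            = (LBINT s:{0..2 * pi - \<theta>}. poisson_angle r s *\<^sub>R \<psi> s)"
        proof -
          have "{s. \<theta> + 1 * s \<in> {\<theta>..2 * pi}} = {0..2 * pi - \<theta>}" by auto
          then show ?thesis
            using set_lborel_affine[of 1 "{\<theta>..2 * pi}" "\<lambda>t. poisson_angle r (t - \<theta>) *\<^sub>R (\<phi> t - \<phi> \<theta>)" \<theta>]
            by (simp add: \<psi>_def)
        qed
        also have "(LBINT t:{0..<\<theta>}. poisson_angle r (t - \<theta>) *\<^sub>R (\<phi> t - \<phi> \<theta>))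
            = (LBINT s:{0<..\<theta>}. poisson_angle r s *\<^sub>R \<psi> (- s))"
        proof -
          have "{s. \<theta> + - 1 * s \<in> {0..<\<theta>}} = {0<..\<theta>}" by auto
          then show ?thesis
            using set_lborel_affine[of "-1" "{0..<\<theta>}" "\<lambda>t. poisson_angle r (t - \<theta>) *\<^sub>R (\<phi> t - \<phi> \<theta>)" \<theta>]
            by (simp add: \<psi>_def)
        qed
        also have "\<dots> = (LBINT s:{0..\<theta>}. poisson_angle r s *\<^sub>R \<psi> (- s))"
          unfolding set_lebesgue_integral_def
          by (intro integral_cong_AE) (use AE_lborel_singleton[of "0::real"] in \<open>auto elim!: eventually_mono simp: indicator_def\<close>)
        finally show "(LBINT s:{0..\<theta>}. poisson_angle r s *\<^sub>R \<psi> (- s))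
          + (LBINT s:{0..2 * pi - \<theta>}. poisson_angle r s *\<^sub>R \<psi> s) + (2 * pi) *\<^sub>R \<phi> \<theta>
          = (LBINT t:{0..2 * pi}. poisson_angle r (t - \<theta>) *\<^sub>R \<phi> t)" by simp
      qed simp
      ultimately have "((\<lambda>r. LBINT t:{0..2 * pi}. poisson_angle r (t - \<theta>) *\<^sub>R \<phi> t)
          \<longlongrightarrow> 0 + 0 + (2 * pi) *\<^sub>R \<phi> \<theta>) (at_left 1)"
        by (rule Lim_transform_eventually)
      then show "((\<lambda>r. LBINT t:{0..2 * pi}. poisson_angle r (t - \<theta>) *\<^sub>R \<phi> t)
          \<longlongrightarrow> (2 * pi) *\<^sub>R \<phi> \<theta>) (at_left 1)" by simp
    qed
  qed
qed

section \<open>Fatou's theorem for Schur functions\<close>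

lemma borel_measurable_cis [measurable]: "cis \<in> borel_measurable borel"
  by (simp add: borel_measurable_continuous_onI continuous_intros)

lemma borel_measurable_cnj [measurable]: "cnj \<in> borel_measurable borel"
  by (simp add: borel_measurable_continuous_onI continuous_intros)

text \<open>The interval is closed, to match the Poisson integrals over \<open>{0..2 * pi}\<close>;
  \<open>circle_lebesgue\<close> comes from the half-open one, and the additional endpoint is a null
  set.\<close>

definition angle_measure :: "real measure" where
  "angle_measure = restrict_space lborel {0..2 * pi}"

lemma sets_angle_measure: "sets angle_measure = sets (restrict_space borel {0..2 * pi})"
  unfolding angle_measure_def by (rule sets_restrict_space_cong) simp

lemma space_angle_measure [simp]: "space angle_measure = {0..2 * pi}"
  by (simp add: angle_measure_def space_restrict_space)

lemma measurable_angle_measure [measurable (raw)]: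
  "f \<in> measurable borel N \<Longrightarrow> f \<in> measurable angle_measure N"
  unfolding angle_measure_def by (rule measurable_restrict_space1) simp

lemma emeasure_angle_measure_UNIV: "emeasure angle_measure {0..2 * pi} = ennreal (2 * pi)"
  by (simp add: angle_measure_def emeasure_restrict_space)

lemma finite_measure_angle: "finite_measure angle_measure"
  by (rule finite_measureI) (simp add: emeasure_angle_measure_UNIV)

interpretation angle: finite_measure angle_measure
  by (rule finite_measure_angle)

lemma measure_angle_UNIV: "measure angle_measure {0..2 * pi} = 2 * pi"
  by (simp add: measure_def emeasure_angle_measure_UNIV)

lemma integral_angle_eq:
  fixes f :: "real \<Rightarrow> 'b::{banach,second_countable_topology}"
  shows "(LBINT t:{0..2 * pi}. f t) = (\<integral>t. f t \<partial>angle_measure)"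
  by (simp add: set_lebesgue_integral_def angle_measure_def integral_restrict_space)

lemma integrable_angle_bounded:
  fixes f :: "real \<Rightarrow> 'b::{banach,second_countable_topology}"
  assumes "f \<in> borel_measurable borel" "\<And>t. t \<in> {0..2 * pi} \<Longrightarrow> norm (f t) \<le> M"
  shows "integrable angle_measure f"
  by (rule angle.integrable_const_bound[where B = M])
     (use assms in \<open>auto intro!: AE_I2 measurable_angle_measure\<close>)

lemma AE_angle_iff: "(AE t in angle_measure. P t) \<longleftrightarrow> (AE t in lborel. t \<in> {0..2 * pi} \<longrightarrow> P t)"
  unfolding angle_measure_def by (rule AE_restrict_space_iff) simp

lemma AE_angle_interior: "AE t in angle_measure. t \<in> {0<..<2 * pi}"
  unfolding AE_angle_iff
  using AE_lborel_singleton[of "0::real"] AE_lborel_singleton[of "2 * pi"]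
  by eventually_elim auto

lemma continuous_on_cis_scaled:
  assumes "continuous_on (ball 0 1) h" "\<bar>r\<bar> < 1"
  shows "continuous_on A (\<lambda>t. h (of_real r * cis t))"
  by (rule continuous_on_compose2[OF assms(1)])
     (use assms in \<open>auto intro!: continuous_intros simp: norm_mult\<close>)

lemma schur_continuous_on: "schur h \<Longrightarrow> continuous_on (ball 0 1) h"
  by (simp add: schur_def holomorphic_on_imp_continuous_on)

lemma schur_norm_le: "schur h \<Longrightarrow> norm z < 1 \<Longrightarrow> norm (h z) \<le> 1"
  by (simp add: schur_def)

lemma schur_circle_measurable:
  assumes "schur h" "\<bar>r\<bar> < 1"
  shows "(\<lambda>t. h (of_real r * cis t)) \<in> borel_measurable borel"
  by (intro borel_measurable_continuous_onI continuous_on_cis_scaled schur_continuous_on assms)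

lemma poisson_formula_angle:
  fixes f :: "complex \<Rightarrow> complex"
  assumes f: "continuous_on (cball 0 1) f" "f holomorphic_on ball 0 1" and r: "0 \<le> r" "r < 1"
  shows "(\<integral>t. poisson_angle r (t - \<theta>) *\<^sub>R f (cis t) \<partial>angle_measure) = (2 * pi) *\<^sub>R f (of_real r * cis \<theta>)"
  using poisson_formula[OF assms] by (simp only: integral_angle_eq)

lemma poisson_limit_AE:
  fixes \<phi> :: "real \<Rightarrow> 'b::euclidean_space"
  assumes "\<phi> \<in> borel_measurable borel" "\<And>x. norm (\<phi> x) \<le> M"
  shows "AE \<theta> in angle_measure.
    ((\<lambda>r. \<integral>t. poisson_angle r (t - \<theta>) *\<^sub>R \<phi> t \<partial>angle_measure) \<longlongrightarrow> (2 * pi) *\<^sub>R \<phi> \<theta>) (at_left 1)"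
proof -
  have "AE \<theta> in angle_measure. \<theta> \<in> {0<..<2 * pi} \<longrightarrow>
    ((\<lambda>r. \<integral>t. poisson_angle r (t - \<theta>) *\<^sub>R \<phi> t \<partial>angle_measure) \<longlongrightarrow> (2 * pi) *\<^sub>R \<phi> \<theta>) (at_left 1)"
    using poisson_integral_limit_AE[OF assms] unfolding AE_angle_iff integral_angle_eq
    by eventually_elim blast
  then show ?thesis using AE_angle_interior by eventually_elim blast
qed

section \<open>Parseval's identity for absolutely summable Fourier series\<close>

lemma integral_cis_multiple:
  "(\<integral>t. cis (real m * t) * cnj (cis (real n * t)) \<partial>angle_measure) = (if m = n then 2 * pi else 0)"
proof (cases "m = n")
  case True
  then show ?thesis
    by (simp add: cis_cnj cis_mult measure_angle_UNIV scaleR_conv_of_real)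
next
  case False
  define c where "c = \<i> * of_real (real m - real n)"
  have c: "c \<noteq> 0" using False by (simp add: c_def)
  have eq: "cis (real m * t) * cnj (cis (real n * t)) = exp (c * of_real t)" for t
    unfolding cis_cnj cis_mult by (simp add: cis_conv_exp c_def algebra_simps)
  have "(\<integral>t. exp (c * of_real t) \<partial>angle_measure) = (LBINT t. indicator {0..2 * pi} t *\<^sub>R exp (c * of_real t))"
    unfolding integral_angle_eq[symmetric] set_lebesgue_integral_def ..
  also have "\<dots> = exp (c * of_real (2 * pi)) / c - exp (c * of_real 0) / c"
  proof (rule integral_FTC_Icc)
    fix t :: real
    have "((\<lambda>z. exp (c * z) / c) has_field_derivative exp (c * of_real t)) (at (of_real t))"
      using c by (auto intro!: derivative_eq_intros)
    then show "((\<lambda>t. exp (c * of_real t) / c) has_vector_derivative exp (c * of_real t))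
        (at t within {0..2 * pi})"
      by (rule has_vector_derivative_real_field)
  qed (auto intro!: continuous_intros)
  also have "exp (c * of_real (2 * pi)) = 1"
    unfolding exp_eq_1 c_def by (auto intro!: exI[of _ "int m - int n"] simp: algebra_simps)
  finally show ?thesis using False by (simp add: eq)
qed

lemma sums_integral_angle_cis:
  assumes c: "summable (\<lambda>n. norm (c n))" and g: "g \<in> borel_measurable borel" "\<And>t. norm (g t) \<le> B"
  shows "(\<lambda>n. c n * (\<integral>t. cis (real n * t) * g t \<partial>angle_measure)) sums
    (\<integral>t. (\<Sum>n. c n * cis (real n * t)) * g t \<partial>angle_measure)"
proof -
  have B: "0 \<le> B" using g(2)[of 0] norm_ge_zero order_trans by blast
  have [measurable]: "g \<in> borel_measurable borel" by (rule g)
  have bd: "norm (c n * cis (real n * t) * g t) \<le> norm (c n) * B" for n t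
    using g(2)[of t] by (simp add: norm_mult mult_left_mono)
  have meas: "(\<lambda>t. c n * cis (real n * t) * g t) \<in> borel_measurable borel" for n
    by (intro borel_measurable_times borel_measurable_continuous_onI continuous_intros g(1))
  have int: "integrable angle_measure (\<lambda>t. c n * cis (real n * t) * g t)" for n
    by (rule integrable_angle_bounded[OF meas bd])
  have sm: "summable (\<lambda>n. norm (c n) * B)" using c by (rule summable_mult2)
  have "(\<lambda>n. \<integral>t. c n * cis (real n * t) * g t \<partial>angle_measure) sums
    (\<integral>t. (\<Sum>n. c n * cis (real n * t) * g t) \<partial>angle_measure)"
  proof (rule sums_integral[OF int])
    show "AE t in angle_measure. summable (\<lambda>n. norm (c n * cis (real n * t) * g t))"
      by (intro AE_I2 summable_comparison_test'[OF sm]) (use bd in auto)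
    show "summable (\<lambda>n. \<integral>t. norm (c n * cis (real n * t) * g t) \<partial>angle_measure)"
    proof (rule summable_comparison_test'[OF summable_mult2[OF sm, of "2 * pi"]])
      fix n
      have "(\<integral>t. norm (c n * cis (real n * t) * g t) \<partial>angle_measure) \<le> (\<integral>t. norm (c n) * B \<partial>angle_measure)"
        by (rule integral_mono[OF integrable_norm[OF int]]) (use bd in auto)
      also have "\<dots> = norm (c n) * B * (2 * pi)" using measure_angle_UNIV by simp
      finally show "norm (\<integral>t. norm (c n * cis (real n * t) * g t) \<partial>angle_measure) \<le> norm (c n) * B * (2 * pi)"
        by (simp only: real_norm_def abs_of_nonneg[OF Bochner_Integration.integral_nonneg] norm_ge_zero)
    qed
  qed
  moreover have "(\<Sum>n. c n * cis (real n * t) * g t) = (\<Sum>n. c n * cis (real n * t)) * g t" for t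
    by (rule suminf_mult2[symmetric], rule summable_norm_cancel) (simp add: norm_mult c)
  ultimately show ?thesis by (simp add: mult.assoc)
qed

text \<open>Sum and integral are exchanged twice: against a conjugate character, which by
  orthogonality extracts \<open>c n\<close>, and against \<open>cnj (d t)\<close>, which then
  produces the sum of squares.\<close>

lemma parseval_absolutely_summable:
  assumes c: "summable (\<lambda>n. norm (c n))"
  shows "(\<lambda>n. 2 * pi * (norm (c n))\<^sup>2) sums (\<integral>t. (norm (\<Sum>n. c n * cis (real n * t)))\<^sup>2 \<partial>angle_measure)"
proof -
  define d where "d = (\<lambda>t. \<Sum>n. c n * cis (real n * t))"
  have sn: "summable (\<lambda>n. norm (c n * cis (real n * t)))" for t
    using c by (simp add: norm_mult)
  have bd: "norm (d t) \<le> (\<Sum>n. norm (c n))" for t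
    unfolding d_def using summable_norm[OF sn[of t]] by (simp add: norm_mult)
  have "continuous_on UNIV d"
    unfolding d_def
  proof (rule uniform_limit_theorem[where F = sequentially])
    show "uniform_limit UNIV (\<lambda>n t. \<Sum>i<n. c i * cis (real i * t)) (\<lambda>t. \<Sum>n. c n * cis (real n * t)) sequentially"
      by (rule Weierstrass_m_test[OF _ c]) (simp add: norm_mult)
    show "\<forall>\<^sub>F n in sequentially. continuous_on UNIV (\<lambda>t. \<Sum>i<n. c i * cis (real i * t))"
      by (intro always_eventually allI continuous_intros)
  qed simp
  then have meas': "(\<lambda>t. cnj (d t)) \<in> borel_measurable borel"
    by (intro borel_measurable_continuous_onI continuous_intros)
  have bd': "norm (cnj (d t)) \<le> (\<Sum>n. norm (c n))" for t using bd by simp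
  have 1: "(\<integral>t. d t * cnj (cis (real n * t)) \<partial>angle_measure) = 2 * pi * c n" for n
  proof -
    have "(\<lambda>m. c m * (\<integral>t. cis (real m * t) * cnj (cis (real n * t)) \<partial>angle_measure)) sums
      (\<integral>t. d t * cnj (cis (real n * t)) \<partial>angle_measure)"
      unfolding d_def by (rule sums_integral_angle_cis[OF c, where B = 1])
        (auto intro!: borel_measurable_continuous_onI continuous_intros)
    moreover have "(\<lambda>m. c m * (\<integral>t. cis (real m * t) * cnj (cis (real n * t)) \<partial>angle_measure))
      = (\<lambda>m. if m = n then 2 * pi * c m else 0)"
      unfolding integral_cis_multiple by auto
    ultimately have "(\<lambda>m. if m = n then 2 * pi * c m else 0) sums
      (\<integral>t. d t * cnj (cis (real n * t)) \<partial>angle_measure)"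
      by (simp only:)
    then show ?thesis
      using sums_single[of n "\<lambda>m. 2 * pi * c m"] by (rule sums_unique2)
  qed
  have 2: "(\<lambda>n. c n * (\<integral>t. cis (real n * t) * cnj (d t) \<partial>angle_measure)) sums
      (\<integral>t. d t * cnj (d t) \<partial>angle_measure)"
    using sums_integral_angle_cis[OF c meas' bd'] unfolding d_def .
  have 3: "(\<integral>t. cis (real n * t) * cnj (d t) \<partial>angle_measure) = 2 * pi * cnj (c n)" for n
  proof -
    have "(\<integral>t. cis (real n * t) * cnj (d t) \<partial>angle_measure)
        = (\<integral>t. cnj (d t * cnj (cis (real n * t))) \<partial>angle_measure)"
      by (intro Bochner_Integration.integral_cong) (simp_all only: complex_cnj_mult complex_cnj_cnj mult.commute)
    also have "\<dots> = cnj (\<integral>t. d t * cnj (cis (real n * t)) \<partial>angle_measure)"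
      by (rule Bochner_Integration.integral_cnj)
    finally show ?thesis unfolding 1 by simp
  qed
  have nsq: "w * cnj w = of_real ((norm w)\<^sup>2)" for w
    by (rule complex_norm_square[symmetric])
  have 4: "c n * (of_real (2 * pi) * cnj (c n)) = of_real (2 * pi * (norm (c n))\<^sup>2)" for n
    using nsq[of "c n"] by (subst mult.left_commute) simp
  have 5: "(\<integral>t. d t * cnj (d t) \<partial>angle_measure) = of_real (\<integral>t. (norm (d t))\<^sup>2 \<partial>angle_measure)"
    unfolding nsq by (rule integral_complex_of_real)
  show ?thesis
    using 2 unfolding 3 4 5 sums_of_real_iff unfolding d_def .
qed

text \<open>Monotone convergence: the pointwise sum of the norms has a finite integral, hence is
  finite almost everywhere.\<close>

lemma AE_summable_norm:
  fixes f :: "nat \<Rightarrow> 'a \<Rightarrow> 'b::{banach,second_countable_topology}"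
  assumes int: "\<And>k. integrable M (f k)" and sm: "summable (\<lambda>k. \<integral>x. norm (f k x) \<partial>M)"
  shows "AE x in M. summable (\<lambda>k. norm (f k x))"
proof -
  have [measurable]: "f k \<in> borel_measurable M" for k using int by auto
  have "(\<integral>\<^sup>+x. (\<Sum>k. ennreal (norm (f k x))) \<partial>M) = (\<Sum>k. \<integral>\<^sup>+x. ennreal (norm (f k x)) \<partial>M)"
    by (rule nn_integral_suminf) measurable
  also have "\<dots> = (\<Sum>k. ennreal (\<integral>x. norm (f k x) \<partial>M))"
    by (intro suminf_cong nn_integral_eq_integral integrable_norm int) auto
  also have "\<dots> = ennreal (\<Sum>k. \<integral>x. norm (f k x) \<partial>M)"
    by (rule suminf_ennreal2) (use sm in auto)
  finally have "(\<integral>\<^sup>+x. (\<Sum>k. ennreal (norm (f k x))) \<partial>M) \<noteq> \<infinity>" by simp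
  then have "AE x in M. (\<Sum>k. ennreal (norm (f k x))) \<noteq> \<infinity>"
    by (intro nn_integral_PInf_AE) measurable
  then show ?thesis
    by eventually_elim (rule summable_suminf_not_top, auto)
qed

section \<open>Square-summable coefficients and the boundary function\<close>

lemma schur_power_series:
  assumes "schur h"
  obtains a where "\<And>z. norm z < 1 \<Longrightarrow> (\<lambda>n. a n * z ^ n) sums h z"
    "\<And>r. 0 \<le> r \<Longrightarrow> r < 1 \<Longrightarrow> summable (\<lambda>n. norm (a n) * r ^ n)"
proof -
  define a where "a = (\<lambda>n. (deriv ^^ n) h 0 / fact n)"
  have s: "(\<lambda>n. a n * z ^ n) sums h z" if "norm z < 1" for z
    using holomorphic_power_series[of h 0 1 z] assms that by (simp add: schur_def a_def)
  have "summable (\<lambda>n. norm (a n) * r ^ n)" if r: "0 \<le> r" "r < 1" for r :: real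
  proof -
    have "summable (\<lambda>n. a n * (of_real ((r + 1) / 2)) ^ n)"
      using s[of "of_real ((r + 1) / 2)"] r by (intro sums_summable[of _ "h (of_real ((r + 1) / 2))"]) (simp del: of_real_divide of_real_add)
    from powser_insidea[OF this, of "of_real r"] r show ?thesis
      by (simp add: norm_mult norm_power del: of_real_divide of_real_add)
  qed
  with s show ?thesis using that by blast
qed

text \<open>Parseval on the circle of radius \<open>r < 1\<close>, where the power series is
  absolutely summable. Since \<open>h\<close> is bounded by 1, every partial sum of the squares
  weighted by \<open>(r ^ n)\<^sup>2\<close> is at most 1, and \<open>r\<close> can tend to 1 in the
  finite sums.\<close>

lemma schur_coefficients_square_summable:
  assumes h: "schur h"
  obtains a where
    "\<And>r s. 0 \<le> r \<Longrightarrow> r < 1 \<Longrightarrow> 0 \<le> s \<Longrightarrow> s < 1 \<Longrightarrow> (\<lambda>n. 2 * pi * ((norm (a n))\<^sup>2 * (r ^ n - s ^ n)\<^sup>2)) sums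
      (\<integral>t. (norm (h (of_real r * cis t) - h (of_real s * cis t)))\<^sup>2 \<partial>angle_measure)"
    "summable (\<lambda>n. (norm (a n :: complex))\<^sup>2)"
proof -
  obtain a where a: "\<And>z. norm z < 1 \<Longrightarrow> (\<lambda>n. a n * z ^ n) sums h z"
    "\<And>r. 0 \<le> r \<Longrightarrow> r < 1 \<Longrightarrow> summable (\<lambda>n. norm (a n) * r ^ n)"
    using schur_power_series[OF h] by blast
  have ser: "(\<lambda>n. a n * of_real (r ^ n) * cis (real n * t)) sums h (of_real r * cis t)"
    if "0 \<le> r" "r < 1" for r t
    using a(1)[of "of_real r * cis t"] that
    by (simp add: norm_mult power_mult_distrib Complex.DeMoivre mult.assoc)
  have 1: "(\<lambda>n. 2 * pi * ((norm (a n))\<^sup>2 * (r ^ n - s ^ n)\<^sup>2)) sums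
      (\<integral>t. (norm (h (of_real r * cis t) - h (of_real s * cis t)))\<^sup>2 \<partial>angle_measure)"
    if r: "0 \<le> r" "r < 1" and s: "0 \<le> s" "s < 1" for r s
  proof -
    define c where "c = (\<lambda>n. a n * of_real (r ^ n) - a n * of_real (s ^ n))"
    have "summable (\<lambda>n. norm (c n))"
    proof (rule summable_comparison_test'[OF summable_add[OF a(2)[OF r] a(2)[OF s]]])
      fix n
      show "norm (norm (c n)) \<le> norm (a n) * r ^ n + norm (a n) * s ^ n"
        using norm_triangle_ineq4[of "a n * of_real (r ^ n)" "a n * of_real (s ^ n)"] r s
        by (simp add: c_def norm_mult norm_power)
    qed
    from parseval_absolutely_summable[OF this]
    have "(\<lambda>n. 2 * pi * (norm (c n))\<^sup>2) sums (\<integral>t. (norm (\<Sum>n. c n * cis (real n * t)))\<^sup>2 \<partial>angle_measure)" .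
    moreover have "(\<Sum>n. c n * cis (real n * t)) = h (of_real r * cis t) - h (of_real s * cis t)" for t
      using sums_diff[OF ser[OF r] ser[OF s], of t t] by (simp add: c_def left_diff_distrib sums_iff)
    moreover have "(norm (c n))\<^sup>2 = (norm (a n))\<^sup>2 * (r ^ n - s ^ n)\<^sup>2" for n
    proof -
      have "c n = a n * of_real (r ^ n - s ^ n)" by (simp add: c_def right_diff_distrib)
      then have "norm (c n) = norm (a n) * \<bar>r ^ n - s ^ n\<bar>" by (simp only: norm_mult norm_of_real)
      then show ?thesis by (simp add: power_mult_distrib)
    qed
    ultimately show ?thesis by simp
  qed
  have 2: "(\<Sum>n<N. (norm (a n))\<^sup>2 * (r ^ n)\<^sup>2) \<le> 1" if r: "0 \<le> r" "r < 1" for r N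
  proof -
    have "summable (\<lambda>n. norm (a n * of_real (r ^ n)))"
      using a(2)[OF r] r by (simp add: norm_mult norm_power)
    from parseval_absolutely_summable[OF this]
    have S: "(\<lambda>n. 2 * pi * (norm (a n * of_real (r ^ n)))\<^sup>2) sums
        (\<integral>t. (norm (\<Sum>n. a n * of_real (r ^ n) * cis (real n * t)))\<^sup>2 \<partial>angle_measure)" .
    have h': "(\<Sum>n. a n * of_real (r ^ n) * cis (real n * t)) = h (of_real r * cis t)" for t
      using ser[OF r, of t] by (simp add: sums_iff)
    have le: "(norm (h (of_real r * cis t)))\<^sup>2 \<le> 1" for t
      using schur_norm_le[OF h, of "of_real r * cis t"] r by (simp add: norm_mult power_le_one)
    have "(\<integral>t. (norm (h (of_real r * cis t)))\<^sup>2 \<partial>angle_measure) \<le> (\<integral>t. 1 \<partial>angle_measure)"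
    proof (rule integral_mono)
      show "integrable angle_measure (\<lambda>t. (norm (h (of_real r * cis t)))\<^sup>2)"
        using schur_circle_measurable[OF h, of r] r
        by (intro integrable_angle_bounded[where M = 1]) (auto simp: le)
    qed (auto simp: le)
    also have "\<dots> = 2 * pi" by (simp add: measure_angle_UNIV)
    finally have "(\<Sum>n<N. 2 * pi * (norm (a n * of_real (r ^ n)))\<^sup>2) \<le> 2 * pi"
      using sum_le_suminf[OF sums_summable[OF S], of "{..<N}"] sums_unique[OF S] unfolding h' by simp
    then have "2 * pi * (\<Sum>n<N. (norm (a n))\<^sup>2 * (r ^ n)\<^sup>2) \<le> 2 * pi * 1"
      using r by (simp add: sum_distrib_left norm_mult norm_power power_mult_distrib)
    then show ?thesis by (subst (asm) mult_le_cancel_left_pos) auto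
  qed
  have "(\<Sum>n<N. (norm (a n))\<^sup>2) \<le> 1" for N
  proof -
    have "((\<lambda>r. \<Sum>n<N. (norm (a n))\<^sup>2 * (r ^ n)\<^sup>2) \<longlongrightarrow> (\<Sum>n<N. (norm (a n))\<^sup>2 * (1 ^ n)\<^sup>2)) (at_left 1)"
      by (intro tendsto_intros)
    moreover have "eventually (\<lambda>r. (\<Sum>n<N. (norm (a n))\<^sup>2 * (r ^ n)\<^sup>2) \<le> 1) (at_left 1)"
      using eventually_at_left_real[of 0 1] by (auto elim!: eventually_mono intro: 2)
    ultimately have "(\<Sum>n<N. (norm (a n))\<^sup>2 * (1 ^ n)\<^sup>2) \<le> 1"
      by (intro tendsto_upperbound[of _ _ "at_left (1::real)"]) auto
    then show ?thesis by simp
  qed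
  then have "summable (\<lambda>n. (norm (a n))\<^sup>2)"
    by (intro summableI_nonneg_bounded[where x = 1]) auto
  with 1 show ?thesis using that by blast
qed

text \<open>The radii are chosen for speed: the rate \<open>(1 / 4) ^ k\<close> for squared norms
  makes the successive differences summable in L1, which yields convergence almost everywhere along
  the sequence.\<close>

lemma circle_means_Cauchy:
  assumes h: "schur h"
  obtains r :: "nat \<Rightarrow> real" where "\<And>k. 0 \<le> r k" "\<And>k. r k < 1" "r \<longlonglongrightarrow> 1"
    "\<And>k. (\<integral>t. (norm (h (of_real (r k) * cis t) - h (of_real (r (Suc k)) * cis t)))\<^sup>2 \<partial>angle_measure)
      \<le> 4 * pi * (1 / 4) ^ k"
proof -
  obtain a where a:
    "\<And>r s. 0 \<le> r \<Longrightarrow> r < 1 \<Longrightarrow> 0 \<le> s \<Longrightarrow> s < 1 \<Longrightarrow> (\<lambda>n. 2 * pi * ((norm (a n))\<^sup>2 * (r ^ n - s ^ n)\<^sup>2)) sums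
      (\<integral>t. (norm (h (of_real r * cis t) - h (of_real s * cis t)))\<^sup>2 \<partial>angle_measure)"
    "summable (\<lambda>n. (norm (a n :: complex))\<^sup>2)"
    using schur_coefficients_square_summable[OF h] by blast
  \<comment> \<open>Up to the factor \<open>2 * pi\<close>, the squared L2 distance from the circle
    of radius \<open>r\<close> to the boundary, expressed by coefficients because no boundary
    function is available yet. Dominated convergence of series sends it to 0.\<close>
  define e where "e = (\<lambda>r. \<Sum>n. (norm (a n))\<^sup>2 * (1 - r ^ n)\<^sup>2)"
  have bd: "(norm (a n))\<^sup>2 * (1 - r ^ n)\<^sup>2 \<le> (norm (a n))\<^sup>2" if "0 \<le> r" "r < 1" for r n
  proof -
    have "(1 - r ^ n)\<^sup>2 \<le> 1" using that by (intro power_le_one) (auto simp: power_le_one)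
    then show ?thesis by (simp add: mult_left_le)
  qed
  have es: "summable (\<lambda>n. (norm (a n))\<^sup>2 * (1 - r ^ n)\<^sup>2)" if "0 \<le> r" "r < 1" for r
    by (rule summable_comparison_test'[OF a(2)]) (use bd[OF that] in simp)
  have "((\<lambda>r. \<Sum>n. (norm (a n))\<^sup>2 * (1 - r ^ n)\<^sup>2) \<longlongrightarrow> (\<Sum>n. 0)) (at_left 1)"
  proof (rule tannerys_theorem[THEN conjunct2, THEN conjunct2])
    fix n
    have "((\<lambda>r. (norm (a n))\<^sup>2 * (1 - r ^ n)\<^sup>2) \<longlongrightarrow> (norm (a n))\<^sup>2 * (1 - 1 ^ n)\<^sup>2) (at_left 1)"
      by (intro tendsto_intros)
    then show "((\<lambda>r. (norm (a n))\<^sup>2 * (1 - r ^ n)\<^sup>2) \<longlongrightarrow> 0) (at_left 1)" by simp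
  next
    have "eventually (\<lambda>r. r \<in> {0<..<1}) (at_left (1::real))"
      using eventually_at_left_real[of 0 "1::real"] by simp
    then have "eventually (\<lambda>x. True \<and> snd x \<in> {0<..<1}) (sequentially \<times>\<^sub>F at_left (1::real))"
      by (intro eventually_prodI) auto
    then show "\<forall>\<^sub>F (n, r) in sequentially \<times>\<^sub>F at_left 1. norm ((norm (a n))\<^sup>2 * (1 - r ^ n)\<^sup>2) \<le> (norm (a n))\<^sup>2"
      by (rule eventually_mono) (use bd in \<open>auto\<close>)
  qed (use a(2) in auto)
  then have "(e \<longlongrightarrow> 0) (at_left 1)" by (simp add: e_def)
  then have ev: "eventually (\<lambda>r. e r < (1 / 4) ^ k) (at_left 1)" for k :: nat
    by (intro order_tendstoD(2)) auto
  have "\<exists>r. max 0 (1 - 1 / real (Suc k)) < r \<and> r < 1 \<and> e r < (1 / 4) ^ k" for k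
  proof -
    have "eventually (\<lambda>r. r \<in> {max 0 (1 - 1 / real (Suc k))<..<1}) (at_left (1::real))"
      by (rule eventually_at_left_real) simp
    with ev[of k] have "eventually (\<lambda>r. max 0 (1 - 1 / real (Suc k)) < r \<and> r < 1 \<and> e r < (1 / 4) ^ k) (at_left 1)"
      by eventually_elim auto
    then show ?thesis using eventually_happens'[of "at_left (1::real)"] by auto
  qed
  then obtain r where r: "\<And>k. max 0 (1 - 1 / real (Suc k)) < r k \<and> r k < 1 \<and> e (r k) < (1 / 4) ^ k"
    by metis
  have r': "0 \<le> r k" "r k < 1" for k using r[of k] unfolding max_less_iff_conj by (blast intro: less_imp_le)+
  show ?thesis
  proof (rule that[of r])
    show "r \<longlonglongrightarrow> 1"
    proof (rule tendsto_sandwich)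
      have "(\<lambda>k. 1 - 1 / real (Suc k)) \<longlonglongrightarrow> 1 - 0"
        using LIMSEQ_inverse_real_of_nat by (intro tendsto_diff tendsto_const) (simp add: inverse_eq_divide)
      then show "(\<lambda>k. 1 - 1 / real (Suc k)) \<longlonglongrightarrow> 1" by simp
      show "(\<lambda>_. 1) \<longlonglongrightarrow> (1::real)" by simp
    qed (use r in \<open>auto intro!: always_eventually less_imp_le\<close>)
    fix k
    let ?r = "r k" and ?s = "r (Suc k)"
    have S: "(\<lambda>n. 2 * pi * ((norm (a n))\<^sup>2 * (?r ^ n - ?s ^ n)\<^sup>2)) sums
        (\<integral>t. (norm (h (of_real ?r * cis t) - h (of_real ?s * cis t)))\<^sup>2 \<partial>angle_measure)"
      by (rule a(1)) (use r' in auto)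
    have T: "(\<lambda>n. 2 * pi * ((norm (a n))\<^sup>2 * (1 - ?r ^ n)\<^sup>2 + (norm (a n))\<^sup>2 * (1 - ?s ^ n)\<^sup>2)) sums
        (2 * pi * (e ?r + e ?s))"
      unfolding e_def by (intro sums_mult sums_add summable_sums es r')
    have "(\<integral>t. (norm (h (of_real ?r * cis t) - h (of_real ?s * cis t)))\<^sup>2 \<partial>angle_measure) \<le> 2 * pi * (e ?r + e ?s)"
    proof (rule sums_le[OF _ S T])
      fix n
      have "(?r ^ n - ?s ^ n)\<^sup>2 \<le> (1 - ?r ^ n)\<^sup>2 + (1 - ?s ^ n)\<^sup>2"
      proof -
        have "0 \<le> (1 - ?r ^ n) * (1 - ?s ^ n)"
          using r' by (intro mult_nonneg_nonneg) (auto simp: power_le_one less_imp_le)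
        then show ?thesis by (simp add: power2_eq_square algebra_simps)
      qed
      then have "(norm (a n))\<^sup>2 * (?r ^ n - ?s ^ n)\<^sup>2 \<le> (norm (a n))\<^sup>2 * ((1 - ?r ^ n)\<^sup>2 + (1 - ?s ^ n)\<^sup>2)"
        by (rule mult_left_mono) simp
      then have "(norm (a n))\<^sup>2 * (?r ^ n - ?s ^ n)\<^sup>2
          \<le> (norm (a n))\<^sup>2 * (1 - ?r ^ n)\<^sup>2 + (norm (a n))\<^sup>2 * (1 - ?s ^ n)\<^sup>2"
        by (simp only: distrib_left)
      then show "2 * pi * ((norm (a n))\<^sup>2 * (?r ^ n - ?s ^ n)\<^sup>2)
          \<le> 2 * pi * ((norm (a n))\<^sup>2 * (1 - ?r ^ n)\<^sup>2 + (norm (a n))\<^sup>2 * (1 - ?s ^ n)\<^sup>2)"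
        by (rule mult_left_mono) simp
    qed
    also have "\<dots> \<le> 2 * pi * ((1 / 4) ^ k + (1 / 4) ^ k)"
    proof -
      have "(1 / 4 :: real) ^ Suc k \<le> (1 / 4) ^ k" by simp
      then have "e ?r + e ?s \<le> (1 / 4) ^ k + (1 / 4) ^ k" using r[of k] r[of "Suc k"] by linarith
      then show ?thesis by (rule mult_left_mono) simp
    qed
    finally show "(\<integral>t. (norm (h (of_real ?r * cis t) - h (of_real ?s * cis t)))\<^sup>2 \<partial>angle_measure)
        \<le> 4 * pi * (1 / 4) ^ k" by simp
  qed (use r' in auto)
qed

text \<open>Convergence along special radii defines \<phi>, and bounded convergence in the Poisson
  formula represents \<open>h\<close> as the Poisson integral of \<phi>. Only then does the theorem
  on Lebesgue points give the limit along all radii.\<close>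

lemma schur_boundary_function:
  assumes h: "schur h"
  obtains \<phi> where "\<phi> \<in> borel_measurable borel" "\<And>t. norm (\<phi> t :: complex) \<le> 1"
    "\<And>r \<theta>. 0 \<le> r \<Longrightarrow> r < 1 \<Longrightarrow>
      (\<integral>t. poisson_angle r (t - \<theta>) *\<^sub>R \<phi> t \<partial>angle_measure) = (2 * pi) *\<^sub>R h (of_real r * cis \<theta>)"
    "AE t in angle_measure. ((\<lambda>r. h (of_real r * cis t)) \<longlongrightarrow> \<phi> t) (at_left 1)"
proof -
  obtain r :: "nat \<Rightarrow> real" where r: "\<And>k. 0 \<le> r k" "\<And>k. r k < 1" "r \<longlonglongrightarrow> 1"
    "\<And>k. (\<integral>t. (norm (h (of_real (r k) * cis t) - h (of_real (r (Suc k)) * cis t)))\<^sup>2 \<partial>angle_measure)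
      \<le> 4 * pi * (1 / 4) ^ k"
    using circle_means_Cauchy[OF h] by blast
  define x where "x = (\<lambda>k t. h (of_real (r k) * cis t))"
  define D where "D = (\<lambda>k t. x k t - x (Suc k) t)"
  have xm [measurable]: "x k \<in> borel_measurable borel" for k
    unfolding x_def by (rule schur_circle_measurable[OF h]) (use r in auto)
  have x1: "norm (x k t) \<le> 1" for k t
    unfolding x_def using r by (intro schur_norm_le[OF h]) (simp add: norm_mult)
  have Dm [measurable]: "D k \<in> borel_measurable borel" for k unfolding D_def by measurable
  have D2: "norm (D k t) \<le> 2" for k t
    unfolding D_def using norm_triangle_ineq4[of "x k t" "x (Suc k) t"] x1[of k t] x1[of "Suc k" t] by linarith
  have Di: "integrable angle_measure (D k)" for k
    by (rule integrable_angle_bounded[OF Dm D2])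
  have Di2: "integrable angle_measure (\<lambda>t. (norm (D k t))\<^sup>2)" for k
  proof (rule integrable_angle_bounded[where M = "2\<^sup>2"])
    show "norm ((norm (D k t))\<^sup>2) \<le> 2\<^sup>2" for t using power_mono[OF D2[of k t], of 2] by simp
  qed measurable
  have D1: "(\<integral>t. norm (D k t) \<partial>angle_measure) \<le> 3 * pi * (1 / 2) ^ k" for k
  proof -
    \<comment> \<open>The arithmetic-geometric mean inequality with weight \<open>2 ^ k\<close>,
      chosen so that the squared norm of order \<open>(1 / 4) ^ k\<close> and the constant term both
      contribute order \<open>(1 / 2) ^ k\<close>.\<close>
    have "(\<integral>t. norm (D k t) \<partial>angle_measure) \<le> (\<integral>t. (2 ^ k * (norm (D k t))\<^sup>2 + (1 / 2) ^ k) / 2 \<partial>angle_measure)"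
    proof (rule integral_mono)
      show "integrable angle_measure (\<lambda>t. (2 ^ k * (norm (D k t))\<^sup>2 + (1 / 2) ^ k) / 2)"
        using Di2 by simp
      fix t
      have "0 \<le> 2 ^ k * (norm (D k t) - (1 / 2) ^ k)\<^sup>2" by simp
      also have "\<dots> = 2 ^ k * (norm (D k t))\<^sup>2 - 2 * norm (D k t) * (2 ^ k * (1 / 2) ^ k) + 2 ^ k * (1 / 2) ^ k * (1 / 2) ^ k"
        by (simp add: power2_diff power2_eq_square[of "(1 / 2) ^ k"] algebra_simps)
      also have "2 ^ k * (1 / 2 :: real) ^ k = 1" by (simp flip: power_mult_distrib)
      finally show "norm (D k t) \<le> (2 ^ k * (norm (D k t))\<^sup>2 + (1 / 2) ^ k) / 2" by simp
    qed (use Di in simp)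
    also have "\<dots> = (2 ^ k * (\<integral>t. (norm (D k t))\<^sup>2 \<partial>angle_measure) + (1 / 2) ^ k * (2 * pi)) / 2"
      using Di2[of k] by (simp add: measure_angle_UNIV)
    also have "\<dots> \<le> (2 ^ k * (4 * pi * (1 / 4) ^ k) + (1 / 2) ^ k * (2 * pi)) / 2"
      using r(4)[of k] unfolding D_def x_def by (intro divide_right_mono add_mono mult_left_mono) auto
    also have "2 ^ k * (4 * pi * (1 / 4) ^ k) = 4 * pi * (1 / 2) ^ k"
      using power_mult_distrib[of 2 "1/4::real" k] by simp
    finally show ?thesis by simp
  qed
  have "AE t in angle_measure. summable (\<lambda>k. norm (D k t))"
  proof (rule AE_summable_norm[OF Di])
    show "summable (\<lambda>k. \<integral>t. norm (D k t) \<partial>angle_measure)"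
    proof (rule summable_comparison_test')
      show "summable (\<lambda>k. 3 * pi * (1 / 2 :: real) ^ k)" by (intro summable_mult summable_geometric) simp
      show "norm (\<integral>t. norm (D k t) \<partial>angle_measure) \<le> 3 * pi * (1 / 2) ^ k" if "k \<ge> 0" for k
        using D1[of k] by simp
    qed
  qed
  then have conv: "AE t in angle_measure. convergent (\<lambda>k. x k t)"
  proof eventually_elim
    case (elim t)
    then have "summable (\<lambda>k. D k t)" by (rule summable_norm_cancel)
    then have "convergent (\<lambda>n. \<Sum>k<n. D k t)" unfolding summable_iff_convergent .
    moreover have "(\<Sum>k<n. D k t) = x 0 t - x n t" for n
      unfolding D_def by (rule sum_lessThan_telescope'[of "\<lambda>k. x k t"])
    ultimately have "convergent (\<lambda>n. x 0 t - x n t)" by simp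
    from convergent_diff[OF convergent_const[of "x 0 t"] this] show ?case by simp
  qed
  define \<phi>0 where "\<phi>0 = (\<lambda>t. lim (\<lambda>k. x k t))"
  have [measurable]: "\<phi>0 \<in> borel_measurable borel"
    unfolding \<phi>0_def by (rule borel_measurable_lim_metric) measurable
  \<comment> \<open>Where the sequence diverges, \<open>lim\<close> is an arbitrary value; the
    cutoff secures the bound 1 everywhere and changes nothing at points of convergence.\<close>
  define \<phi> where "\<phi> = (\<lambda>t. if norm (\<phi>0 t) \<le> 1 then \<phi>0 t else 0)"
  have \<phi>m [measurable]: "\<phi> \<in> borel_measurable borel" unfolding \<phi>_def by measurable
  have \<phi>1: "norm (\<phi> t) \<le> 1" for t by (simp add: \<phi>_def)
  have x\<phi>: "AE t in angle_measure. (\<lambda>k. x k t) \<longlonglongrightarrow> \<phi> t"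
    using conv
  proof eventually_elim
    case (elim t)
    then have l: "(\<lambda>k. x k t) \<longlonglongrightarrow> \<phi>0 t" by (simp add: \<phi>0_def convergent_LIMSEQ_iff)
    have "norm (\<phi>0 t) \<le> 1"
      by (rule tendsto_upperbound[OF tendsto_norm[OF l]]) (auto simp: x1)
    with l show ?case by (simp add: \<phi>_def)
  qed
  have P: "(\<integral>t. poisson_angle q (t - \<theta>) *\<^sub>R \<phi> t \<partial>angle_measure) = (2 * pi) *\<^sub>R h (of_real q * cis \<theta>)"
    if q: "0 \<le> q" "q < 1" for q \<theta>
  proof (rule LIMSEQ_unique)
    show "(\<lambda>k. \<integral>t. poisson_angle q (t - \<theta>) *\<^sub>R x k t \<partial>angle_measure)
        \<longlonglongrightarrow> (\<integral>t. poisson_angle q (t - \<theta>) *\<^sub>R \<phi> t \<partial>angle_measure)"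
    proof (rule integral_dominated_convergence[where w = "\<lambda>_. (1 - q\<^sup>2) / (1 - q)\<^sup>2"])
      show "AE t in angle_measure. (\<lambda>k. poisson_angle q (t - \<theta>) *\<^sub>R x k t) \<longlonglongrightarrow> poisson_angle q (t - \<theta>) *\<^sub>R \<phi> t"
        using x\<phi> by eventually_elim (intro tendsto_intros)
      show "AE t in angle_measure. norm (poisson_angle q (t - \<theta>) *\<^sub>R x k t) \<le> (1 - q\<^sup>2) / (1 - q)\<^sup>2" for k
      proof (rule AE_I2)
        fix t
        have "\<bar>poisson_angle q (t - \<theta>)\<bar> * norm (x k t) \<le> (1 - q\<^sup>2) / (1 - q)\<^sup>2 * 1"
          using poisson_angle_bounded[OF q, of "t - \<theta>"] poisson_angle_nonneg[OF q, of "t - \<theta>"] x1[of k t] q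
          by (intro mult_mono) (auto simp: power_le_one)
        then show "norm (poisson_angle q (t - \<theta>) *\<^sub>R x k t) \<le> (1 - q\<^sup>2) / (1 - q)\<^sup>2" by simp
      qed
    qed auto
    have eq: "(\<integral>t. poisson_angle q (t - \<theta>) *\<^sub>R x k t \<partial>angle_measure)
        = (2 * pi) *\<^sub>R h (of_real (r k) * (of_real q * cis \<theta>))" for k
    proof -
      have sub: "of_real (r k) * z \<in> ball 0 1" if "z \<in> cball (0::complex) 1" for z
      proof -
        have "norm (of_real (r k) * z) \<le> r k * 1"
          using that r(1)[of k] unfolding norm_mult norm_of_real by (intro mult_mono) auto
        then show ?thesis using r(2)[of k] by simp
      qed
      have "continuous_on (cball 0 1) (\<lambda>z. h (of_real (r k) * z))"
        by (rule continuous_on_compose2[OF schur_continuous_on[OF h]])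
          (use sub in \<open>auto intro!: continuous_intros\<close>)
      moreover have "(h \<circ> (\<lambda>z. of_real (r k) * z)) holomorphic_on ball 0 1"
        by (rule holomorphic_on_compose_gen[where t = "ball 0 1"])
          (use h sub in \<open>auto intro!: holomorphic_intros simp: schur_def\<close>)
      ultimately show ?thesis
        using poisson_formula_angle[of "\<lambda>z. h (of_real (r k) * z)" q \<theta>] q by (simp add: x_def o_def)
    qed
    have "isCont h (of_real q * cis \<theta>)"
      using schur_continuous_on[OF h] q by (auto simp: continuous_on_eq_continuous_at norm_mult)
    moreover have "(\<lambda>k. of_real (r k) * (of_real q * cis \<theta>)) \<longlonglongrightarrow> of_real q * cis \<theta>"
      using tendsto_mult_right[OF tendsto_of_real[OF r(3)], of "of_real q * cis \<theta>"] by simp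
    ultimately have "(\<lambda>k. h (of_real (r k) * (of_real q * cis \<theta>))) \<longlonglongrightarrow> h (of_real q * cis \<theta>)"
      by (rule isCont_tendsto_compose)
    then show "(\<lambda>k. \<integral>t. poisson_angle q (t - \<theta>) *\<^sub>R x k t \<partial>angle_measure)
        \<longlonglongrightarrow> (2 * pi) *\<^sub>R h (of_real q * cis \<theta>)"
      unfolding eq by (intro tendsto_intros)
  qed
  have "AE \<theta> in angle_measure. ((\<lambda>q. h (of_real q * cis \<theta>)) \<longlongrightarrow> \<phi> \<theta>) (at_left 1)"
    using poisson_limit_AE[OF \<phi>m \<phi>1]
  proof eventually_elim
    case (elim \<theta>)
    have "((\<lambda>q. (1 / (2 * pi)) *\<^sub>R (\<integral>t. poisson_angle q (t - \<theta>) *\<^sub>R \<phi> t \<partial>angle_measure))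
        \<longlongrightarrow> (1 / (2 * pi)) *\<^sub>R ((2 * pi) *\<^sub>R \<phi> \<theta>)) (at_left 1)"
      by (intro tendsto_intros elim)
    moreover have "eventually (\<lambda>q. (1 / (2 * pi)) *\<^sub>R (\<integral>t. poisson_angle q (t - \<theta>) *\<^sub>R \<phi> t \<partial>angle_measure)
        = h (of_real q * cis \<theta>)) (at_left 1)"
      using eventually_at_left_real[of 0 1] by (rule eventually_mono) (auto simp: P)
    ultimately have "((\<lambda>q. h (of_real q * cis \<theta>)) \<longlongrightarrow> (1 / (2 * pi)) *\<^sub>R ((2 * pi) *\<^sub>R \<phi> \<theta>)) (at_left 1)"
      by (rule Lim_transform_eventually)
    then show ?case by simp
  qed
  then show ?thesis using that[OF \<phi>m \<phi>1 P] by blast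
qed

section \<open>Weak convergence of boundary values\<close>

lemma measurable_fst_angle [measurable]: "fst \<in> measurable (angle_measure \<Otimes>\<^sub>M N) borel"
  by (rule measurable_compose[OF measurable_fst]) (rule measurable_angle_measure, simp)

lemma measurable_snd_angle [measurable]: "snd \<in> measurable (N \<Otimes>\<^sub>M angle_measure) borel"
  by (rule measurable_compose[OF measurable_snd]) (rule measurable_angle_measure, simp)

text \<open>A relation, since boundary values are fixed only up to null sets. The bound is demanded
  at every point for the sake of integrability; the Poisson representation is what links integrals
  of \<phi> to values of \<open>h\<close> in the disc.\<close>

definition boundary_function :: "(complex \<Rightarrow> complex) \<Rightarrow> (real \<Rightarrow> complex) \<Rightarrow> bool" where
  "boundary_function h \<phi> \<longleftrightarrow> \<phi> \<in> borel_measurable borel \<and> (\<forall>t. norm (\<phi> t) \<le> 1) \<and>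
    (\<forall>r \<theta>. 0 \<le> r \<longrightarrow> r < 1 \<longrightarrow>
      (\<integral>t. poisson_angle r (t - \<theta>) *\<^sub>R \<phi> t \<partial>angle_measure) = (2 * pi) *\<^sub>R h (of_real r * cis \<theta>)) \<and>
    (AE t in angle_measure. ((\<lambda>r. h (of_real r * cis t)) \<longlongrightarrow> \<phi> t) (at_left 1))"

lemma boundary_function_exists: "schur h \<Longrightarrow> \<exists>\<phi>. boundary_function h \<phi>"
  unfolding boundary_function_def by (rule schur_boundary_function) blast+

text \<open>By Fubini and the symmetry of the kernel, smoothing \<psi> has the same effect on the
  pairing as smoothing \<phi>, and the Poisson integral of \<phi> is \<open>h\<close> on the circle
  of radius \<open>q\<close>.\<close>

lemma poisson_pairing:
  assumes h: "boundary_function h \<phi>" and [measurable]: "\<psi> \<in> borel_measurable borel"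
    and \<psi>: "\<And>t. \<bar>\<psi> t :: real\<bar> \<le> 1" and q: "0 \<le> q" "q < 1"
  shows "(\<integral>t. (\<integral>s. poisson_angle q (s - t) * \<psi> s \<partial>angle_measure) *\<^sub>R \<phi> t \<partial>angle_measure)
    = (2 * pi) *\<^sub>R (\<integral>s. \<psi> s *\<^sub>R h (of_real q * cis s) \<partial>angle_measure)"
proof -
  have [measurable]: "\<phi> \<in> borel_measurable borel" and \<phi>: "\<And>t. norm (\<phi> t) \<le> 1"
    and P: "\<And>\<theta>. (\<integral>t. poisson_angle q (t - \<theta>) *\<^sub>R \<phi> t \<partial>angle_measure) = (2 * pi) *\<^sub>R h (of_real q * cis \<theta>)"
    using h q by (auto simp: boundary_function_def)
  define K where "K = (1 - q\<^sup>2) / (1 - q)\<^sup>2"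
  have pK: "\<bar>poisson_angle q s\<bar> \<le> K" for s
    using poisson_angle_bounded[OF q, of s] poisson_angle_nonneg[OF q, of s] by (simp add: K_def)
  define F where "F = (\<lambda>t s. poisson_angle q (s - t) *\<^sub>R \<psi> s *\<^sub>R \<phi> t)"
  interpret pair_sigma_finite angle_measure angle_measure ..
  interpret pf: finite_measure "angle_measure \<Otimes>\<^sub>M angle_measure"
    by (intro finite_measure_pair_measure finite_measure_angle)
  have "integrable (angle_measure \<Otimes>\<^sub>M angle_measure) (\<lambda>(t, s). F t s)"
  proof (rule pf.integrable_const_bound[where B = "K * (1 * 1)"])
    have "norm (F t s) \<le> K * (1 * 1)" for t s
      unfolding F_def norm_scaleR using pK[of "s - t"] \<psi>[of s] \<phi>[of t]
      by (intro mult_mono) auto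
    then show "AE x in angle_measure \<Otimes>\<^sub>M angle_measure. norm (case x of (t, s) \<Rightarrow> F t s) \<le> K * (1 * 1)"
      by (auto intro!: AE_I2)
    show "(\<lambda>(t, s). F t s) \<in> borel_measurable (angle_measure \<Otimes>\<^sub>M angle_measure)"
      unfolding F_def by measurable
  qed
  from Fubini_integral[OF this]
  have "(\<integral>s. (\<integral>t. F t s \<partial>angle_measure) \<partial>angle_measure) = (\<integral>t. (\<integral>s. F t s \<partial>angle_measure) \<partial>angle_measure)" .
  moreover have "(\<integral>s. F t s \<partial>angle_measure) = (\<integral>s. poisson_angle q (s - t) * \<psi> s \<partial>angle_measure) *\<^sub>R \<phi> t" for t
  proof -
    have "integrable angle_measure (\<lambda>s. poisson_angle q (s - t) * \<psi> s)"
    proof (rule integrable_angle_bounded[where M = "K * 1"])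
      show "norm (poisson_angle q (s - t) * \<psi> s) \<le> K * 1" for s
        unfolding real_norm_def abs_mult using pK[of "s - t"] \<psi>[of s] by (intro mult_mono) auto
    qed measurable
    from integral_scaleR_left[OF this, of "\<phi> t"] show ?thesis by (simp add: F_def)
  qed
  moreover have "(\<integral>t. F t s \<partial>angle_measure) = (2 * pi) *\<^sub>R \<psi> s *\<^sub>R h (of_real q * cis s)" for s
  proof -
    have "(\<integral>t. F t s \<partial>angle_measure) = (\<integral>t. \<psi> s *\<^sub>R (poisson_angle q (t - s) *\<^sub>R \<phi> t) \<partial>angle_measure)"
    proof (rule Bochner_Integration.integral_cong[OF refl])
      fix t
      show "F t s = \<psi> s *\<^sub>R (poisson_angle q (t - s) *\<^sub>R \<phi> t)"
        using poisson_angle_minus[of q "t - s"] by (simp add: F_def mult.commute)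
    qed
    also have "\<dots> = \<psi> s *\<^sub>R (2 * pi) *\<^sub>R h (of_real q * cis s)"
      by (simp only: integral_scaleR_right P)
    finally show ?thesis by (simp only: scaleR_left_commute)
  qed
  ultimately show ?thesis by (simp only: integral_scaleR_right)
qed

lemma radii_to_1:
  obtains q :: "nat \<Rightarrow> real" where "\<And>n. 0 \<le> q n" "\<And>n. q n < 1" "filterlim q (at_left 1) sequentially"
proof -
  define q where "q = (\<lambda>n. 1 - inverse (real (Suc n)))"
  have q: "0 \<le> q n" "q n < 1" for n by (auto simp: q_def inverse_le_1_iff)
  have q1: "filterlim q (at_left 1) sequentially"
    unfolding filterlim_at
  proof
    show "q \<longlonglongrightarrow> 1"
      using tendsto_diff[OF tendsto_const[of 1] LIMSEQ_inverse_real_of_nat] by (simp add: q_def)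
    show "\<forall>\<^sub>F n in sequentially. q n \<in> {..<1} \<and> q n \<noteq> 1"
      using q by (auto intro!: always_eventually simp: less_imp_neq)
  qed
  with q show ?thesis using that by blast
qed

text \<open>Replacing the indicator of \<open>S\<close> by its Poisson integral costs an \<open>L\<^sup>1\<close> error that does not
  depend on the function, and moves the pairing to a circle inside the disc.\<close>

lemma boundary_function_weak_limit:
  assumes h: "\<And>j. schur (h j)" "\<And>j. boundary_function (h j) (\<phi> j)"
    and g: "schur g" "boundary_function g \<gamma>"
    and lim: "\<And>z. z \<in> ball 0 1 \<Longrightarrow> (\<lambda>j. h j z) \<longlonglongrightarrow> g z"
    and [measurable]: "S \<in> sets borel"
  shows "(\<lambda>j. \<integral>t. indicator S t *\<^sub>R \<phi> j t \<partial>angle_measure) \<longlonglongrightarrow> (\<integral>t. indicator S t *\<^sub>R \<gamma> t \<partial>angle_measure)"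
proof -
  obtain q :: "nat \<Rightarrow> real" where q: "\<And>n. 0 \<le> q n" "\<And>n. q n < 1"
    and q1: "filterlim q (at_left 1) sequentially"
    using radii_to_1 by blast
  let ?\<psi> = "indicator S :: real \<Rightarrow> real"
  define P where "P = (\<lambda>n t. \<integral>s. poisson_angle (q n) (s - t) * ?\<psi> s \<partial>angle_measure)"
  have P_le: "\<bar>P n t\<bar> \<le> 2 * pi" for n t
  proof -
    have i: "integrable angle_measure (\<lambda>s. poisson_angle (q n) (s - t))"
      using poisson_angle_bounded[OF q] poisson_angle_nonneg[OF q]
      by (intro integrable_angle_bounded[where M = "(1 - (q n)\<^sup>2) / (1 - q n)\<^sup>2"]) auto
    have "0 \<le> P n t" unfolding P_def
      by (rule Bochner_Integration.integral_nonneg) (simp add: poisson_angle_nonneg[OF q])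
    moreover have "P n t \<le> (\<integral>s. poisson_angle (q n) (s - t) \<partial>angle_measure)"
      unfolding P_def by (rule integral_mono'[OF i]) (auto simp: indicator_def poisson_angle_nonneg[OF q])
    moreover have "(\<integral>s. poisson_angle (q n) (s - t) \<partial>angle_measure) = 2 * pi"
      using poisson_angle_integral[OF q] unfolding integral_angle_eq .
    ultimately show ?thesis by simp
  qed
  have bdd: "\<bar>2 * pi * ?\<psi> t - P n t\<bar> \<le> 4 * pi" for n t
    using P_le[of n t] pi_gt_zero by (cases "t \<in> S") (simp_all add: abs_le_iff)
  have Pm [measurable]: "P n \<in> borel_measurable angle_measure" for n
    unfolding P_def by (rule angle.borel_measurable_lebesgue_integral) measurable
  have Plim: "AE t in angle_measure. (\<lambda>n. P n t) \<longlonglongrightarrow> 2 * pi * ?\<psi> t"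
  proof -
    have "AE \<theta> in angle_measure. ((\<lambda>r. \<integral>t. poisson_angle r (t - \<theta>) *\<^sub>R ?\<psi> t \<partial>angle_measure)
        \<longlongrightarrow> (2 * pi) *\<^sub>R ?\<psi> \<theta>) (at_left 1)"
      by (rule poisson_limit_AE[where M = 1]) (auto simp: indicator_def)
    then show ?thesis
    proof eventually_elim
      case (elim t)
      from filterlim_compose[OF elim q1] show ?case by (simp add: P_def)
    qed
  qed
  define c where "c = (\<lambda>n. \<integral>t. \<bar>2 * pi * ?\<psi> t - P n t\<bar> \<partial>angle_measure)"
  have c: "c \<longlonglongrightarrow> 0"
  proof -
    have "c \<longlonglongrightarrow> (\<integral>t. 0 \<partial>angle_measure)"
      unfolding c_def
    proof (rule integral_dominated_convergence[where w = "\<lambda>_. 4 * pi"])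
      show "AE t in angle_measure. (\<lambda>n. \<bar>2 * pi * ?\<psi> t - P n t\<bar>) \<longlonglongrightarrow> 0"
        using Plim
      proof eventually_elim
        case (elim t)
        from tendsto_rabs[OF tendsto_diff[OF tendsto_const[of "2 * pi * ?\<psi> t"] elim]]
        show ?case by simp
      qed
      show "AE t in angle_measure. norm \<bar>2 * pi * ?\<psi> t - P n t\<bar> \<le> 4 * pi" for n
        using bdd by (intro AE_I2) simp
    qed auto
    then show ?thesis by simp
  qed
  have est: "norm ((2 * pi) *\<^sub>R (\<integral>s. ?\<psi> s *\<^sub>R k (of_real (q n) * cis s) \<partial>angle_measure)
      - (2 * pi) *\<^sub>R (\<integral>t. ?\<psi> t *\<^sub>R \<kappa> t \<partial>angle_measure)) \<le> c n"
    if k: "boundary_function k \<kappa>" for k \<kappa> n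
  proof -
    have [measurable]: "\<kappa> \<in> borel_measurable borel" and \<kappa>: "\<And>t. norm (\<kappa> t) \<le> 1"
      using k by (auto simp: boundary_function_def)
    have i1: "integrable angle_measure (\<lambda>t. P n t *\<^sub>R \<kappa> t)"
    proof (rule angle.integrable_const_bound[where B = "2 * pi * 1"])
      show "AE t in angle_measure. norm (P n t *\<^sub>R \<kappa> t) \<le> 2 * pi * 1"
        unfolding norm_scaleR using P_le \<kappa> by (intro AE_I2 mult_mono) auto
    qed measurable
    have i2: "integrable angle_measure (\<lambda>t. (2 * pi * ?\<psi> t) *\<^sub>R \<kappa> t)"
    proof (rule integrable_angle_bounded[where M = "2 * pi * 1"])
      show "norm ((2 * pi * ?\<psi> t) *\<^sub>R \<kappa> t) \<le> 2 * pi * 1" for t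
        unfolding norm_scaleR using \<kappa> by (intro mult_mono) (auto simp: indicator_def)
    qed measurable
    have i3: "integrable angle_measure (\<lambda>t. \<bar>2 * pi * ?\<psi> t - P n t\<bar>)"
    proof (rule angle.integrable_const_bound[where B = "4 * pi"])
      show "AE t in angle_measure. norm \<bar>2 * pi * ?\<psi> t - P n t\<bar> \<le> 4 * pi"
        using bdd by (intro AE_I2) simp
    qed measurable
    have "(2 * pi) *\<^sub>R (\<integral>s. ?\<psi> s *\<^sub>R k (of_real (q n) * cis s) \<partial>angle_measure)
        = (\<integral>t. P n t *\<^sub>R \<kappa> t \<partial>angle_measure)"
      unfolding P_def by (rule poisson_pairing[OF k _ _ q, symmetric]) (auto simp: indicator_def)
    moreover have "(2 * pi) *\<^sub>R (\<integral>t. ?\<psi> t *\<^sub>R \<kappa> t \<partial>angle_measure)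
        = (\<integral>t. (2 * pi * ?\<psi> t) *\<^sub>R \<kappa> t \<partial>angle_measure)"
      by (simp only: scaleR_scaleR[symmetric] integral_scaleR_right)
    ultimately have "norm ((2 * pi) *\<^sub>R (\<integral>s. ?\<psi> s *\<^sub>R k (of_real (q n) * cis s) \<partial>angle_measure)
        - (2 * pi) *\<^sub>R (\<integral>t. ?\<psi> t *\<^sub>R \<kappa> t \<partial>angle_measure))
      = norm (\<integral>t. P n t *\<^sub>R \<kappa> t - (2 * pi * ?\<psi> t) *\<^sub>R \<kappa> t \<partial>angle_measure)"
      by (simp only: Bochner_Integration.integral_diff[OF i1 i2])
    also have "\<dots> \<le> c n"
      unfolding c_def
    proof (rule order_trans[OF integral_norm_bound integral_mono'[OF i3]])
      fix t
      have "norm (P n t *\<^sub>R \<kappa> t - (2 * pi * ?\<psi> t) *\<^sub>R \<kappa> t) = \<bar>2 * pi * ?\<psi> t - P n t\<bar> * norm (\<kappa> t)"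
        by (metis norm_minus_commute norm_scaleR real_norm_def scaleR_diff_left)
      also have "\<dots> \<le> \<bar>2 * pi * ?\<psi> t - P n t\<bar> * 1" using \<kappa> by (intro mult_left_mono) auto
      finally show "norm (P n t *\<^sub>R \<kappa> t - (2 * pi * ?\<psi> t) *\<^sub>R \<kappa> t) \<le> \<bar>2 * pi * ?\<psi> t - P n t\<bar>" by simp
    qed simp
    finally show ?thesis .
  qed
  have "(\<lambda>j. (2 * pi) *\<^sub>R (\<integral>t. ?\<psi> t *\<^sub>R \<phi> j t \<partial>angle_measure)) \<longlonglongrightarrow> (2 * pi) *\<^sub>R (\<integral>t. ?\<psi> t *\<^sub>R \<gamma> t \<partial>angle_measure)"
  \<comment> \<open>The approximations live on the fixed circle of radius \<open>q n\<close>, where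
    pointwise convergence in the disc and the bound 1 allow dominated convergence in
    \<open>j\<close>.\<close>
  proof (rule tendsto_approx_family[where N = "\<lambda>_. 0" and c = c])
    show "norm ((2 * pi) *\<^sub>R (\<integral>s. ?\<psi> s *\<^sub>R h j (of_real (q n) * cis s) \<partial>angle_measure)
      - (2 * pi) *\<^sub>R (\<integral>t. ?\<psi> t *\<^sub>R \<phi> j t \<partial>angle_measure)) \<le> c n" for n j
      by (rule est[OF h(2)])
    show "norm ((2 * pi) *\<^sub>R (\<integral>s. ?\<psi> s *\<^sub>R g (of_real (q n) * cis s) \<partial>angle_measure)
      - (2 * pi) *\<^sub>R (\<integral>t. ?\<psi> t *\<^sub>R \<gamma> t \<partial>angle_measure)) \<le> c n" for n
      by (rule est[OF g(2)])
    show "(\<lambda>j. (2 * pi) *\<^sub>R (\<integral>s. ?\<psi> s *\<^sub>R h j (of_real (q n) * cis s) \<partial>angle_measure))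
      \<longlonglongrightarrow> (2 * pi) *\<^sub>R (\<integral>s. ?\<psi> s *\<^sub>R g (of_real (q n) * cis s) \<partial>angle_measure)" for n
    proof (intro tendsto_scaleR tendsto_const integral_dominated_convergence[where w = "\<lambda>_. 1"])
      have qn: "norm (of_real (q n) * cis s) < 1" "\<bar>q n\<bar> < 1" for s
        using q[of n] by (auto simp: norm_mult)
      have [measurable]: "(\<lambda>s. h j (of_real (q n) * cis s)) \<in> borel_measurable borel"
        "(\<lambda>s. g (of_real (q n) * cis s)) \<in> borel_measurable borel" for j
        by (intro schur_circle_measurable h g qn)+
      show "(\<lambda>s. ?\<psi> s *\<^sub>R g (of_real (q n) * cis s)) \<in> borel_measurable angle_measure"
        "(\<lambda>s. ?\<psi> s *\<^sub>R h j (of_real (q n) * cis s)) \<in> borel_measurable angle_measure" for j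
        by measurable
      show "AE s in angle_measure. (\<lambda>j. ?\<psi> s *\<^sub>R h j (of_real (q n) * cis s)) \<longlonglongrightarrow> ?\<psi> s *\<^sub>R g (of_real (q n) * cis s)"
        using qn by (intro AE_I2 tendsto_scaleR tendsto_const lim) simp
      show "AE s in angle_measure. norm (?\<psi> s *\<^sub>R h j (of_real (q n) * cis s)) \<le> 1" for j
        using schur_norm_le[OF h(1) qn(1)] by (intro AE_I2) (auto simp: indicator_def)
    qed simp
  qed (rule c)
  from tendsto_scaleR[OF tendsto_const[of "1 / (2 * pi)"] this] show ?thesis by simp
qed

section \<open>The boundary value 1 of a Schur function vanishing at the origin\<close>

lemma schur_norm_less:
  assumes "schur g" "g 0 = 0" "norm w < 1"
  shows "norm (g w) < 1"
proof (rule ccontr)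
  assume "\<not> norm (g w) < 1"
  then have 1: "norm (g w) = 1" using schur_norm_le[OF assms(1,3)] by simp
  have "g constant_on ball 0 1"
    by (rule maximum_modulus_principle[of g "ball 0 1" "ball 0 1" w])
       (use assms 1 in \<open>auto simp: schur_def\<close>)
  then have "g w = g 0" using assms(3) by (auto simp: constant_on_def)
  with 1 assms(2) show False by simp
qed

text \<open>The mean value property for the real part of \<open>Ln (1 - g)\<close>. The principal
  branch is holomorphic here because \<open>norm (g w) < 1\<close> puts \<open>1 - g\<close> in the
  right half-plane, and its value at the origin is \<open>Ln 1 = 0\<close>.\<close>

lemma integral_ln_one_minus_schur:
  assumes g: "schur g" "g 0 = 0" and r: "0 \<le> r" "r < 1"
  shows "(\<integral>t. ln (norm (1 - g (of_real r * cis t))) \<partial>angle_measure) = 0"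
    "integrable angle_measure (\<lambda>t. ln (norm (1 - g (of_real r * cis t))))"
proof -
  have sub: "of_real r * z \<in> ball 0 1" if "z \<in> cball (0::complex) 1" for z
  proof -
    have "norm (of_real r * z) \<le> r * 1"
      using that r unfolding norm_mult norm_of_real by (intro mult_mono) auto
    then show ?thesis using r by simp
  qed
  have pos: "Re (1 - g (of_real r * z)) > 0" if "z \<in> cball 0 1" for z
    using schur_norm_less[OF g, of "of_real r * z"] sub[OF that] complex_Re_le_cmod[of "g (of_real r * z)"]
    by simp
  then have nn: "1 - g (of_real r * z) \<notin> \<real>\<^sub>\<le>\<^sub>0" if "z \<in> cball 0 1" for z
    using pos[OF that] by (auto simp: complex_nonpos_Reals_iff)
  define H where "H = (\<lambda>z. Ln (1 - g (of_real r * z)))"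
  have c: "continuous_on (cball 0 1) (\<lambda>z. g (of_real r * z))"
    by (rule continuous_on_compose2[OF schur_continuous_on[OF g(1)]])
      (use sub in \<open>auto intro!: continuous_intros\<close>)
  have "(g \<circ> (\<lambda>z. of_real r * z)) holomorphic_on ball 0 1"
    by (rule holomorphic_on_compose_gen[where t = "ball 0 1"])
      (use g sub in \<open>auto intro!: holomorphic_intros simp: schur_def\<close>)
  then have h: "(\<lambda>z. g (of_real r * z)) holomorphic_on ball 0 1" by (simp add: o_def)
  have H: "continuous_on (cball 0 1) H" "H holomorphic_on ball 0 1"
    unfolding H_def using c h nn by (auto intro!: continuous_intros holomorphic_intros)
  have "(\<integral>t. H (cis t) \<partial>angle_measure) = (2 * pi) *\<^sub>R H 0"
    using poisson_formula_angle[OF H, of 0 0] by (simp add: poisson_angle_def)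
  then have 0: "(\<integral>t. H (cis t) \<partial>angle_measure) = 0" using g by (simp add: H_def)
  have cont: "continuous_on UNIV (\<lambda>t. H (cis t))" by (rule cis_continuous_on_compose[OF H(1)])
  have "bounded (H ` cball 0 1)"
    by (intro compact_imp_bounded compact_continuous_image H(1)) simp
  then obtain B where "\<forall>x \<in> H ` cball 0 1. norm x \<le> B" unfolding bounded_iff by blast
  then have int: "integrable angle_measure (\<lambda>t. H (cis t))"
    by (intro integrable_angle_bounded[where M = B] borel_measurable_continuous_onI cont) simp
  have Re: "Re (H (cis t)) = ln (norm (1 - g (of_real r * cis t)))" for t
    using pos[of "cis t"] unfolding H_def by (subst Re_Ln) auto
  show "(\<integral>t. ln (norm (1 - g (of_real r * cis t))) \<partial>angle_measure) = 0"
    using integral_Re[OF int] 0 unfolding Re by simp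
  show "integrable angle_measure (\<lambda>t. ln (norm (1 - g (of_real r * cis t))))"
    using integrable_Re[OF int] unfolding Re .
qed

text \<open>The mean of \<open>ln \<bar>1 - g\<bar>\<close> over every circle is \<open>0\<close>, while boundary values \<open>1\<close> on a set of
  positive measure would push it to \<open>- \<infinity>\<close>.\<close>

lemma schur_boundary_ne_1:
  assumes g: "schur g" "g 0 = 0" "boundary_function g \<phi>"
  shows "AE t in angle_measure. \<phi> t \<noteq> 1"
proof -
  have [measurable]: "\<phi> \<in> borel_measurable borel" and \<phi>: "\<And>t. norm (\<phi> t) \<le> 1"
    and lim: "AE t in angle_measure. ((\<lambda>r. g (of_real r * cis t)) \<longlongrightarrow> \<phi> t) (at_left 1)"
    using g(3) by (auto simp: boundary_function_def)
  obtain q :: "nat \<Rightarrow> real" where q: "\<And>n. 0 \<le> q n" "\<And>n. q n < 1"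
    and q1: "filterlim q (at_left 1) sequentially"
    using radii_to_1 by blast
  define Z where "Z = {t \<in> {0..2 * pi}. \<phi> t = 1}"
  have Zm: "Z \<in> sets angle_measure"
    unfolding Z_def by (subst space_angle_measure[symmetric]) measurable
  have iZ: "integrable angle_measure (indicator Z :: real \<Rightarrow> real)"
    by (rule integrable_real_indicator[OF Zm]) (simp add: angle.emeasure_eq_measure)
  have ZI: "Z \<inter> {0..2 * pi} = Z" by (auto simp: Z_def)
  have le2: "norm (1 - w) \<le> 2" if "norm w \<le> 1" for w :: complex
    using norm_triangle_ineq4[of 1 w] that by simp
  have bound: "real N * measure angle_measure Z \<le> 2 * pi * ln 2" for N
  proof -
    \<comment> \<open>Chosen to make \<open>ln \<epsilon> = ln 2 - real N\<close>: the truncated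
      logarithm is at most \<open>ln 2\<close> everywhere and lower by exactly \<open>N\<close> on
      \<open>Z\<close>.\<close>
    define \<epsilon> where "\<epsilon> = 2 * exp (- real N)"
    have \<epsilon>: "0 < \<epsilon>" "\<epsilon> \<le> 2" "ln \<epsilon> = ln 2 - real N" by (auto simp: \<epsilon>_def ln_mult)
    \<comment> \<open>Truncation makes the logarithm bounded and continuous, so its integrals
      converge to that of the boundary values, and it only increases the logarithm, so the means
      stay nonnegative.\<close>
    define L where "L = (\<lambda>x. ln (max \<epsilon> x))"
    have Lb: "norm (L (norm (1 - w))) \<le> \<bar>ln \<epsilon>\<bar> + ln 2" if "norm w \<le> 1" for w :: complex
    proof -
      have "ln \<epsilon> \<le> L (norm (1 - w))" "L (norm (1 - w)) \<le> ln 2"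
        unfolding L_def using \<epsilon>(1,2) le2[OF that] by (auto intro!: ln_mono)
      moreover have "ln 2 > (0::real)" by simp
      ultimately show ?thesis unfolding real_norm_def by linarith
    qed
    have Lc: "continuous_on UNIV L"
      unfolding L_def using \<epsilon>(1) by (intro continuous_intros) (auto simp: max_def)
    then have [measurable]: "L \<in> borel_measurable borel" by (rule borel_measurable_continuous_onI)
    have gm [measurable]: "(\<lambda>t. g (of_real (q n) * cis t)) \<in> borel_measurable borel" for n
      using q[of n] by (intro schur_circle_measurable g) auto
    have g1: "norm (g (of_real (q n) * cis t)) \<le> 1" for n t
      using q[of n] by (intro schur_norm_le[OF g(1)]) (simp add: norm_mult)
    have Li: "integrable angle_measure (\<lambda>t. L (norm (1 - \<phi> t)))"
      by (rule integrable_angle_bounded[where M = "\<bar>ln \<epsilon>\<bar> + ln 2"]) (measurable, rule Lb[OF \<phi>])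
    have "(\<lambda>n. \<integral>t. L (norm (1 - g (of_real (q n) * cis t))) \<partial>angle_measure)
        \<longlonglongrightarrow> (\<integral>t. L (norm (1 - \<phi> t)) \<partial>angle_measure)"
    proof (rule integral_dominated_convergence[where w = "\<lambda>_. \<bar>ln \<epsilon>\<bar> + ln 2"])
      show "AE t in angle_measure. (\<lambda>n. L (norm (1 - g (of_real (q n) * cis t)))) \<longlonglongrightarrow> L (norm (1 - \<phi> t))"
        using lim
      proof eventually_elim
        case (elim t)
        have "isCont L (norm (1 - \<phi> t))"
          using Lc by (simp add: continuous_on_eq_continuous_at)
        moreover have "(\<lambda>n. norm (1 - g (of_real (q n) * cis t))) \<longlonglongrightarrow> norm (1 - \<phi> t)"
          using filterlim_compose[OF elim q1] by (intro tendsto_intros)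
        ultimately show ?case by (rule isCont_tendsto_compose)
      qed
      show "AE t in angle_measure. norm (L (norm (1 - g (of_real (q n) * cis t)))) \<le> \<bar>ln \<epsilon>\<bar> + ln 2" for n
        by (intro AE_I2 Lb g1)
    qed auto
    moreover have "0 \<le> (\<integral>t. L (norm (1 - g (of_real (q n) * cis t))) \<partial>angle_measure)" for n
    proof -
      have "(\<integral>t. ln (norm (1 - g (of_real (q n) * cis t))) \<partial>angle_measure)
          \<le> (\<integral>t. L (norm (1 - g (of_real (q n) * cis t))) \<partial>angle_measure)"
      proof (rule integral_mono)
        show "integrable angle_measure (\<lambda>t. L (norm (1 - g (of_real (q n) * cis t))))"
          by (rule integrable_angle_bounded[where M = "\<bar>ln \<epsilon>\<bar> + ln 2"]) (measurable, rule Lb[OF g1])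
        fix t
        have "norm (g (of_real (q n) * cis t)) < 1"
          using q[of n] by (intro schur_norm_less[OF g(1,2)]) (simp add: norm_mult)
        then have "g (of_real (q n) * cis t) \<noteq> 1" by (metis less_irrefl norm_one)
        then show "ln (norm (1 - g (of_real (q n) * cis t))) \<le> L (norm (1 - g (of_real (q n) * cis t)))"
          unfolding L_def by (intro ln_mono) simp_all
      qed (rule integral_ln_one_minus_schur[OF g(1,2) q])
      then show ?thesis using integral_ln_one_minus_schur(1)[OF g(1,2) q] by simp
    qed
    ultimately have "0 \<le> (\<integral>t. L (norm (1 - \<phi> t)) \<partial>angle_measure)"
      by (intro tendsto_lowerbound) auto
    also have "\<dots> \<le> (\<integral>t. ln 2 - real N * indicator Z t \<partial>angle_measure)"
    proof (rule integral_mono[OF Li])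
      show "integrable angle_measure (\<lambda>t. ln 2 - real N * indicator Z t)"
        by (intro Bochner_Integration.integrable_diff integrable_mult_right iZ) simp
      fix t assume t: "t \<in> space angle_measure"
      show "L (norm (1 - \<phi> t)) \<le> ln 2 - real N * indicator Z t"
      proof (cases "t \<in> Z")
        case True
        then show ?thesis using \<epsilon> by (simp add: Z_def L_def)
      next
        case False
        then show ?thesis using \<epsilon> le2[OF \<phi>, of t] by (simp add: L_def)
      qed
    qed
    also have "\<dots> = 2 * pi * ln 2 - real N * measure angle_measure Z"
      using Bochner_Integration.integral_diff[OF angle.integrable_const[of "ln 2"] integrable_mult_right[OF iZ, of "real N"]]
      by (simp add: measure_angle_UNIV ZI)
    finally show ?thesis by simp
  qed
  have "measure angle_measure Z = 0"
  proof (rule ccontr)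
    assume "measure angle_measure Z \<noteq> 0"
    then have "0 < measure angle_measure Z" by (simp add: zero_less_measure_iff)
    then obtain N :: nat where "2 * pi * ln 2 < real N * measure angle_measure Z"
      using reals_Archimedean3 by blast
    with bound[of N] show False by simp
  qed
  then have "Z \<in> null_sets angle_measure"
    using Zm by (simp add: null_sets_def angle.emeasure_eq_measure)
  then show ?thesis
    by (rule AE_I') (auto simp: Z_def)
qed

section \<open>Null sets on the circle and in the angle\<close>

lemma measurable_cis_restrict: "cis \<in> restrict_space lborel {0..<2 * pi} \<rightarrow>\<^sub>M borel"
  by (intro measurable_restrict_space1) simp

lemma circle_AE_sphere: "AE z in circle_lebesgue. z \<in> sphere 0 1"
  unfolding circle_lebesgue_def by (subst AE_distr_iff[OF measurable_cis_restrict]) auto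

lemma borel_measurable_Arg2pi [measurable]: "Arg2pi \<in> borel_measurable borel"
proof -
  have "(\<lambda>z. indicator (- \<real>\<^sub>\<ge>\<^sub>0) z *\<^sub>R Arg2pi z) \<in> borel_measurable borel"
    by (intro borel_measurable_continuous_on_indicator continuous_at_imp_continuous_on ballI continuous_at_Arg2pi)
      (auto simp: closed_nonneg_Reals_complex borel_comp borel_closed)
  also have "(\<lambda>z. indicator (- \<real>\<^sub>\<ge>\<^sub>0) z *\<^sub>R Arg2pi z) = Arg2pi"
    by (auto simp: fun_eq_iff indicator_def Arg2pi_eq_0 complex_nonneg_Reals_iff complex_is_Real_iff)
  finally show ?thesis .
qed

text \<open>\<open>P\<close> may be nonmeasurable, so it is replaced by a Borel null set
  \<open>N\<close> of angles containing all exceptions; the preimage of \<open>N\<close> under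
  \<open>Arg2pi\<close> is then a Borel null set for the circle measure.\<close>

lemma AE_circleI:
  assumes "AE t in angle_measure. P (cis t)"
  shows "AE z in circle_lebesgue. P z"
proof -
  from assms obtain N where N: "N \<in> null_sets lborel" "\<And>t. t \<in> {0..2 * pi} \<Longrightarrow> \<not> P (cis t) \<Longrightarrow> t \<in> N"
    unfolding AE_angle_iff by (rule AE_E3) auto
  have [measurable]: "N \<in> sets borel" using N(1) by auto
  have "AE z in circle_lebesgue. Arg2pi z \<notin> N"
    unfolding circle_lebesgue_def
  proof (subst AE_distr_iff[OF measurable_cis_restrict])
    show "{x \<in> space borel. Arg2pi x \<notin> N} \<in> sets borel" by measurable
    have "AE t in lborel. t \<notin> N" by (rule AE_not_in[OF N(1)])
    then have "AE t in lborel. t \<in> {0..<2 * pi} \<longrightarrow> Arg2pi (cis t) \<notin> N"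
      by eventually_elim (auto simp: cis_conv_exp Arg2pi_exp)
    then show "AE t in restrict_space lborel {0..<2 * pi}. Arg2pi (cis t) \<notin> N"
      by (subst AE_restrict_space_iff) auto
  qed
  with circle_AE_sphere show ?thesis
  proof eventually_elim
    case (elim z)
    have "z = cis (Arg2pi z)" using Arg2pi_eq[of z] elim by (simp add: cis_conv_exp)
    moreover have "Arg2pi z \<in> {0..2 * pi}" using Arg2pi[of z] by auto
    ultimately show ?case using N(2)[of "Arg2pi z"] elim by metis
  qed
qed

lemma AE_circleD:
  assumes "AE z in circle_lebesgue. P z"
  shows "AE t in angle_measure. P (cis t)"
proof -
  from AE_distrD[OF measurable_cis_restrict assms[unfolded circle_lebesgue_def]]
  have "AE t in lborel. t \<in> {0..<2 * pi} \<longrightarrow> P (cis t)"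
    by (subst (asm) AE_restrict_space_iff) auto
  then have "AE t in angle_measure. t \<in> {0..<2 * pi} \<longrightarrow> P (cis t)"
    unfolding AE_angle_iff by eventually_elim auto
  with AE_angle_interior show ?thesis by eventually_elim auto
qed

section \<open>The spectral measure of a half-line CMV matrix\<close>

lemma cmv_rho_square: "norm a \<le> 1 \<Longrightarrow> cmv_rho a * cmv_rho a = 1 - cnj a * a"
proof -
  assume "norm a \<le> 1"
  then have "cmv_rho a * cmv_rho a = of_real (1 - (norm a)\<^sup>2)"
    unfolding cmv_rho_def of_real_mult[symmetric] by (simp add: power_le_one)
  then show ?thesis unfolding of_real_diff complex_norm_square by (simp add: mult.commute)
qed

lemma norm_cmv_rho_le: "norm (cmv_rho a) \<le> 1" if "norm a \<le> 1"
  using that by (simp add: cmv_rho_def power_le_one)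

lemma norm_Theta_le:
  assumes "norm a \<le> 1" "norm x \<le> B" "norm y \<le> B"
  shows "norm (Theta_fst a x y) \<le> 2 * B" "norm (Theta_snd a x y) \<le> 2 * B"
proof -
  have B: "0 \<le> B" using assms(2) norm_ge_zero order_trans by blast
  have "norm (cnj a * x) \<le> 1 * B" "norm (cmv_rho a * y) \<le> 1 * B"
    "norm (cmv_rho a * x) \<le> 1 * B" "norm (a * y) \<le> 1 * B"
    unfolding norm_mult using assms norm_cmv_rho_le[OF assms(1)] B by (intro mult_mono; simp)+
  then show "norm (Theta_fst a x y) \<le> 2 * B" "norm (Theta_snd a x y) \<le> 2 * B"
    unfolding Theta_fst_def Theta_snd_def
    using norm_triangle_ineq[of "cnj a * x" "cmv_rho a * y"] norm_triangle_ineq4[of "cmv_rho a * x" "a * y"]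
    by linarith+
qed

lemma norm_half_L_le:
  assumes "\<And>n. norm (\<alpha> n) \<le> 1" "\<And>m. norm (u m) \<le> B"
  shows "norm (half_L \<alpha> u m) \<le> 2 * B"
  unfolding half_L_def by (auto intro!: norm_Theta_le assms)

lemma norm_half_M_le:
  assumes "\<And>n. norm (\<alpha> n) \<le> 1" "\<And>m. norm (u m) \<le> B"
  shows "norm (half_M \<alpha> u m) \<le> 2 * B"
proof -
  have "norm (u 0) \<le> 2 * B" using assms(2)[of 0] norm_ge_zero[of "u 0"] by linarith
  then show ?thesis unfolding half_M_def by (auto intro!: norm_Theta_le assms)
qed

text \<open>The matrices act on arbitrary sequences, so the estimate is in the supremum norm, with a
  factor 2 for each of the two block-diagonal factors. Its crudeness is harmless: it only serves
  small \<open>z\<close>.\<close>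

lemma norm_cmv_power_le:
  assumes "\<And>n. norm (\<alpha> n) \<le> 1"
  shows "norm ((half_line_cmv \<alpha> ^^ k) delta0 m) \<le> 4 ^ k"
proof (induction k arbitrary: m)
  case 0
  show ?case by (simp add: delta0_def)
next
  case (Suc k)
  have "norm (half_L \<alpha> (half_M \<alpha> ((half_line_cmv \<alpha> ^^ k) delta0)) m) \<le> 2 * (2 * 4 ^ k)"
    by (intro norm_half_L_le norm_half_M_le assms Suc)
  moreover have "(half_line_cmv \<alpha> ^^ Suc k) delta0 m = half_L \<alpha> (half_M \<alpha> ((half_line_cmv \<alpha> ^^ k) delta0)) m"
    unfolding half_line_cmv_def by simp
  ultimately show ?case by simp
qed

lemma sums_Theta:
  assumes "u sums x" "v sums y"
  shows "(\<lambda>k. Theta_fst a (u k) (v k)) sums Theta_fst a x y"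
    "(\<lambda>k. Theta_snd a (u k) (v k)) sums Theta_snd a x y"
  unfolding Theta_fst_def Theta_snd_def
  by (intro sums_add sums_diff sums_mult assms)+

lemma sums_half_L:
  assumes "\<And>m. (\<lambda>k. u k m) sums S m"
  shows "(\<lambda>k. half_L \<alpha> (u k) m) sums half_L \<alpha> S m"
  unfolding half_L_def using sums_Theta[OF assms assms] by simp

lemma sums_half_M:
  assumes "\<And>m. (\<lambda>k. u k m) sums S m"
  shows "(\<lambda>k. half_M \<alpha> (u k) m) sums half_M \<alpha> S m"
  unfolding half_M_def using sums_Theta[OF assms assms] assms by simp

lemma half_line_cmv_scale: "half_line_cmv \<alpha> (\<lambda>m. c * u m) m = c * half_line_cmv \<alpha> u m"
proof -
  have T: "Theta_fst a (c * x) (c * y) = c * Theta_fst a x y"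
    "Theta_snd a (c * x) (c * y) = c * Theta_snd a x y" for a x y
    by (simp_all add: Theta_fst_def Theta_snd_def algebra_simps)
  have "half_M \<alpha> (\<lambda>m. c * u m) = (\<lambda>m. c * half_M \<alpha> u m)"
    by (auto simp: half_M_def T fun_eq_iff)
  then show ?thesis by (simp add: half_line_cmv_def half_L_def T)
qed

text \<open>The Neumann series of \<open>1 - z C\<close> applied to \<open>delta0\<close>. With
  growth \<open>4 ^ k\<close> and |z| at most 1/16 its terms are at most \<open>(1 / 4) ^ k\<close>,
  with sum 4/3.\<close>

lemma cmv_resolvent:
  assumes \<alpha>: "\<And>n. norm (\<alpha> n) \<le> 1" and z: "norm z \<le> 1 / 16"
  obtains U where "\<And>m. (\<lambda>k. z ^ k * (half_line_cmv \<alpha> ^^ k) delta0 m) sums U m"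
    "\<And>m. norm (U m) \<le> 2" "\<And>m. U m = delta0 m + z * half_line_cmv \<alpha> U m"
proof -
  define u where "u = (\<lambda>k m. z ^ k * (half_line_cmv \<alpha> ^^ k) delta0 m)"
  have ub: "norm (u k m) \<le> (1 / 4) ^ k" for k m
  proof -
    have "norm (u k m) \<le> (1 / 16) ^ k * 4 ^ k"
      unfolding u_def norm_mult norm_power
      using z norm_cmv_power_le[of \<alpha> k m, OF \<alpha>] by (intro mult_mono power_mono) auto
    also have "\<dots> = (1 / 4) ^ k" by (simp flip: power_mult_distrib)
    finally show ?thesis .
  qed
  have g: "(\<lambda>k. (1 / 4 :: real) ^ k) sums (4 / 3)" using geometric_sums[of "1/4::real"] by simp
  have sn: "summable (\<lambda>k. norm (u k m))" for m
    by (rule summable_comparison_test'[OF sums_summable[OF g]]) (use ub in simp)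
  define U where "U = (\<lambda>m. \<Sum>k. u k m)"
  have US: "(\<lambda>k. u k m) sums U m" for m
    unfolding U_def using summable_norm_cancel[OF sn] by (rule summable_sums)
  have UB: "norm (U m) \<le> 2" for m
  proof -
    have "norm (U m) \<le> (\<Sum>k. norm (u k m))" unfolding U_def by (rule summable_norm[OF sn])
    also have "\<dots> \<le> 4 / 3" using sums_le[OF ub summable_sums[OF sn] g] .
    finally show ?thesis by simp
  qed
  have "U m = delta0 m + z * half_line_cmv \<alpha> U m" for m
  proof -
    have "(\<lambda>k. half_line_cmv \<alpha> (u k) m) sums half_line_cmv \<alpha> U m"
      unfolding half_line_cmv_def o_def by (intro sums_half_L sums_half_M US)
    then have "(\<lambda>k. z * half_line_cmv \<alpha> (u k) m) sums (z * half_line_cmv \<alpha> U m)"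
      by (rule sums_mult)
    moreover have "z * half_line_cmv \<alpha> (u k) m = u (Suc k) m" for k
      unfolding u_def half_line_cmv_scale by simp
    ultimately have "(\<lambda>k. u (Suc k) m) sums (z * half_line_cmv \<alpha> U m)" by simp
    then have "(\<lambda>k. u k m) sums (z * half_line_cmv \<alpha> U m + u 0 m)"
      by (rule sums_Suc)
    with US[of m] have "U m = z * half_line_cmv \<alpha> U m + u 0 m" by (rule sums_unique2)
    then show ?thesis by (simp add: u_def)
  qed
  with US UB show ?thesis using that unfolding u_def by blast
qed

text \<open>\<open>y - f x\<close> and \<open>d'\<close> measure by how much consecutive components of a solution of \<open>U = \<delta>\<^sub>0 + z C U\<close>
  fail to have the ratio prescribed by the Schur functions. For small \<open>z\<close> this defect at least halves
  with every two steps towards the origin, so that it vanishes for bounded solutions.\<close>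

lemma transfer_step:
  fixes g f f' z :: complex
  assumes g: "norm g \<le> 1" and f: "f = mobius g (z * f')" and nz: "1 + cnj g * (z * f') \<noteq> 0"
    and x': "x' = c * (cmv_rho g * x - cnj g * y')"
    and y: "y = g * x + cmv_rho g * y'"
    and y': "y' = e * (d' + f' * x')" and ce: "c * e = z"
  shows "y - f * x = cmv_rho g * e * d' / (1 + cnj g * (z * f'))"
proof -
  let ?\<rho> = "cmv_rho g"
  define D where "D = 1 + cnj g * (z * f')"
  have \<rho>: "?\<rho> * ?\<rho> = 1 - cnj g * g" by (rule cmv_rho_square[OF g])
  have fD: "f * D = g + z * f'" using nz by (simp add: f mobius_def D_def)
  have "e * x' = z * (?\<rho> * x - cnj g * y')" unfolding x' ce[symmetric] by (simp only: mult_ac)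
  moreover have "y' = e * d' + f' * (e * x')" unfolding y' by (simp add: algebra_simps)
  ultimately have "y' = e * d' + f' * (z * (?\<rho> * x - cnj g * y'))" by simp
  also have "\<dots> = e * d' + f' * z * ?\<rho> * x - f' * z * cnj g * y'" by (simp add: algebra_simps)
  finally have "y' + f' * z * cnj g * y' = e * d' + f' * z * ?\<rho> * x" by (simp only: eq_diff_eq)
  then have 1: "y' * D = e * d' + f' * z * ?\<rho> * x" by (simp add: D_def algebra_simps)
  have "(y - f * x) * D = g * x * D + ?\<rho> * (y' * D) - f * D * x"
    by (simp add: y algebra_simps)
  also have "\<dots> = ?\<rho> * e * d' + x * (g * D + f' * z * (?\<rho> * ?\<rho>) - (g + z * f'))"
    unfolding 1 fD by (simp add: algebra_simps)
  also have "g * D + f' * z * (?\<rho> * ?\<rho>) - (g + z * f') = 0"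
    unfolding \<rho> by (simp add: D_def algebra_simps)
  finally show ?thesis using nz by (simp add: D_def divide_simps)
qed

lemma cmv_rho_cnj [simp]: "cmv_rho (cnj a) = cmv_rho a"
  by (simp add: cmv_rho_def)

text \<open>\<open>U 0\<close> is the moment generating function of the spectral measure, so this is
  Geronimus' theorem for small \<open>z\<close>. The parameters appear conjugated because the
  moments are those of \<open>z ^ k\<close> and not of \<open>cnj z ^ k\<close>.\<close>

lemma cmv_resolvent_schur:
  assumes \<alpha>: "\<And>n. norm (\<alpha> n) \<le> 1" and z: "norm z \<le> 1 / 16"
    and U: "\<And>m. norm (U m) \<le> 2" "\<And>m. U m = delta0 m + z * half_line_cmv \<alpha> U m"
  shows "U 0 * (1 - z * schur_lim (\<lambda>n. cnj (\<alpha> n)) z) = 1"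
proof -
  define V where "V = half_M \<alpha> U"
  have V4: "norm (V m) \<le> 4" for m
    using norm_half_M_le[of \<alpha> U 2 m, OF \<alpha> U(1)] by (simp add: V_def)
  have UV: "U m = delta0 m + z * half_L \<alpha> V m" for m
    using U(2)[of m] by (simp add: V_def half_line_cmv_def)
  define f where "f n = schur_lim (\<lambda>k. cnj (\<alpha> (n + k))) z" for n
  have zb: "z \<in> ball 0 1" using z by simp
  have f1: "norm (f n) \<le> 1" for n
    unfolding f_def by (rule norm_schur_lim_le) (use \<alpha> zb in auto)
  have frec: "f n = mobius (cnj (\<alpha> n)) (z * f (Suc n))" for n
    unfolding f_def using schur_lim_rec[of "\<lambda>k. cnj (\<alpha> (n + k))" z] \<alpha> zb by (simp add: o_def)
  have nz: "1 + cnj (cnj (\<alpha> n)) * (z * f (Suc n)) \<noteq> 0" for n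
    using mobius_denominator_nonzero[of "cnj (\<alpha> n)" z "f (Suc n)"] \<alpha> f1 zb by simp
  have den: "norm (x / (1 + cnj (cnj (\<alpha> n)) * (z * f (Suc n)))) \<le> norm x * (16 / 15)" for x n
  proof -
    have "norm (\<alpha> n * (z * f (Suc n))) \<le> 1 * (1 / 16 * 1)"
      unfolding norm_mult using \<alpha> f1 z by (intro mult_mono) auto
    moreover have "1 - norm (\<alpha> n * (z * f (Suc n))) \<le> norm (1 + \<alpha> n * (z * f (Suc n)))"
      using norm_diff_ineq[of 1 "\<alpha> n * (z * f (Suc n))"] by simp
    ultimately have "15 / 16 \<le> norm (1 + \<alpha> n * (z * f (Suc n)))" by simp
    then have "norm x / norm (1 + \<alpha> n * (z * f (Suc n))) \<le> norm x / (15 / 16)"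
      by (intro divide_left_mono) auto
    then show ?thesis by (simp add: norm_divide)
  qed
  \<comment> \<open>\<open>X n\<close> and \<open>Y n\<close> are the \<open>n\<close>-th
    coordinates of the input and output of the block with coefficient \<open>\<alpha> n\<close>.
    This block belongs to \<open>half_L\<close> for even \<open>n\<close>, with input
    \<open>V\<close>, and to \<open>half_M\<close> for odd \<open>n\<close>, with input
    \<open>U\<close>.\<close>
  define X where "X n = (if even n then V n else U n)" for n
  define Y where "Y n = (if even n then half_L \<alpha> V n else V n)" for n
  \<comment> \<open>The factor \<open>z\<close> of the resolvent equation enters the defect only at
    odd \<open>n\<close>, while a denominator costs at most 16/15. Two steps therefore give 16/15
    times 1/15, well below the 1/2 that is used.\<close>
  define D where "D n = Y n - f n * X n" for n
  have even_rel: "D n = cmv_rho (\<alpha> n) * 1 * D (Suc n) / (1 + cnj (cnj (\<alpha> n)) * (z * f (Suc n)))"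
    if n: "even n" for n
  proof -
    have "U (Suc n) = z * (cmv_rho (\<alpha> n) * V n - \<alpha> n * V (Suc n))"
      using UV[of "Suc n"] n by (simp add: delta0_def half_L_def Theta_snd_def)
    then have x': "X (Suc n) = z * (cmv_rho (cnj (\<alpha> n)) * X n - cnj (cnj (\<alpha> n)) * Y (Suc n))"
      using n by (simp add: X_def Y_def)
    have y: "Y n = cnj (\<alpha> n) * X n + cmv_rho (cnj (\<alpha> n)) * Y (Suc n)"
      using n by (simp add: X_def Y_def half_L_def Theta_fst_def)
    have y': "Y (Suc n) = 1 * (D (Suc n) + f (Suc n) * X (Suc n))" by (simp add: D_def)
    have "norm (cnj (\<alpha> n)) \<le> 1" using \<alpha> by simp
    from transfer_step[OF this frec nz x' y y']
    show ?thesis by (simp only: D_def[of n] cmv_rho_cnj mult_1_right)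
  qed
  have odd_rel: "D n = cmv_rho (\<alpha> n) * z * D (Suc n) / (1 + cnj (cnj (\<alpha> n)) * (z * f (Suc n)))"
    if n: "odd n" for n
  proof -
    have "U (Suc n) = z * half_L \<alpha> V (Suc n)"
      using UV[of "Suc n"] by (simp add: delta0_def)
    then have y': "U (Suc n) = z * (D (Suc n) + f (Suc n) * X (Suc n))"
      using n by (simp add: D_def X_def Y_def)
    have x': "X (Suc n) = 1 * (cmv_rho (cnj (\<alpha> n)) * X n - cnj (cnj (\<alpha> n)) * U (Suc n))"
      using n by (simp add: X_def V_def half_M_def Theta_snd_def)
    have y: "Y n = cnj (\<alpha> n) * X n + cmv_rho (cnj (\<alpha> n)) * U (Suc n)"
      using n by (auto simp: X_def Y_def V_def half_M_def Theta_fst_def)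
    have "norm (cnj (\<alpha> n)) \<le> 1" using \<alpha> by simp
    from transfer_step[OF this frec nz x' y y']
    show ?thesis by (simp only: D_def[of n] cmv_rho_cnj mult_1_left)
  qed
  have even_le: "norm (D n) \<le> norm (D (Suc n)) * (16 / 15)" if "even n" for n
  proof -
    have "norm (D n) \<le> norm (cmv_rho (\<alpha> n) * 1 * D (Suc n)) * (16 / 15)"
      unfolding even_rel[OF that] by (rule den)
    also have "norm (cmv_rho (\<alpha> n) * 1 * D (Suc n)) \<le> 1 * 1 * norm (D (Suc n))"
      unfolding norm_mult using norm_cmv_rho_le[OF \<alpha>, of n] by (intro mult_mono) auto
    finally show ?thesis by simp
  qed
  have odd_le: "norm (D n) \<le> norm (D (Suc n)) * (1 / 15)" if "odd n" for n
  proof -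
    have "norm (D n) \<le> norm (cmv_rho (\<alpha> n) * z * D (Suc n)) * (16 / 15)"
      unfolding odd_rel[OF that] by (rule den)
    also have "norm (cmv_rho (\<alpha> n) * z * D (Suc n)) \<le> 1 * (1 / 16) * norm (D (Suc n))"
      unfolding norm_mult using norm_cmv_rho_le[OF \<alpha>, of n] z by (intro mult_mono) auto
    finally show ?thesis by simp
  qed
  have two: "norm (D (2 * k)) \<le> norm (D (2 * Suc k)) * (1 / 2)" for k
  proof -
    have "norm (D (2 * k)) \<le> norm (D (Suc (2 * k))) * (16 / 15)" by (rule even_le) simp
    moreover have "norm (D (Suc (2 * k))) \<le> norm (D (Suc (Suc (2 * k)))) * (1 / 15)" by (rule odd_le) simp
    moreover have e: "2 * Suc k = Suc (Suc (2 * k))" by simp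
    ultimately show ?thesis unfolding e using norm_ge_zero[of "D (Suc (Suc (2 * k)))"] by linarith
  qed
  have down: "norm (D 0) \<le> norm (D (2 * k)) * (1 / 2) ^ k" for k
  proof (induction k)
    case (Suc k)
    have "norm (D (2 * k)) * (1 / 2) ^ k \<le> norm (D (2 * Suc k)) * (1 / 2) * (1 / 2) ^ k"
      by (intro mult_right_mono two) simp
    with Suc.IH show ?case by (simp only: power_Suc mult.assoc)
  qed simp
  have "norm (D n) \<le> 12" for n
  proof -
    have "norm (X n) \<le> 4" using U(1)[of n] V4[of n] by (auto simp: X_def)
    then have "norm (f n * X n) \<le> 1 * 4" unfolding norm_mult using f1 by (intro mult_mono) auto
    moreover have "norm (Y n) \<le> 8"
      using norm_half_L_le[of \<alpha> V 4 n, OF \<alpha> V4] V4[of n] by (auto simp: Y_def)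
    ultimately show ?thesis
      unfolding D_def using norm_triangle_ineq4[of "Y n" "f n * X n"] by simp
  qed
  then have "norm (D 0) \<le> 12 * (1 / 2) ^ k" for k
    by (intro order_trans[OF down[of k]] mult_right_mono) auto
  moreover have "(\<lambda>k. 12 * (1 / 2 :: real) ^ k) \<longlonglongrightarrow> 0"
    by (rule geometric_tendsto_0) simp
  ultimately have "norm (D 0) \<le> 0"
    by (intro tendsto_lowerbound[of "\<lambda>k. 12 * (1 / 2 :: real) ^ k" _ sequentially]) auto
  \<comment> \<open>The vanishing defect at the origin gives the ratio of the components there;
    \<open>half_M\<close> fixes coordinate 0, so the equation for \<open>U 0\<close> closes.\<close>
  then have "half_L \<alpha> V 0 = f 0 * V 0" by (simp add: D_def X_def Y_def)
  moreover have "V 0 = U 0" by (simp add: V_def half_M_def)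
  ultimately show ?thesis
    using UV[of 0] by (simp add: delta0_def f_def algebra_simps)
qed

section \<open>Moments and Poisson integral of the spectral measure\<close>

lemma norm_spectral_moment_le:
  fixes \<mu> :: "complex measure"
  assumes "prob_space \<mu>" "sets \<mu> = sets borel" "AE z in \<mu>. z \<in> sphere 0 1"
  shows "integrable \<mu> (\<lambda>z::complex. z ^ k)" "norm (\<integral>z. z ^ k \<partial>\<mu>) \<le> 1" "(\<integral>z. norm (z ^ k) \<partial>\<mu>) = 1"
proof -
  interpret prob_space \<mu> by fact
  have m: "(\<lambda>z::complex. z ^ k) \<in> borel_measurable \<mu>"
    using assms(2) by (simp add: measurable_cong_sets[OF assms(2) refl])
  have 1: "AE z in \<mu>. norm (z ^ k) = 1"
    using assms(3) by eventually_elim (simp add: norm_power)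
  show i: "integrable \<mu> (\<lambda>z::complex. z ^ k)"
    by (rule integrable_const_bound[where B = 1, OF _ m]) (use 1 in eventually_elim, simp)
  have "(\<integral>z. norm (z ^ k) \<partial>\<mu>) = (\<integral>z. 1 \<partial>\<mu>)"
    using 1 m by (intro integral_cong_AE) auto
  then show "(\<integral>z. norm (z ^ k) \<partial>\<mu>) = 1" by (simp add: prob_space)
  then show "norm (\<integral>z. z ^ k \<partial>\<mu>) \<le> 1"
    using integral_norm_bound[of \<mu> "\<lambda>z. z ^ k"] by simp
qed

lemma spectral_measure_sums:
  fixes \<mu> :: "complex measure" and z :: complex
  assumes \<mu>: "prob_space \<mu>" "sets \<mu> = sets borel" "AE z in \<mu>. z \<in> sphere 0 1" and z: "norm z < 1"
  shows "(\<lambda>k. (\<integral>\<zeta>. \<zeta> ^ k \<partial>\<mu>) * z ^ k) sums (\<integral>\<zeta>. 1 / (1 - z * \<zeta>) \<partial>\<mu>)"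
    "integrable \<mu> (\<lambda>\<zeta>. 1 / (1 - z * \<zeta>))"
proof -
  interpret prob_space \<mu> by fact
  have i: "integrable \<mu> (\<lambda>\<zeta>. z ^ k * \<zeta> ^ k)" for k
    using norm_spectral_moment_le(1)[OF \<mu>, of k] by simp
  have n: "AE \<zeta> in \<mu>. summable (\<lambda>k. norm (z ^ k * \<zeta> ^ k))"
    using \<mu>(3) by eventually_elim (use z in \<open>simp add: norm_mult norm_power summable_geometric\<close>)
  have "(\<integral>\<zeta>. norm (z ^ k * \<zeta> ^ k) \<partial>\<mu>) = norm z ^ k" for k
    using norm_spectral_moment_le(3)[OF \<mu>, of k] by (simp add: norm_mult norm_power)
  then have s: "summable (\<lambda>k. \<integral>\<zeta>. norm (z ^ k * \<zeta> ^ k) \<partial>\<mu>)"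
    using z by (simp add: summable_geometric)
  have "(\<lambda>k. \<integral>\<zeta>. z ^ k * \<zeta> ^ k \<partial>\<mu>) sums (\<integral>\<zeta>. (\<Sum>k. z ^ k * \<zeta> ^ k) \<partial>\<mu>)"
    by (rule sums_integral[OF i n s])
  moreover have ae: "AE \<zeta> in \<mu>. (\<Sum>k. z ^ k * \<zeta> ^ k) = 1 / (1 - z * \<zeta>)"
    using \<mu>(3)
  proof eventually_elim
    case (elim \<zeta>)
    then have "norm (z * \<zeta>) < 1" using z by (simp add: norm_mult)
    from suminf_geometric[OF this] show ?case by (simp add: power_mult_distrib)
  qed
  moreover have m: "(\<lambda>\<zeta>. \<Sum>k. z ^ k * \<zeta> ^ k) \<in> borel_measurable \<mu>" "(\<lambda>\<zeta>. 1 / (1 - z * \<zeta>)) \<in> borel_measurable \<mu>"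
    unfolding measurable_cong_sets[OF \<mu>(2) refl] by measurable
  ultimately show "(\<lambda>k. (\<integral>\<zeta>. \<zeta> ^ k \<partial>\<mu>) * z ^ k) sums (\<integral>\<zeta>. 1 / (1 - z * \<zeta>) \<partial>\<mu>)"
    using integral_cong_AE[OF m ae] by (simp add: mult.commute)
  show "integrable \<mu> (\<lambda>\<zeta>. 1 / (1 - z * \<zeta>))"
    using integrable_cong_AE[OF m ae] integrable_suminf[OF i n s] by simp
qed

text \<open>Near the origin the integral is \<open>U 0\<close>, both having the moments as Taylor
  coefficients. Both sides are holomorphic in the disc, so the identity extends by analytic
  continuation.\<close>

lemma spectral_measure_schur:
  assumes \<alpha>: "\<And>n. norm (\<alpha> n) \<le> 1" and \<mu>: "spectral_measure (half_line_cmv \<alpha>) \<mu>" and z: "norm z < 1"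
  shows "(\<integral>\<zeta>. 1 / (1 - z * \<zeta>) \<partial>\<mu>) * (1 - z * schur_lim (\<lambda>n. cnj (\<alpha> n)) z) = 1"
proof -
  have \<mu>': "prob_space \<mu>" "sets \<mu> = sets borel" "AE z in \<mu>. z \<in> sphere 0 1"
    and mom: "\<And>k. (half_line_cmv \<alpha> ^^ k) delta0 0 = (\<integral>z. z ^ k \<partial>\<mu>)"
    using \<mu> by (auto simp: spectral_measure_def)
  let ?f = "schur_lim (\<lambda>n. cnj (\<alpha> n))" and ?M = "\<lambda>z. \<integral>\<zeta>. 1 / (1 - z * \<zeta>) \<partial>\<mu>"
  have M: "?M holomorphic_on ball 0 1"
    by (rule power_series_holomorphic[where a = "\<lambda>k. \<integral>\<zeta>. \<zeta> ^ k \<partial>\<mu>"])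
      (use spectral_measure_sums(1)[OF \<mu>'] in simp)
  have f: "?f holomorphic_on ball 0 1"
    using schur_schur_lim[of "\<lambda>n. cnj (\<alpha> n)"] \<alpha> by (simp add: schur_def)
  have small: "?M w * (1 - w * ?f w) = 1" if w: "w \<in> ball 0 (1 / 16)" for w
  proof -
    have w': "norm w \<le> 1 / 16" using w by simp
    from cmv_resolvent[of \<alpha> w, OF \<alpha> w'] obtain U where U:
      "\<And>m. (\<lambda>k. w ^ k * (half_line_cmv \<alpha> ^^ k) delta0 m) sums U m"
      "\<And>m. norm (U m) \<le> 2" "\<And>m. U m = delta0 m + w * half_line_cmv \<alpha> U m"
      by blast
    have "U 0 = ?M w"
      using U(1)[of 0] spectral_measure_sums(1)[OF \<mu>', of w] w
      by (intro sums_unique2[of "\<lambda>k. (\<integral>\<zeta>. \<zeta> ^ k \<partial>\<mu>) * w ^ k"]) (simp_all add: mom mult.commute)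
    then show ?thesis using cmv_resolvent_schur[of \<alpha> w U, OF \<alpha> w' U(2,3)] by simp
  qed
  show ?thesis
  proof (rule analytic_continuation_open[of "ball 0 (1 / 16)" "ball 0 1"
        "\<lambda>w. ?M w * (1 - w * ?f w)" "\<lambda>_. 1" z])
    show "(\<lambda>w. ?M w * (1 - w * ?f w)) holomorphic_on ball 0 1"
      using M f by (intro holomorphic_intros)
  qed (use z small in auto)
qed

lemma schur_approx_cnj:
  "schur_approx n (\<lambda>k. cnj (\<gamma> k)) 0 z = cnj (schur_approx n \<gamma> 0 (cnj z))"
  by (induction n arbitrary: \<gamma>) (simp_all add: mobius_def o_def)

text \<open>Turns the conjugated parameters supplied by the moments into the Verblunsky coefficients
  themselves, at the price of evaluating at \<open>cnj z\<close>.\<close>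

lemma schur_lim_cnj:
  assumes "\<forall>k. norm (\<gamma> k) \<le> 1" "norm z < 1"
  shows "schur_lim (\<lambda>k. cnj (\<gamma> k)) z = cnj (schur_lim \<gamma> (cnj z))"
proof (rule LIMSEQ_unique)
  show "(\<lambda>n. schur_approx n (\<lambda>k. cnj (\<gamma> k)) 0 z) \<longlonglongrightarrow> schur_lim (\<lambda>k. cnj (\<gamma> k)) z"
    by (rule schur_approx_tendsto) (use assms in auto)
  show "(\<lambda>n. schur_approx n (\<lambda>k. cnj (\<gamma> k)) 0 z) \<longlonglongrightarrow> cnj (schur_lim \<gamma> (cnj z))"
    unfolding schur_approx_cnj by (intro tendsto_cnj schur_approx_tendsto) (use assms in auto)
qed

lemma Re_cayley:
  assumes "(x::complex) \<noteq> 1"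
  shows "Re (2 / (1 - x) - 1) = (1 - (norm x)\<^sup>2) / (norm (1 - x))\<^sup>2"
proof -
  have "2 / (1 - x) - 1 = (1 + x) / (1 - x)" using assms by (simp add: field_simps)
  also have "\<dots> = (1 + x) * cnj (1 - x) / of_real ((norm (1 - x))\<^sup>2)"
    by (subst complex_div_cnj) simp
  also have "Re \<dots> = Re ((1 + x) * cnj (1 - x)) / (norm (1 - x))\<^sup>2"
    by (rule Re_divide_of_real)
  also have "Re ((1 + x) * cnj (1 - x)) = 1 - (norm x)\<^sup>2"
    by (simp add: cmod_power2) (simp add: power2_eq_square algebra_simps)
  finally show ?thesis .
qed

text \<open>The real part of the Caratheodory function \<open>(1 + x) / (1 - x)\<close>, written as
  \<open>2 / (1 - x) - 1\<close> so that the generating function of the moments can be inserted, at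
  \<open>cnj z\<close> to undo the conjugation.\<close>

lemma spectral_measure_poisson:
  assumes \<alpha>: "\<And>n. norm (\<alpha> n) \<le> 1" and \<mu>: "spectral_measure (half_line_cmv \<alpha>) \<mu>" and z: "norm z < 1"
  defines "x \<equiv> z * schur_lim \<alpha> z"
  shows "(\<integral>\<zeta>. (1 - (norm z)\<^sup>2) / (norm (\<zeta> - z))\<^sup>2 \<partial>\<mu>) = (1 - (norm x)\<^sup>2) / (norm (1 - x))\<^sup>2"
    "integrable \<mu> (\<lambda>\<zeta>. (1 - (norm z)\<^sup>2) / (norm (\<zeta> - z))\<^sup>2)"
proof -
  have \<mu>': "prob_space \<mu>" "sets \<mu> = sets borel" "AE z in \<mu>. z \<in> sphere 0 1"
    using \<mu> by (auto simp: spectral_measure_def)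
  interpret prob_space \<mu> by fact
  let ?w = "cnj z"
  let ?y = "?w * schur_lim (\<lambda>n. cnj (\<alpha> n)) ?w"
  have yx: "?y = cnj x"
    using schur_lim_cnj[of \<alpha> ?w] \<alpha> z by (simp add: x_def)
  have M: "(\<integral>\<zeta>. 1 / (1 - ?w * \<zeta>) \<partial>\<mu>) * (1 - ?y) = 1"
    using spectral_measure_schur[of \<alpha> \<mu> ?w, OF \<alpha> \<mu>] z by simp
  then have y1: "?y \<noteq> 1" by auto
  then have "(\<integral>\<zeta>. 1 / (1 - ?w * \<zeta>) \<partial>\<mu>) = 1 / (1 - ?y)"
    using M by (simp add: field_simps)
  moreover have I: "integrable \<mu> (\<lambda>\<zeta>. 1 / (1 - ?w * \<zeta>))"
    using spectral_measure_sums(2)[OF \<mu>', of ?w] z by simp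
  moreover have I2: "integrable \<mu> (\<lambda>\<zeta>. 2 * (1 / (1 - ?w * \<zeta>)) - 1)"
    by (intro Bochner_Integration.integrable_diff integrable_mult_right I) simp
  moreover have "(\<integral>\<zeta>. 2 * (1 / (1 - ?w * \<zeta>)) - 1 \<partial>\<mu>) = 2 * (\<integral>\<zeta>. 1 / (1 - ?w * \<zeta>) \<partial>\<mu>) - 1"
    using Bochner_Integration.integral_diff[OF integrable_mult_right[OF I, of 2], of "\<lambda>_. 1"]
      Bochner_Integration.integral_mult_right[of 2 \<mu>, OF I] by (simp only: integrable_const) (simp add: prob_space)
  ultimately have "(\<integral>\<zeta>. 2 * (1 / (1 - ?w * \<zeta>)) - 1 \<partial>\<mu>) = 2 / (1 - ?y) - 1"
    by (simp only: times_divide_eq_right mult_1_right)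
  then have E: "(\<integral>\<zeta>. Re (2 * (1 / (1 - ?w * \<zeta>)) - 1) \<partial>\<mu>) = (1 - (norm ?y)\<^sup>2) / (norm (1 - ?y))\<^sup>2"
    using integral_Re[OF I2] Re_cayley[OF y1] by simp
  have ae: "AE \<zeta> in \<mu>. Re (2 * (1 / (1 - ?w * \<zeta>)) - 1) = (1 - (norm z)\<^sup>2) / (norm (\<zeta> - z))\<^sup>2"
    using \<mu>'(3)
  proof eventually_elim
    case (elim \<zeta>)
    then have n\<zeta>: "norm \<zeta> = 1" by simp
    have ne: "?w * \<zeta> \<noteq> 1"
    proof
      assume "?w * \<zeta> = 1"
      then have "norm (?w * \<zeta>) = 1" by simp
      then show False using n\<zeta> z by (simp add: norm_mult)
    qed
    have "\<zeta> * cnj \<zeta> = 1" using complex_norm_square[of \<zeta>] n\<zeta> by simp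
    \<comment> \<open>On the circle the reciprocal of \<zeta> is its conjugate; this converts the
      denominator of the moment integral into that of the Poisson kernel.\<close>
    then have "1 - ?w * \<zeta> = \<zeta> * cnj (\<zeta> - z)" by (simp add: algebra_simps)
    then have "norm (1 - ?w * \<zeta>) = norm (\<zeta> - z)" using n\<zeta> by (simp only: norm_mult complex_mod_cnj)
    then show ?case
      using Re_cayley[OF ne] n\<zeta> by (simp add: norm_mult)
  qed
  have m: "(\<lambda>\<zeta>. Re (2 * (1 / (1 - ?w * \<zeta>)) - 1)) \<in> borel_measurable \<mu>"
    "(\<lambda>\<zeta>. (1 - (norm z)\<^sup>2) / (norm (\<zeta> - z))\<^sup>2) \<in> borel_measurable \<mu>"
    unfolding measurable_cong_sets[OF \<mu>'(2) refl] by measurable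
  have "norm (1 - cnj x) = norm (1 - x)" by (metis complex_cnj_diff complex_cnj_one complex_mod_cnj)
  then have "norm ?y = norm x" "norm (1 - ?y) = norm (1 - x)"
    unfolding yx by (simp_all only: complex_mod_cnj)
  then show "(\<integral>\<zeta>. (1 - (norm z)\<^sup>2) / (norm (\<zeta> - z))\<^sup>2 \<partial>\<mu>) = (1 - (norm x)\<^sup>2) / (norm (1 - x))\<^sup>2"
    using E integral_cong_AE[OF m ae] by simp
  show "integrable \<mu> (\<lambda>\<zeta>. (1 - (norm z)\<^sup>2) / (norm (\<zeta> - z))\<^sup>2)"
    using integrable_cong_AE[OF m ae] integrable_Re[OF I2] by simp
qed

section \<open>Convergence along the absolutely continuous spectrum\<close>

lemma schur_times_z: "schur f \<Longrightarrow> schur (\<lambda>z. z * f z)"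
  unfolding schur_def by (auto intro!: holomorphic_intros mult_le_one simp: norm_mult)

lemma boundary_functionD:
  assumes "boundary_function h \<phi>"
  shows "\<phi> \<in> borel_measurable borel" "norm (\<phi> t) \<le> 1"
    "AE t in angle_measure. ((\<lambda>r. h (of_real r * cis t)) \<longlongrightarrow> \<phi> t) (at_left 1)"
  using assms by (auto simp: boundary_function_def)

lemma nn_integral_circle_eq:
  assumes [measurable]: "f \<in> borel_measurable borel"
  shows "(\<integral>\<^sup>+z. f z \<partial>circle_lebesgue) = (\<integral>\<^sup>+t. f (cis t) \<partial>angle_measure)"
proof -
  have "(\<integral>\<^sup>+z. f z \<partial>circle_lebesgue) = (\<integral>\<^sup>+t. f (cis t) \<partial>restrict_space lborel {0..<2 * pi})"
    unfolding circle_lebesgue_def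
    by (rule nn_integral_distr) (auto intro!: measurable_restrict_space1)
  also have "\<dots> = (\<integral>\<^sup>+t. f (cis t) * indicator {0..<2 * pi} t \<partial>lborel)"
    by (rule nn_integral_restrict_space) simp
  also have "\<dots> = (\<integral>\<^sup>+t. f (cis t) * indicator {0..2 * pi} t \<partial>lborel)"
    using AE_lborel_singleton[of "2 * pi"]
    by (intro nn_integral_cong_AE) (auto elim!: eventually_mono simp: indicator_def)
  also have "\<dots> = (\<integral>\<^sup>+t. f (cis t) \<partial>angle_measure)"
    unfolding angle_measure_def by (rule nn_integral_restrict_space[symmetric]) simp
  finally show ?thesis .
qed

text \<open>The measure with density \<open>min w 1\<close> lies below \<mu>, and the Poisson kernel
  is nonnegative. The density is truncated because radial limits are available for Poisson integrals
  of bounded functions.\<close>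

lemma poisson_ac_le_spectral:
  assumes \<alpha>: "\<And>n. norm (\<alpha> n) \<le> 1" and \<mu>: "spectral_measure (half_line_cmv \<alpha>) \<mu>"
    and w: "ac_density \<mu> w" and r: "0 \<le> r" "r < 1"
  shows "(\<integral>t. poisson_angle r (t - \<theta>) * min (w (cis t)) 1 \<partial>angle_measure)
    \<le> (\<integral>\<zeta>. (1 - (norm (of_real r * cis \<theta>))\<^sup>2) / (norm (\<zeta> - of_real r * cis \<theta>))\<^sup>2 \<partial>\<mu>)"
proof -
  have \<mu>s: "sets \<mu> = sets borel" using \<mu> by (simp add: spectral_measure_def)
  have wm [measurable]: "w \<in> borel_measurable borel" and w0: "\<And>z. 0 \<le> w z"
    using w by (auto simp: ac_density_def)
  define z where "z = of_real r * cis \<theta>"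
  have z: "norm z < 1" using r by (simp add: z_def norm_mult)
  define k where "k = (\<lambda>\<zeta>. (1 - (norm z)\<^sup>2) / (norm (\<zeta> - z))\<^sup>2)"
  have km [measurable]: "k \<in> borel_measurable borel" unfolding k_def by measurable
  have k0: "0 \<le> k \<zeta>" for \<zeta> using z by (simp add: k_def power_le_one)
  have kc: "k (cis t) = poisson_angle r (t - \<theta>)" for t
    using norm_cis_diff_square[of t r \<theta>] r
    by (simp add: k_def z_def poisson_angle_def norm_mult)
  define W where "W = (\<lambda>\<zeta>. min (w \<zeta>) 1)"
  have Wm [measurable]: "W \<in> borel_measurable borel" unfolding W_def by measurable
  have W: "0 \<le> W \<zeta>" "W \<zeta> \<le> 1" "W \<zeta> \<le> w \<zeta>" for \<zeta> using w0 by (auto simp: W_def)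
  have cs [simp]: "sets circle_lebesgue = sets borel" by (simp add: circle_lebesgue_def)
  have cm: "f \<in> borel_measurable borel \<Longrightarrow> f \<in> borel_measurable circle_lebesgue" for f :: "complex \<Rightarrow> ennreal"
    by (simp add: measurable_cong_sets[OF cs refl])
  let ?\<nu> = "density circle_lebesgue (\<lambda>\<zeta>. ennreal (W \<zeta>))"
  have "emeasure ?\<nu> B \<le> emeasure \<mu> B" for B
  proof (cases "B \<in> sets borel")
    case True
    have "emeasure ?\<nu> B = (\<integral>\<^sup>+\<zeta>. ennreal (W \<zeta>) * indicator B \<zeta> \<partial>circle_lebesgue)"
      using True by (intro emeasure_density cm) auto
    also have "\<dots> \<le> (\<integral>\<^sup>+\<zeta>. ennreal (w \<zeta>) * indicator B \<zeta> \<partial>circle_lebesgue)"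
      by (intro nn_integral_mono mult_right_mono ennreal_leI W) simp
    also have "\<dots> = emeasure (density circle_lebesgue (\<lambda>z. ennreal (w z))) B"
      using True by (intro emeasure_density[symmetric] cm) auto
    also have "\<dots> \<le> emeasure \<mu> B"
      using w True by (fastforce simp: ac_density_def)
    finally show ?thesis .
  next
    case False
    then show ?thesis by (simp add: emeasure_notin_sets)
  qed
  moreover have "sets ?\<nu> = sets \<mu>" by (simp add: \<mu>s)
  ultimately have "?\<nu> \<le> \<mu>" by (simp add: le_measure)
  then have le: "(\<integral>\<^sup>+\<zeta>. ennreal (k \<zeta>) \<partial>?\<nu>) \<le> (\<integral>\<^sup>+\<zeta>. ennreal (k \<zeta>) \<partial>\<mu>)"
    by (intro nn_integral_mono_measure) (simp_all add: \<mu>s)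
  have "integrable \<mu> k" unfolding k_def by (rule spectral_measure_poisson(2)[OF \<alpha> \<mu> z])
  then have R: "(\<integral>\<^sup>+\<zeta>. ennreal (k \<zeta>) \<partial>\<mu>) = ennreal (\<integral>\<zeta>. k \<zeta> \<partial>\<mu>)"
    by (rule nn_integral_eq_integral) (simp add: k0)
  have "(\<integral>\<^sup>+\<zeta>. ennreal (k \<zeta>) \<partial>?\<nu>) = (\<integral>\<^sup>+\<zeta>. ennreal (W \<zeta>) * ennreal (k \<zeta>) \<partial>circle_lebesgue)"
    by (intro nn_integral_density cm) measurable
  also have "\<dots> = (\<integral>\<^sup>+\<zeta>. ennreal (k \<zeta> * W \<zeta>) \<partial>circle_lebesgue)"
    by (intro nn_integral_cong) (simp add: ennreal_mult k0 W mult.commute)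
  also have "\<dots> = (\<integral>\<^sup>+t. ennreal (k (cis t) * W (cis t)) \<partial>angle_measure)"
    by (rule nn_integral_circle_eq) measurable
  also have "\<dots> = ennreal (\<integral>t. k (cis t) * W (cis t) \<partial>angle_measure)"
  proof (rule nn_integral_eq_integral)
    show "integrable angle_measure (\<lambda>t. k (cis t) * W (cis t))"
    proof (rule integrable_angle_bounded[where M = "(1 - r\<^sup>2) / (1 - r)\<^sup>2 * 1"])
      show "norm (k (cis t) * W (cis t)) \<le> (1 - r\<^sup>2) / (1 - r)\<^sup>2 * 1" for t
        unfolding real_norm_def abs_mult
        using poisson_angle_bounded[OF r, of "t - \<theta>"] W[of "cis t"] k0[of "cis t"] r
        by (intro mult_mono) (auto simp: kc power_le_one)
    qed measurable
  qed (auto simp: k0 W)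
  finally have "ennreal (\<integral>t. k (cis t) * W (cis t) \<partial>angle_measure) \<le> ennreal (\<integral>\<zeta>. k \<zeta> \<partial>\<mu>)"
    using le R by simp
  moreover have "0 \<le> (\<integral>\<zeta>. k \<zeta> \<partial>\<mu>)" by (rule Bochner_Integration.integral_nonneg) (rule k0)
  ultimately have "(\<integral>t. k (cis t) * W (cis t) \<partial>angle_measure) \<le> (\<integral>\<zeta>. k \<zeta> \<partial>\<mu>)"
    by (simp add: ennreal_le_iff)
  then show ?thesis unfolding kc by (simp add: W_def k_def z_def)
qed

text \<open>At almost every point \<phi> differs from 1. If it had modulus one there, the Poisson
  integral of \<mu>, which is \<open>(1 - |x|^2) / |1 - x|^2\<close>, would tend to 0 along the
  radius; but it dominates the Poisson integral of \<open>min w 1\<close>, whose limit is positive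
  where \<open>w\<close> is.\<close>

lemma ac_imp_boundary_less_1:
  assumes \<alpha>: "\<And>n. norm (\<alpha> n) \<le> 1" and \<mu>: "spectral_measure (half_line_cmv \<alpha>) \<mu>"
    and w: "ac_density \<mu> w" and \<phi>: "boundary_function (\<lambda>z. z * schur_lim \<alpha> z) \<phi>"
  shows "AE t in angle_measure. 0 < w (cis t) \<longrightarrow> norm (\<phi> t) < 1"
proof -
  have S: "schur (schur_lim \<alpha>)" by (rule schur_schur_lim) (use \<alpha> in simp)
  have wm [measurable]: "w \<in> borel_measurable borel" and w0: "\<And>z. 0 \<le> w z"
    using w by (auto simp: ac_density_def)
  have mb: "\<bar>min (w z) 1\<bar> \<le> 1" for z using w0[of z] by (auto simp: min_def)
  have "AE t in angle_measure. \<phi> t \<noteq> 1"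
    by (rule schur_boundary_ne_1[OF schur_times_z[OF S] _ \<phi>]) simp
  moreover have "AE \<theta> in angle_measure. ((\<lambda>r. \<integral>t. poisson_angle r (t - \<theta>) *\<^sub>R min (w (cis t)) 1 \<partial>angle_measure)
      \<longlongrightarrow> (2 * pi) *\<^sub>R min (w (cis \<theta>)) 1) (at_left 1)"
    by (rule poisson_limit_AE[where M = 1]) (measurable, simp add: mb)
  ultimately show ?thesis using boundary_functionD(3)[OF \<phi>]
  proof eventually_elim
    case (elim \<theta>)
    show ?case
    proof (intro impI, rule ccontr)
      assume pos: "0 < w (cis \<theta>)" and "\<not> norm (\<phi> \<theta>) < 1"
      then have 1: "norm (\<phi> \<theta>) = 1" using boundary_functionD(2)[OF \<phi>, of \<theta>] by simp
      define x where "x = (\<lambda>r. of_real r * cis \<theta> * schur_lim \<alpha> (of_real r * cis \<theta>))"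
      have x: "(x \<longlongrightarrow> \<phi> \<theta>) (at_left 1)" using elim(3) by (simp add: x_def)
      have "((\<lambda>r. (1 - (norm (x r))\<^sup>2) / (norm (1 - x r))\<^sup>2) \<longlongrightarrow>
          (1 - (norm (\<phi> \<theta>))\<^sup>2) / (norm (1 - \<phi> \<theta>))\<^sup>2) (at_left 1)"
        using elim(1) by (intro tendsto_intros x) simp
      then have up: "((\<lambda>r. (1 - (norm (x r))\<^sup>2) / (norm (1 - x r))\<^sup>2) \<longlongrightarrow> 0) (at_left 1)"
        using 1 by simp
      have "eventually (\<lambda>r. (\<integral>t. poisson_angle r (t - \<theta>) *\<^sub>R min (w (cis t)) 1 \<partial>angle_measure)
          \<le> (1 - (norm (x r))\<^sup>2) / (norm (1 - x r))\<^sup>2) (at_left 1)"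
        using eventually_at_left_real[of 0 "1::real"]
      proof (rule eventually_mono)
        fix r :: real assume "r \<in> {0<..<1}"
        then have r: "0 \<le> r" "r < 1" "norm (of_real r * cis \<theta>) < 1" by (auto simp: norm_mult)
        show "(\<integral>t. poisson_angle r (t - \<theta>) *\<^sub>R min (w (cis t)) 1 \<partial>angle_measure)
          \<le> (1 - (norm (x r))\<^sup>2) / (norm (1 - x r))\<^sup>2"
          using poisson_ac_le_spectral[OF \<alpha> \<mu> w r(1,2), of \<theta>]
          unfolding spectral_measure_poisson(1)[OF \<alpha> \<mu> r(3)] x_def real_scaleR_def .
      qed simp
      from tendsto_le[OF _ up elim(2) this] have "(2 * pi) *\<^sub>R min (w (cis \<theta>)) 1 \<le> 0" by simp
      with pos show False using pi_gt_zero by (auto simp: mult_le_0_iff min_def split: if_splits)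
    qed
  qed
qed

text \<open>Pseudohyperbolic distance at most \<open>e\<close>, multiplied out so that it also makes
  sense for equal points of modulus one.\<close>

definition pseudo_close :: "real \<Rightarrow> complex \<Rightarrow> complex \<Rightarrow> bool" where
  "pseudo_close e a b \<longleftrightarrow> norm (a - b) \<le> e * norm (1 - cnj a * b)"

text \<open>Under the automorphism both sides of the inequality acquire the same factor
  \<open>K\<close>, for points of the closed disc as well.\<close>

lemma pseudo_close_mobius:
  assumes g: "norm g < 1" and a: "norm a \<le> 1" and b: "norm b \<le> 1" and ab: "pseudo_close e a b"
  shows "pseudo_close e (mobius g a) (mobius g b)"
proof -
  have nz: "1 + cnj g * a \<noteq> 0" "1 + cnj g * b \<noteq> 0"
    using mobius_denominator_nonzero'[OF g] a b by auto
  then have nz': "1 + g * cnj a \<noteq> 0"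
    using complex_cnj_cancel_iff[of "1 + cnj g * a" 0] by simp
  have 1: "mobius g a - mobius g b = (1 - cnj g * g) * (a - b) / ((1 + cnj g * a) * (1 + cnj g * b))"
    by (rule mobius_diff[OF nz])
  have 2: "1 - cnj (mobius g a) * mobius g b
      = (1 - cnj g * g) * (1 - cnj a * b) / ((1 + g * cnj a) * (1 + cnj g * b))"
    unfolding mobius_def using nz nz' by (simp add: divide_simps) (simp add: algebra_simps)
  have 3: "norm (1 + g * cnj a) = norm (1 + cnj g * a)"
    by (metis complex_cnj_add complex_cnj_cnj complex_cnj_mult complex_cnj_one complex_mod_cnj)
  define K where "K = norm (1 - cnj g * g) / (norm (1 + cnj g * a) * norm (1 + cnj g * b))"
  have "norm (mobius g a - mobius g b) = K * norm (a - b)"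
    "norm (1 - cnj (mobius g a) * mobius g b) = K * norm (1 - cnj a * b)"
    unfolding 1 2 norm_divide norm_mult 3 K_def by simp_all
  moreover have "K * norm (a - b) \<le> K * (e * norm (1 - cnj a * b))"
    using ab unfolding pseudo_close_def by (rule mult_left_mono) (simp add: K_def)
  ultimately show ?thesis by (simp add: pseudo_close_def mult.left_commute)
qed

lemma pseudo_close_rotate:
  assumes "norm c = 1" "pseudo_close e a b"
  shows "pseudo_close e (c * a) (c * b)"
proof -
  have "cnj c * c = 1" using assms(1) complex_norm_square[of c] by (simp add: mult.commute)
  moreover have "cnj (c * a) * (c * b) = (cnj c * c) * (cnj a * b)" by simp
  ultimately have "cnj (c * a) * (c * b) = cnj a * b" by simp
  moreover have "norm (c * a - c * b) = norm (a - b)"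
    using assms(1) by (simp flip: right_diff_distrib add: norm_mult)
  ultimately show ?thesis using assms(2) by (simp only: pseudo_close_def)
qed

lemma pseudo_close_norm_le:
  assumes "pseudo_close e a b" "norm a \<le> 1" "norm b \<le> 1" "0 \<le> e"
  shows "norm (a - b) \<le> 2 * e"
proof -
  have "norm (cnj a * b) \<le> 1" using assms by (simp add: norm_mult mult_le_one)
  then have "norm (1 - cnj a * b) \<le> 2" using norm_triangle_ineq4[of 1 "cnj a * b"] by simp
  then have "e * norm (1 - cnj a * b) \<le> e * 2" using assms(4) by (rule mult_left_mono)
  with assms(1) show ?thesis by (simp add: pseudo_close_def)
qed

text \<open>The inverse Schur iterates: \<open>backward \<alpha> c n\<close> is the Schur function with parameters
  \<open>- cnj (\<alpha> (n - 1)), \<dots>, - cnj (\<alpha> 0)\<close> followed by the constant \<open>c\<close>. On the circle its complex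
  conjugate obeys the same recursion as \<open>z f\<^sub>n(z)\<close>, where \<open>f\<^sub>n\<close> are the Schur iterates.\<close>

fun backward :: "(nat \<Rightarrow> complex) \<Rightarrow> complex \<Rightarrow> nat \<Rightarrow> complex \<Rightarrow> complex" where
  "backward \<alpha> c 0 z = c"
| "backward \<alpha> c (Suc n) z = mobius (- cnj (\<alpha> n)) (z * backward \<alpha> c n z)"

text \<open>The parameter met first is the one at \<open>n - 1\<close>, so the index runs downwards.
  The subtraction truncates only for \<open>k \<ge> n\<close>, where no parameter is read.\<close>

lemma backward_eq_schur_approx:
  "backward \<alpha> c n z = schur_approx n (\<lambda>k. - cnj (\<alpha> (n - Suc k))) c z"
  by (induction n) (simp_all add: o_def)

lemma norm_backward_le:
  assumes "\<And>n. norm (\<alpha> n) < 1" "norm c \<le> 1" "norm z \<le> 1"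
  shows "norm (backward \<alpha> c n z) \<le> 1"
proof (induction n)
  case (Suc n)
  show ?case
    unfolding backward.simps using assms(1)[of n] Suc assms(3)
    by (intro norm_mobius_le) (simp_all add: norm_mult mult_le_one)
qed (use assms in simp)

text \<open>With all parameters inside the disc these functions are rational without poles on the
  closed disc. Their boundary values are genuine values at every point of the circle, so the
  recursion holds there without exceptions.\<close>

lemma boundary_function_backward:
  assumes \<alpha>: "\<And>n. norm (\<alpha> n) < 1" and c: "norm c \<le> 1"
  shows "schur (backward \<alpha> c n)" "boundary_function (backward \<alpha> c n) (\<lambda>t. backward \<alpha> c n (cis t))"
proof -
  have nz: "1 + cnj (- cnj (\<alpha> n)) * (z * backward \<alpha> c n z) \<noteq> 0" if "norm z \<le> 1" for n z
    using \<alpha>[of n] norm_backward_le[of \<alpha> c z n, OF \<alpha> c that] that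
    by (intro mobius_denominator_nonzero') (simp_all add: norm_mult mult_le_one)
  have C: "continuous_on (cball 0 1) (backward \<alpha> c n)"
  proof (induction n)
    case 0
    then show ?case by simp
  next
    case (Suc n)
    then show ?case
      unfolding backward.simps mobius_def using nz by (intro continuous_intros) auto
  qed
  have H: "backward \<alpha> c n holomorphic_on ball 0 1"
  proof (induction n)
    case 0
    then show ?case by simp
  next
    case (Suc n)
    then show ?case
      unfolding backward.simps mobius_def using nz by (intro holomorphic_intros) auto
  qed
  show "schur (backward \<alpha> c n)"
    unfolding schur_def using H norm_backward_le[of \<alpha> c _ n, OF \<alpha> c] by simp
  have lim: "((\<lambda>r. backward \<alpha> c n (of_real r * cis t)) \<longlongrightarrow> backward \<alpha> c n (cis t)) (at_left 1)" for t
  proof -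
    have "((\<lambda>r. of_real r * cis t) \<longlongrightarrow> of_real 1 * cis t) (at_left 1)" by (intro tendsto_intros)
    moreover have "eventually (\<lambda>r. of_real r * cis t \<in> cball 0 1) (at_left 1)"
      using eventually_at_left_real[of 0 1] by (rule eventually_mono) (auto simp: norm_mult)
    ultimately show ?thesis
      using continuous_on_tendsto_compose[OF C, of "\<lambda>r. of_real r * cis t" "cis t"] by simp
  qed
  have "continuous_on UNIV (\<lambda>t. backward \<alpha> c n (cis t))" by (rule cis_continuous_on_compose[OF C])
  then show "boundary_function (backward \<alpha> c n) (\<lambda>t. backward \<alpha> c n (cis t))"
    unfolding boundary_function_def
    using poisson_formula_angle[OF C H] norm_backward_le[of \<alpha> c _ n, OF \<alpha> c] lim
    by (auto intro!: borel_measurable_continuous_onI)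
qed

text \<open>If all averages of a function lie in a closed set, so do almost all its values. Setting
  the function to 0 off \<open>T\<close> reduces any average to one over a subset of
  \<open>T\<close>; the ball contains 0 since \<open>0 \<le> e\<close>.\<close>

lemma AE_angle_norm_le_by_averages:
  fixes q :: "real \<Rightarrow> complex"
  assumes [measurable]: "q \<in> borel_measurable borel" and M: "\<And>t. norm (q t) \<le> M"
    and T [measurable]: "T \<in> sets borel" and e: "0 \<le> e"
    and avg: "\<And>S. S \<in> sets borel \<Longrightarrow> S \<subseteq> T \<Longrightarrow> S \<subseteq> {0..2 * pi} \<Longrightarrow>
      norm (\<integral>t. indicator S t *\<^sub>R q t \<partial>angle_measure) \<le> e * measure angle_measure S"
  shows "AE t in angle_measure. t \<in> T \<longrightarrow> norm (q t) \<le> e"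
proof -
  have M0: "0 \<le> M" using M[of 0] norm_ge_zero order_trans by blast
  have "AE t in angle_measure. indicator T t *\<^sub>R q t \<in> cball 0 e"
  proof (rule angle.averaging_theorem)
    show "integrable angle_measure (\<lambda>t. indicator T t *\<^sub>R q t)"
      by (rule integrable_angle_bounded[where M = M]) (measurable, use M M0 in \<open>simp add: indicator_def\<close>)
    fix A assume A: "A \<in> sets angle_measure" "0 < measure angle_measure A"
    from A(1) have B: "A \<subseteq> {0..2 * pi}" and [measurable]: "A \<in> sets borel"
      unfolding sets_angle_measure by (simp_all add: sets_restrict_space_iff)
    have AT: "A \<inter> T \<in> sets borel" "A \<inter> T \<subseteq> T" "A \<inter> T \<subseteq> {0..2 * pi}"
      using B by auto
    have "set_lebesgue_integral angle_measure A (\<lambda>t. indicator T t *\<^sub>R q t)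
        = (\<integral>t. indicator (A \<inter> T) t *\<^sub>R q t \<partial>angle_measure)"
      by (simp add: set_lebesgue_integral_def indicator_inter_arith)
    then have "norm (set_lebesgue_integral angle_measure A (\<lambda>t. indicator T t *\<^sub>R q t))
        \<le> e * measure angle_measure (A \<inter> T)"
      using avg[OF AT] by simp
    also have "\<dots> \<le> e * measure angle_measure A"
      using A(1) e by (intro mult_left_mono angle.finite_measure_mono) auto
    finally show "(1 / measure angle_measure A) *\<^sub>R set_lebesgue_integral angle_measure A (\<lambda>t. indicator T t *\<^sub>R q t)
        \<in> cball 0 e"
      using A(2) by (simp add: field_simps)
  qed simp
  then show ?thesis by eventually_elim (auto simp: indicator_def)
qed

text \<open>The admissible \<open>c\<close>, with strict inequality, form an open set containing
  \<open>cnj a\<close>, where the left side is 0 and the right side positive because |a| < 1. A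
  countable dense set meets it.\<close>

lemma exists_pseudo_close:
  obtains Dn :: "complex set" where "countable Dn" "\<And>c. c \<in> Dn \<Longrightarrow> norm c < 1"
    "\<And>a e. norm a < 1 \<Longrightarrow> 0 < e \<Longrightarrow> \<exists>c \<in> Dn. pseudo_close e a (cnj c)"
proof -
  obtain D :: "complex set" where D: "countable D" "\<And>X. open X \<Longrightarrow> X \<noteq> {} \<Longrightarrow> \<exists>d\<in>D. d \<in> X"
    using countable_dense_exists by blast
  show ?thesis
  proof (rule that[of "D \<inter> ball 0 1"])
    fix a :: complex and e :: real assume a: "norm a < 1" "0 < e"
    let ?X = "{c. norm (a - cnj c) < e * norm (1 - cnj a * cnj c)} \<inter> ball 0 1"
    have "open ?X"
      by (intro open_Int open_Collect_less continuous_intros) simp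
    moreover have "cnj a \<in> ?X"
    proof -
      have "norm (cnj a * a) < 1" using a(1) norm_mult3_less_one[of 1 "cnj a" a] by simp
      then have "cnj a * a \<noteq> 1" by (metis less_irrefl norm_one)
      then show ?thesis using a by simp
    qed
    ultimately obtain c where "c \<in> D" "c \<in> ?X" using D(2)[of ?X] by blast
    then show "\<exists>c \<in> D \<inter> ball 0 1. pseudo_close e a (cnj c)"
      by (intro bexI[of _ c]) (auto simp: pseudo_close_def)
  qed (use D in auto)
qed

text \<open>The constant \<open>c\<close> sits at depth \<open>N j\<close>, which tends to infinity.
  Cutting at a fixed depth \<open>n\<close> costs at most \<open>2 * norm z ^ n\<close> once
  \<open>n \<le> N j\<close>, and the \<open>n\<close> parameters above the cut converge.\<close>

lemma backward_tendsto:
  fixes N :: "nat \<Rightarrow> nat"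
  assumes \<alpha>: "\<And>n. norm (\<alpha> n) < 1" and N: "filterlim N at_top sequentially"
    and \<gamma>: "\<forall>k. norm (\<gamma> k) \<le> 1" and lim: "\<And>k. (\<lambda>j. - cnj (\<alpha> (N j - Suc k))) \<longlonglongrightarrow> \<gamma> k"
    and c: "norm c \<le> 1" and z: "z \<in> ball 0 1"
  shows "(\<lambda>j. backward \<alpha> c (N j) z) \<longlonglongrightarrow> schur_lim \<gamma> z"
proof -
  define G where "G j k = - cnj (\<alpha> (N j - Suc k))" for j k
  have G: "\<forall>k. norm (G j k) \<le> 1" for j using \<alpha> by (simp add: G_def less_imp_le)
  have "\<exists>J. \<forall>j\<ge>J. n \<le> N j" for n
    using N by (simp add: filterlim_at_top eventually_sequentially)
  then obtain J where J: "\<And>n j. j \<ge> J n \<Longrightarrow> n \<le> N j" by metis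
  show ?thesis
  proof (rule tendsto_approx_family[where N = J])
    show "norm (schur_approx n (G j) 0 z - backward \<alpha> c (N j) z) \<le> 2 * norm z ^ n" if jn: "J n \<le> j" for n j
    proof -
      obtain k where k: "N j = n + k" using le_Suc_ex[OF J[OF jn]] by blast
      have "backward \<alpha> c (N j) z = schur_approx (n + k) (G j) c z"
        unfolding backward_eq_schur_approx k[symmetric] G_def ..
      then show ?thesis
        unfolding schur_approx_add
        by (simp only:) (intro schur_approx_dist_const G z norm_schur_approx_le c, use G in auto)
    qed
    show "norm (schur_approx n \<gamma> 0 z - schur_lim \<gamma> z) \<le> 2 * norm z ^ n" for n
      by (rule schur_lim_dist[OF \<gamma> _ z]) simp
    show "(\<lambda>j. schur_approx n (G j) 0 z) \<longlonglongrightarrow> schur_approx n \<gamma> 0 z" for n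
      by (rule schur_approx_tendsto_params[OF \<gamma> G _ z]) (use lim in \<open>simp_all add: G_def\<close>)
    show "(\<lambda>n. 2 * norm z ^ n) \<longlonglongrightarrow> 0"
      using z by (intro geometric_tendsto_0) simp
  qed
qed

text \<open>\<open>\<Phi> n\<close> belongs to \<open>z\<close> times the iterate, so
  \<open>cis (- t)\<close> first removes the factor \<open>z\<close> before the Schur step.
  Countably many null sets are merged, so that one point serves all \<open>n\<close>.\<close>

lemma schur_iterate_boundary_rec:
  assumes \<alpha>: "\<And>n. norm (\<alpha> n) < 1"
    and \<Phi>: "\<And>n. boundary_function (\<lambda>z. z * schur_lim (\<lambda>k. \<alpha> (n + k)) z) (\<Phi> n)"
  shows "AE t in angle_measure. \<forall>n. \<Phi> (Suc n) t = mobius (- \<alpha> n) (cis (- t) * \<Phi> n t)"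
proof -
  define f where "f n = schur_lim (\<lambda>k. \<alpha> (n + k))" for n
  have \<alpha>1: "\<forall>k. norm (\<alpha> (n + k)) \<le> 1" for n using \<alpha> by (simp add: less_imp_le)
  have f1: "norm (f n z) \<le> 1" if "norm z < 1" for n z
    unfolding f_def using that by (intro norm_schur_lim_le \<alpha>1) simp
  have rec: "z * f (Suc n) z = mobius (- \<alpha> n) (f n z)" if "norm z < 1" for n z
  proof -
    have "f n z = mobius (\<alpha> n) (z * f (Suc n) z)"
      unfolding f_def using schur_lim_rec[OF \<alpha>1, of z n] that by (simp add: o_def)
    moreover have "norm (z * f (Suc n) z) \<le> 1"
      using f1[OF that] that by (simp add: norm_mult mult_le_one)
    ultimately show ?thesis
      using mobius_inverse[OF \<alpha>[of n]] by (simp add: mobius_def)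
  qed
  have "AE t in angle_measure. \<forall>n. ((\<lambda>r. of_real r * cis t * f n (of_real r * cis t)) \<longlongrightarrow> \<Phi> n t) (at_left 1)"
    unfolding AE_all_countable f_def using boundary_functionD(3)[OF \<Phi>] by blast
  then show ?thesis
  proof eventually_elim
    case (elim t)
    show ?case
    proof
      fix n
      have ev: "eventually (\<lambda>r. r \<in> {0<..<1}) (at_left (1::real))"
        using eventually_at_left_real[of 0 "1::real"] by simp
      have "((\<lambda>r. (of_real r * cis t * f n (of_real r * cis t)) / (of_real r * cis t)) \<longlongrightarrow> \<Phi> n t / (of_real 1 * cis t)) (at_left 1)"
        by (intro tendsto_intros elim[rule_format]) simp
      moreover have "eventually (\<lambda>r. (of_real r * cis t * f n (of_real r * cis t)) / (of_real r * cis t)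
          = f n (of_real r * cis t)) (at_left 1)"
        using ev by (rule eventually_mono) auto
      ultimately have "((\<lambda>r. f n (of_real r * cis t)) \<longlongrightarrow> \<Phi> n t / (of_real 1 * cis t)) (at_left 1)"
        by (rule Lim_transform_eventually)
      moreover have "\<Phi> n t / (of_real 1 * cis t) = cis (- t) * \<Phi> n t"
        by (simp add: divide_inverse cis_inverse mult.commute)
      ultimately have fl: "((\<lambda>r. f n (of_real r * cis t)) \<longlongrightarrow> cis (- t) * \<Phi> n t) (at_left 1)" by simp
      have "norm (\<Phi> n t) \<le> 1" by (rule boundary_functionD(2)[OF \<Phi>])
      then have "1 + cnj (- \<alpha> n) * (cis (- t) * \<Phi> n t) \<noteq> 0"
        using \<alpha>[of n] by (intro mobius_denominator_nonzero') (simp_all add: norm_mult)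
      then have "((\<lambda>r. mobius (- \<alpha> n) (f n (of_real r * cis t))) \<longlongrightarrow> mobius (- \<alpha> n) (cis (- t) * \<Phi> n t)) (at_left 1)"
        unfolding mobius_def by (intro tendsto_intros fl)
      moreover have "eventually (\<lambda>r. mobius (- \<alpha> n) (f n (of_real r * cis t))
          = of_real r * cis t * f (Suc n) (of_real r * cis t)) (at_left 1)"
        using ev by (rule eventually_mono) (auto simp: norm_mult rec)
      ultimately have "((\<lambda>r. of_real r * cis t * f (Suc n) (of_real r * cis t)) \<longlongrightarrow> mobius (- \<alpha> n) (cis (- t) * \<Phi> n t)) (at_left 1)"
        by (rule Lim_transform_eventually)
      with elim[rule_format, of "Suc n"] show "\<Phi> (Suc n) t = mobius (- \<alpha> n) (cis (- t) * \<Phi> n t)"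
        by (intro tendsto_unique[of "at_left (1::real)"]) auto
    qed
  qed
qed

text \<open>Conjugation turns the parameter \<open>- cnj (\<alpha> n)\<close> into
  \<open>- \<alpha> n\<close> and \<open>cis t\<close> into \<open>cis (- t)\<close>, so both
  sequences undergo the same rotation and the same automorphism in each step.\<close>

lemma pseudo_close_iterates:
  assumes \<alpha>: "\<And>n. norm (\<alpha> n) < 1" and c: "norm c \<le> 1"
    and rec: "\<And>n. G (Suc n) = mobius (- \<alpha> n) (cis (- t) * G n)" and G: "\<And>n. norm (G n) \<le> 1"
    and close: "pseudo_close e (G 0) (cnj c)"
  shows "pseudo_close e (G n) (cnj (backward \<alpha> c n (cis t)))"
proof (induction n)
  case 0
  then show ?case using close by simp
next
  case (Suc n)
  let ?b = "backward \<alpha> c n (cis t)"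
  have b: "norm ?b \<le> 1" by (rule norm_backward_le[of \<alpha> c "cis t" n, OF \<alpha> c]) simp
  have "cnj (backward \<alpha> c (Suc n) (cis t)) = mobius (- \<alpha> n) (cis (- t) * cnj ?b)"
    by (simp add: mobius_def cis_cnj)
  moreover have "pseudo_close e (mobius (- \<alpha> n) (cis (- t) * G n)) (mobius (- \<alpha> n) (cis (- t) * cnj ?b))"
    using \<alpha>[of n] G[of n] b
    by (intro pseudo_close_mobius pseudo_close_rotate Suc.IH) (simp_all add: norm_mult)
  ultimately show ?case using rec[of n] by simp
qed

lemma right_limit_boundary_relation:
  fixes N :: "nat \<Rightarrow> nat"
  assumes \<alpha>: "\<And>n. norm (\<alpha> n) < 1" and N: "filterlim N at_top sequentially"
    and p: "\<forall>k. norm (p k) \<le> 1" "\<And>k. (\<lambda>j. \<alpha> (N j + k)) \<longlonglongrightarrow> p k"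
    and m: "\<forall>k. norm (m k) \<le> 1" "\<And>k. (\<lambda>j. - cnj (\<alpha> (N j - Suc k))) \<longlonglongrightarrow> m k"
    and \<Phi>0: "boundary_function (\<lambda>z. z * schur_lim \<alpha> z) \<Phi>0"
    and P: "boundary_function (\<lambda>z. z * schur_lim p z) P" and Q: "boundary_function (schur_lim m) Q"
  shows "AE t in angle_measure. norm (\<Phi>0 t) < 1 \<longrightarrow> P t = cnj (Q t)"
proof -
  have \<alpha>1: "\<forall>k. norm (\<alpha> (n + k)) \<le> 1" for n using \<alpha> by (simp add: less_imp_le)
  define F where "F n = (\<lambda>z. z * schur_lim (\<lambda>k. \<alpha> (n + k)) z)" for n
  have SF: "schur (F n)" for n
    unfolding F_def by (intro schur_times_z schur_schur_lim \<alpha>1)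
  \<comment> \<open>The given \<open>\<Phi>0\<close> must be the first member of the chosen
    sequence, since the conclusion refers to its values.\<close>
  have "\<exists>\<Phi>. boundary_function (F n) \<Phi> \<and> (n = 0 \<longrightarrow> \<Phi> = \<Phi>0)" for n
  proof (cases "n = 0")
    case True
    then show ?thesis using \<Phi>0 by (auto simp: F_def)
  next
    case False
    then show ?thesis using boundary_function_exists[OF SF] by blast
  qed
  then obtain \<Phi> where "\<forall>n. boundary_function (F n) (\<Phi> n) \<and> (n = 0 \<longrightarrow> \<Phi> n = \<Phi>0)" by metis
  then have \<Phi>: "\<And>n. boundary_function (F n) (\<Phi> n)" and \<Phi>00: "\<Phi> 0 = \<Phi>0" by auto
  have [measurable]: "\<Phi> n \<in> borel_measurable borel" "P \<in> borel_measurable borel" "Q \<in> borel_measurable borel" for n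
    using boundary_functionD(1) \<Phi> P Q by blast+
  have SP: "schur (\<lambda>z. z * schur_lim p z)" and SQ: "schur (schur_lim m)"
    by (intro schur_times_z schur_schur_lim p m)+
  have rec: "AE t in angle_measure. \<forall>n. \<Phi> (Suc n) t = mobius (- \<alpha> n) (cis (- t) * \<Phi> n t)"
    by (rule schur_iterate_boundary_rec[of \<alpha> \<Phi>, OF \<alpha>]) (use \<Phi> in \<open>simp add: F_def\<close>)
  define q where "q t = P t - cnj (Q t)" for t
  have qm [measurable]: "q \<in> borel_measurable borel" unfolding q_def by measurable
  have q2: "norm (q t) \<le> 2" for t
    unfolding q_def using norm_triangle_ineq4[of "P t" "cnj (Q t)"]
      boundary_functionD(2)[OF P, of t] boundary_functionD(2)[OF Q, of t] by simp
  have local: "AE t in angle_measure. pseudo_close e (\<Phi>0 t) (cnj c) \<longrightarrow> norm (q t) \<le> 2 * e"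
    if c: "norm c \<le> 1" and e: "0 < e" for c e
  proof -
    \<comment> \<open>For this fixed \<open>c\<close> the closeness at stage 0 persists to every
      stage on \<open>T\<close>. Integrated over a subset of \<open>T\<close>, it survives the weak
      limits of both sequences.\<close>
    define T where "T = {t. pseudo_close e (\<Phi> 0 t) (cnj c)}"
    have T: "T \<in> sets borel"
      unfolding T_def pseudo_close_def by measurable
    let ?B = "\<lambda>n t. backward \<alpha> c n (cis t)"
    have Bs: "schur (backward \<alpha> c n)" "boundary_function (backward \<alpha> c n) (?B n)" for n
      using boundary_function_backward[of \<alpha> c n, OF \<alpha> c] by auto
    have [measurable]: "?B n \<in> borel_measurable borel" for n
      by (rule boundary_functionD(1)[OF Bs(2)])
    have "AE t in angle_measure. t \<in> T \<longrightarrow> norm (q t) \<le> 2 * e"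
    proof (rule AE_angle_norm_le_by_averages[OF qm q2 T])
      fix S assume S [measurable]: "S \<in> sets borel" and ST: "S \<subseteq> T" "S \<subseteq> {0..2 * pi}"
      have Sa [measurable]: "S \<in> sets angle_measure"
        unfolding sets_angle_measure using ST(2) S by (simp add: sets_restrict_space_iff)
      have int: "integrable angle_measure (\<lambda>t. indicator S t *\<^sub>R h t)"
        if "h \<in> borel_measurable borel" "\<And>t. norm (h t) \<le> 1" for h :: "real \<Rightarrow> complex"
        by (rule integrable_angle_bounded[where M = 1]) (use that in \<open>measurable, simp add: indicator_def\<close>)
      have cint: "(\<integral>t. indicator S t *\<^sub>R cnj (h t) \<partial>angle_measure) = cnj (\<integral>t. indicator S t *\<^sub>R h t \<partial>angle_measure)"
        for h :: "real \<Rightarrow> complex"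
        by (subst Bochner_Integration.integral_cnj[symmetric]) simp
      have L1: "(\<lambda>j. \<integral>t. indicator S t *\<^sub>R \<Phi> (N j) t \<partial>angle_measure) \<longlonglongrightarrow> (\<integral>t. indicator S t *\<^sub>R P t \<partial>angle_measure)"
      proof (rule boundary_function_weak_limit[OF SF \<Phi> SP P _ S])
        fix z :: complex assume z: "z \<in> ball 0 1"
        show "(\<lambda>j. F (N j) z) \<longlonglongrightarrow> z * schur_lim p z"
          unfolding F_def by (intro tendsto_intros schur_lim_tendsto_params[OF p(1) \<alpha>1 z] p(2))
      qed
      have L2: "(\<lambda>j. \<integral>t. indicator S t *\<^sub>R ?B (N j) t \<partial>angle_measure) \<longlonglongrightarrow> (\<integral>t. indicator S t *\<^sub>R Q t \<partial>angle_measure)"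
        by (rule boundary_function_weak_limit[OF Bs SQ Q _ S])
          (rule backward_tendsto[of \<alpha> N m, OF \<alpha> N m c])
      have "(\<lambda>j. (\<integral>t. indicator S t *\<^sub>R \<Phi> (N j) t \<partial>angle_measure) - cnj (\<integral>t. indicator S t *\<^sub>R ?B (N j) t \<partial>angle_measure))
          \<longlonglongrightarrow> (\<integral>t. indicator S t *\<^sub>R P t \<partial>angle_measure) - cnj (\<integral>t. indicator S t *\<^sub>R Q t \<partial>angle_measure)"
        by (intro tendsto_intros L1 L2)
      moreover have "norm ((\<integral>t. indicator S t *\<^sub>R \<Phi> n t \<partial>angle_measure) - cnj (\<integral>t. indicator S t *\<^sub>R ?B n t \<partial>angle_measure))
          \<le> 2 * e * measure angle_measure S" for n
      proof -
        have B1: "norm (cnj (?B n t)) \<le> 1" for t using boundary_functionD(2)[OF Bs(2), of n t] by simp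
        have "(\<integral>t. indicator S t *\<^sub>R \<Phi> n t \<partial>angle_measure) - cnj (\<integral>t. indicator S t *\<^sub>R ?B n t \<partial>angle_measure)
            = (\<integral>t. indicator S t *\<^sub>R \<Phi> n t - indicator S t *\<^sub>R cnj (?B n t) \<partial>angle_measure)"
          unfolding cint[symmetric]
          by (rule Bochner_Integration.integral_diff[symmetric])
            (intro int boundary_functionD[OF \<Phi>], measurable, intro int B1, measurable)
        also have "norm \<dots> \<le> (\<integral>t. norm (indicator S t *\<^sub>R \<Phi> n t - indicator S t *\<^sub>R cnj (?B n t)) \<partial>angle_measure)"
          by (rule integral_norm_bound)
        also have "\<dots> \<le> (\<integral>t. indicator S t * (2 * e) \<partial>angle_measure)"
        proof (rule integral_mono_AE)
          show "integrable angle_measure (\<lambda>t. norm (indicator S t *\<^sub>R \<Phi> n t - indicator S t *\<^sub>R cnj (?B n t)))"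
            by (intro integrable_norm Bochner_Integration.integrable_diff int B1 boundary_functionD[OF \<Phi>]) measurable
          show "integrable angle_measure (\<lambda>t. indicator S t * (2 * e))"
            by (rule integrable_angle_bounded[where M = "2 * e"]) (measurable, use e in \<open>simp add: indicator_def\<close>)
          show "AE t in angle_measure. norm (indicator S t *\<^sub>R \<Phi> n t - indicator S t *\<^sub>R cnj (?B n t)) \<le> indicator S t * (2 * e)"
            using rec
          proof eventually_elim
            case (elim t)
            show ?case
            proof (cases "t \<in> S")
              case True
              then have "pseudo_close e (\<Phi> 0 t) (cnj c)" using ST by (auto simp: T_def)
              then have "pseudo_close e (\<Phi> n t) (cnj (?B n t))"
                using pseudo_close_iterates[of \<alpha> c "\<lambda>n. \<Phi> n t" t e n, OF \<alpha> c] elim boundary_functionD(2)[OF \<Phi>]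
                by blast
              then have "norm (\<Phi> n t - cnj (?B n t)) \<le> 2 * e"
                by (rule pseudo_close_norm_le) (use B1 boundary_functionD(2)[OF \<Phi>] e in auto)
              then show ?thesis using True by simp
            qed simp
          qed
        qed
        also have "\<dots> = 2 * e * measure angle_measure S"
          using ST(2) by (simp add: Int_absorb2)
        finally show ?thesis .
      qed
      ultimately have "norm ((\<integral>t. indicator S t *\<^sub>R P t \<partial>angle_measure) - cnj (\<integral>t. indicator S t *\<^sub>R Q t \<partial>angle_measure))
          \<le> 2 * e * measure angle_measure S"
        by (intro tendsto_upperbound[OF tendsto_norm]) auto
      moreover have "(\<integral>t. indicator S t *\<^sub>R q t \<partial>angle_measure)
          = (\<integral>t. indicator S t *\<^sub>R P t \<partial>angle_measure) - cnj (\<integral>t. indicator S t *\<^sub>R Q t \<partial>angle_measure)"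
        unfolding q_def scaleR_diff_right cint[symmetric]
        by (rule Bochner_Integration.integral_diff; rule int)
          (measurable, use boundary_functionD(2)[OF P] boundary_functionD(2)[OF Q] in auto)
      ultimately show "norm (\<integral>t. indicator S t *\<^sub>R q t \<partial>angle_measure) \<le> 2 * e * measure angle_measure S" by simp
    qed (use e in simp)
    then show ?thesis by (simp add: T_def \<Phi>00)
  qed
  obtain Dn where Dn: "countable Dn" "\<And>c. c \<in> Dn \<Longrightarrow> norm c < 1"
    "\<And>a e. norm a < 1 \<Longrightarrow> 0 < e \<Longrightarrow> \<exists>c \<in> Dn. pseudo_close e a (cnj c)"
    using exists_pseudo_close by blast
  \<comment> \<open>Only countably many centres and accuracies occur, so a single null set serves
    them all; a suitable centre may then be picked separately for each point and each
    accuracy.\<close>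
  have "AE t in angle_measure. \<forall>c\<in>Dn. pseudo_close (inverse (real (Suc i))) (\<Phi>0 t) (cnj c)
      \<longrightarrow> norm (q t) \<le> 2 * inverse (real (Suc i))" for i
    using Dn by (intro AE_ball_countable' local) (auto intro: less_imp_le)
  then have "AE t in angle_measure. \<forall>i. \<forall>c\<in>Dn. pseudo_close (inverse (real (Suc i))) (\<Phi>0 t) (cnj c)
      \<longrightarrow> norm (q t) \<le> 2 * inverse (real (Suc i))"
    unfolding AE_all_countable by (rule allI)
  then show ?thesis
  proof eventually_elim
    case (elim t)
    show ?case
    proof
      assume "norm (\<Phi>0 t) < 1"
      then have "norm (q t) \<le> 2 * inverse (real (Suc i))" for i
        using Dn(3)[of "\<Phi>0 t" "inverse (real (Suc i))"] elim by auto
      moreover have "(\<lambda>i. 2 * inverse (real (Suc i))) \<longlonglongrightarrow> 2 * 0"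
        by (intro tendsto_mult tendsto_const LIMSEQ_inverse_real_of_nat)
      ultimately have "norm (q t) \<le> 2 * 0"
        by (intro tendsto_lowerbound[of "\<lambda>i. 2 * inverse (real (Suc i))" _ sequentially]) auto
      then show "P t = cnj (Q t)" by (simp add: q_def)
    qed
  qed
qed

section \<open>Right limits are reflectionless\<close>

lemma f_plus_eq:
  assumes "\<forall>n. norm (a n) \<le> 1" "norm z < 1"
  shows "f_plus a n z = schur_lim (\<lambda>k. a (n + int k)) z"
  unfolding f_plus_def by (rule schur_fun_eq) (use assms in auto)

lemma f_minus_eq:
  assumes "\<forall>n. norm (a n) \<le> 1" "norm z < 1"
  shows "f_minus a n z = schur_lim (\<lambda>k. - cnj (a (n - 1 - int k))) z"
  unfolding f_minus_def by (rule schur_fun_eq) (use assms in auto)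

text \<open>A radial limit reads values inside the disc only, where the chosen function
  \<open>schur_fun\<close> is known to be \<open>schur_lim\<close>.\<close>

lemma has_radial_limit_cong:
  assumes "\<And>w. norm w < 1 \<Longrightarrow> f w = g w" "norm z = 1"
  shows "has_radial_limit f z l \<longleftrightarrow> ((\<lambda>r. g (of_real r * z)) \<longlongrightarrow> l) (at_left 1)"
  unfolding has_radial_limit_def
proof (rule tendsto_cong)
  show "eventually (\<lambda>r. f (of_real r * z) = g (of_real r * z)) (at_left 1)"
    using eventually_at_left_real[of 0 "1::real"]
    by (rule eventually_mono) (use assms in \<open>auto simp: norm_mult\<close>)
qed

lemma right_limit_reflectionless:
  assumes \<alpha>: "\<And>n. norm (\<alpha> n) < 1" and \<mu>: "spectral_measure (half_line_cmv \<alpha>) \<mu>"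
    and A: "ac_essential_support \<mu> A" and a: "seq_right_limit \<alpha> a"
  shows "seq_reflectionless_on a A"
  unfolding seq_reflectionless_on_def
proof (rule allI, rule AE_circleI)
  fix n :: int
  have \<alpha>1: "norm (\<alpha> n) \<le> 1" for n using \<alpha>[of n] by simp
  from a obtain s :: "nat \<Rightarrow> int" where a1: "\<forall>n. norm (a n) \<le> 1"
    and s: "filterlim s at_top sequentially" "\<And>n. (\<lambda>j. \<alpha> (nat (n + s j))) \<longlonglongrightarrow> a n"
    unfolding seq_right_limit_def by blast
  from A obtain w where w: "ac_density \<mu> w" "AE z in circle_lebesgue. z \<in> A \<longleftrightarrow> 0 < w z"
    unfolding ac_essential_support_def by blast
  \<comment> \<open>Shifting by \<open>n\<close> makes \<open>f_plus a n\<close> and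
    \<open>f_minus a n\<close> the limits of the forward and backward functions at one and the same
    site \<open>N j\<close>.\<close>
  define N where "N j = nat (n + s j)" for j
  have ev: "eventually (\<lambda>j. n + s j \<ge> Z) sequentially" for Z
    using s(1) unfolding filterlim_at_top by (auto elim!: eventually_mono dest!: spec[of _ "Z - n"])
  have N: "filterlim N at_top sequentially"
    unfolding filterlim_at_top
  proof
    fix Z
    show "eventually (\<lambda>j. Z \<le> N j) sequentially"
      using ev[of "int Z"] by eventually_elim (simp add: N_def)
  qed
  define p where "p = (\<lambda>k. a (n + int k))"
  define m where "m = (\<lambda>k. - cnj (a (n - 1 - int k)))"
  have p1: "\<forall>k. norm (p k) \<le> 1" and m1: "\<forall>k. norm (m k) \<le> 1"
    using a1 by (simp_all add: p_def m_def)
  have p: "(\<lambda>j. \<alpha> (N j + k)) \<longlonglongrightarrow> p k" for k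
  proof (rule Lim_transform_eventually)
    show "(\<lambda>j. \<alpha> (nat (n + int k + s j))) \<longlonglongrightarrow> p k" using s(2) by (simp add: p_def)
    show "eventually (\<lambda>j. \<alpha> (nat (n + int k + s j)) = \<alpha> (N j + k)) sequentially"
      using ev[of 0]
    proof eventually_elim
      case (elim j)
      then have "nat (n + int k + s j) = N j + k" unfolding N_def by linarith
      then show ?case by simp
    qed
  qed
  have m: "(\<lambda>j. - cnj (\<alpha> (N j - Suc k))) \<longlonglongrightarrow> m k" for k
  proof -
    \<comment> \<open>Both truncations stop at 0, so this holds for every \<open>j\<close>; the
      forward indices agree only once \<open>n + s j\<close> is nonnegative.\<close>
    have "N j - Suc k = nat (n - 1 - int k + s j)" for j unfolding N_def by linarith
    then show ?thesis
      using tendsto_minus[OF tendsto_cnj[OF s(2)[of "n - 1 - int k"]]] by (simp add: m_def)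
  qed
  have S0: "schur (\<lambda>z. z * schur_lim \<alpha> z)" and SP: "schur (\<lambda>z. z * schur_lim p z)" and SQ: "schur (schur_lim m)"
    using \<alpha>1 p1 m1 by (simp_all add: schur_times_z schur_schur_lim)
  obtain \<Phi>0 P Q where b: "boundary_function (\<lambda>z. z * schur_lim \<alpha> z) \<Phi>0"
    "boundary_function (\<lambda>z. z * schur_lim p z) P" "boundary_function (schur_lim m) Q"
    using boundary_function_exists[OF S0] boundary_function_exists[OF SP] boundary_function_exists[OF SQ] by blast
  show "AE t in angle_measure. cis t \<in> A \<longrightarrow> (\<exists>u v. has_radial_limit (f_plus a n) (cis t) u \<and>
      has_radial_limit (f_minus a n) (cis t) v \<and> cis t * u = cnj v)"
    using AE_circleD[OF w(2)] ac_imp_boundary_less_1[OF \<alpha>1 \<mu> w(1) b(1)]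
      right_limit_boundary_relation[OF \<alpha> N p1 p m1 m b] boundary_functionD(3)[OF b(2)] boundary_functionD(3)[OF b(3)]
  proof eventually_elim
    case (elim t)
    show ?case
    proof
      assume "cis t \<in> A"
      then have PQ: "P t = cnj (Q t)" using elim by blast
      have "((\<lambda>r. of_real r * cis t * schur_lim p (of_real r * cis t) / (of_real r * cis t))
          \<longlongrightarrow> P t / (of_real 1 * cis t)) (at_left 1)"
        by (intro tendsto_intros elim) simp
      moreover have "eventually (\<lambda>r. of_real r * cis t * schur_lim p (of_real r * cis t) / (of_real r * cis t)
          = schur_lim p (of_real r * cis t)) (at_left 1)"
        using eventually_at_left_real[of 0 "1::real"] by (rule eventually_mono) auto
      ultimately have "((\<lambda>r. schur_lim p (of_real r * cis t)) \<longlongrightarrow> P t / (of_real 1 * cis t)) (at_left 1)"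
        by (rule Lim_transform_eventually)
      then have u: "has_radial_limit (f_plus a n) (cis t) (P t / cis t)"
        using has_radial_limit_cong[of "f_plus a n" "schur_lim p" "cis t"] f_plus_eq[OF a1] by (simp add: p_def)
      have v: "has_radial_limit (f_minus a n) (cis t) (Q t)"
        using has_radial_limit_cong[of "f_minus a n" "schur_lim m" "cis t"] f_minus_eq[OF a1] elim by (simp add: m_def)
      have "cis t * (P t / cis t) = cnj (Q t)" using PQ by simp
      with u v show "\<exists>u v. has_radial_limit (f_plus a n) (cis t) u \<and>
          has_radial_limit (f_minus a n) (cis t) v \<and> cis t * u = cnj v" by blast
    qed
  qed
qed

text \<open>If \<open>\<bar>a n\<bar> = 1\<close>, the reflectionless identity forces \<open>a n z f_minus(z) = 1\<close> on \<open>A\<close>, although this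
  function vanishes at the origin.\<close>

lemma reflectionless_degenerate_null:
  assumes a1: "\<forall>n. norm (a n) \<le> 1" and n: "norm (a n) = 1" and refl: "seq_reflectionless_on a A"
  shows "AE z in circle_lebesgue. z \<notin> A"
proof (rule AE_circleI)
  define p where "p = (\<lambda>k. a (n + int k))"
  define m where "m = (\<lambda>k. - cnj (a (n - 1 - int k)))"
  have p1: "\<forall>k. norm (p k) \<le> 1" and m1: "\<forall>k. norm (m k) \<le> 1"
    using a1 by (simp_all add: p_def m_def)
  have pc: "schur_lim p z = a n" if "norm z < 1" for z
    using schur_unimodular_const[OF schur_schur_lim[OF p1], of z] schur_lim_zero[OF p1] n that
    by (simp add: p_def)
  have g: "schur (\<lambda>z. z * (a n * schur_lim m z))"
  proof (rule schur_times_z)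
    show "schur (\<lambda>z. a n * schur_lim m z)"
      using schur_schur_lim[OF m1] n by (auto simp: schur_def norm_mult intro!: holomorphic_intros)
  qed
  then obtain \<gamma> where \<gamma>: "boundary_function (\<lambda>z. z * (a n * schur_lim m z)) \<gamma>"
    using boundary_function_exists by blast
  have "AE t in angle_measure. \<gamma> t \<noteq> 1"
    by (rule schur_boundary_ne_1[OF g _ \<gamma>]) simp
  moreover have "AE t in angle_measure. cis t \<in> A \<longrightarrow> (\<exists>u v. has_radial_limit (f_plus a n) (cis t) u \<and>
      has_radial_limit (f_minus a n) (cis t) v \<and> cis t * u = cnj v)"
    using refl unfolding seq_reflectionless_on_def by (intro AE_circleD) blast
  ultimately show "AE t in angle_measure. cis t \<notin> A"
    using boundary_functionD(3)[OF \<gamma>]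
  proof eventually_elim
    case (elim t)
    show ?case
    proof
      assume "cis t \<in> A"
      then obtain u v where uv: "has_radial_limit (f_plus a n) (cis t) u"
        "has_radial_limit (f_minus a n) (cis t) v" "cis t * u = cnj v"
        using elim by blast
      have "((\<lambda>r. a n) \<longlongrightarrow> u) (at_left (1::real))"
        using uv(1) has_radial_limit_cong[of "f_plus a n" "\<lambda>_. a n" "cis t" u] f_plus_eq[OF a1] pc
        by (simp add: p_def)
      then have u: "u = a n" by (simp add: tendsto_const_iff)
      have v: "((\<lambda>r. schur_lim m (of_real r * cis t)) \<longlongrightarrow> v) (at_left 1)"
        using uv(2) has_radial_limit_cong[of "f_minus a n" "schur_lim m" "cis t" v] f_minus_eq[OF a1]
        by (simp add: m_def)
      have "((\<lambda>r. of_real r * cis t * (a n * schur_lim m (of_real r * cis t))) \<longlongrightarrow> of_real 1 * cis t * (a n * v)) (at_left 1)"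
        by (intro tendsto_intros v)
      then have "\<gamma> t = of_real 1 * cis t * (a n * v)"
        using elim(3) by (intro tendsto_unique[of "at_left (1::real)"]) auto
      \<comment> \<open>With \<open>u = a n\<close> the reflectionless identity says
        \<open>cis t * a n = cnj v\<close>. This has modulus one, so the boundary value is 1, which
        the first exceptional set excludes.\<close>
      also have "\<dots> = cnj v * v" using uv(3) u by (simp flip: mult.assoc)
      also have "\<dots> = 1"
      proof -
        have "norm (cnj v) = 1" unfolding uv(3)[symmetric] u using n by (simp add: norm_mult)
        then show ?thesis using complex_norm_square[of v] by (simp add: mult.commute)
      qed
      finally show False using elim(1) by simp
    qed
  qed
qed

section \<open>Recovering the coefficients from the matrix\<close>

lemma whole_line_cmv_entries:
  assumes "even m"
  defines "e \<equiv> \<lambda>k j :: int. if j = k then 1 else 0"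
  shows "whole_line_cmv a (e (m - 1)) m = cnj (a m) * cmv_rho (a (m - 1))"
    "whole_line_cmv a (e (m - 1)) (m + 1) = cmv_rho (a m) * cmv_rho (a (m - 1))"
    "whole_line_cmv a (e m) (m + 1) = - cmv_rho (a m) * a (m - 1)"
  using assms(1)
  by (simp_all add: e_def whole_line_cmv_def whole_L_def whole_M_def Theta_fst_def Theta_snd_def)

text \<open>The squared moduli of the first two entries add up to the square of
  \<open>\<rho> (a (m - 1))\<close>, as \<open>|a m|^2 + (\<rho> (a m))^2 = 1\<close>. Nonnegativity
  fixes the root, and since \<open>a\<close> lies in the open disc both factors \<rho> can be
  cancelled. Odd indices are reached as \<open>m - 1\<close>.\<close>

lemma whole_line_cmv_inj:
  assumes a: "\<And>n. norm (a n) < 1" and b: "\<And>n. norm (b n) \<le> 1"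
    and eq: "whole_line_cmv a = whole_line_cmv b"
  shows "a = b"
proof -
  define \<rho> where "\<rho> c = sqrt (1 - (norm (c :: complex))\<^sup>2)" for c
  have \<rho>: "cmv_rho c = of_real (\<rho> c)" for c by (simp add: cmv_rho_def \<rho>_def)
  have pos: "\<rho> (a n) > 0" for n
    using a[of n] abs_square_less_1[of "norm (a n)"] by (simp add: \<rho>_def)
  have nn: "\<rho> (b n) \<ge> 0" for n
    using b[of n] by (simp add: \<rho>_def power_le_one)
  have sq: "(norm c)\<^sup>2 + (\<rho> c)\<^sup>2 = 1" if "norm c \<le> 1" for c
    using that by (simp add: \<rho>_def power_le_one)
  have main: "a m = b m \<and> a (m - 1) = b (m - 1)" if m: "even m" for m
  proof -
    have e1: "cnj (a m) * of_real (\<rho> (a (m - 1))) = cnj (b m) * of_real (\<rho> (b (m - 1)))"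
      and e2: "complex_of_real (\<rho> (a m) * \<rho> (a (m - 1))) = of_real (\<rho> (b m) * \<rho> (b (m - 1)))"
      and e3: "of_real (\<rho> (a m)) * a (m - 1) = of_real (\<rho> (b m)) * b (m - 1)"
      using whole_line_cmv_entries[OF m, of a] whole_line_cmv_entries[OF m, of b] unfolding eq \<rho> by auto
    have prod_eq: "\<rho> (a m) * \<rho> (a (m - 1)) = \<rho> (b m) * \<rho> (b (m - 1))"
      using e2 unfolding of_real_eq_iff .
    from arg_cong[OF e1, of norm] have norm_eq: "norm (a m) * \<rho> (a (m - 1)) = norm (b m) * \<rho> (b (m - 1))"
      using pos[of "m - 1"] nn[of "m - 1"] by (simp add: norm_mult)
    have "(\<rho> (a (m - 1)))\<^sup>2 * ((norm (a m))\<^sup>2 + (\<rho> (a m))\<^sup>2)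
        = (norm (a m) * \<rho> (a (m - 1)))\<^sup>2 + (\<rho> (a m) * \<rho> (a (m - 1)))\<^sup>2"
      by (simp add: power_mult_distrib algebra_simps)
    also have "\<dots> = (\<rho> (b (m - 1)))\<^sup>2 * ((norm (b m))\<^sup>2 + (\<rho> (b m))\<^sup>2)"
      unfolding norm_eq prod_eq by (simp add: power_mult_distrib algebra_simps)
    finally have "(\<rho> (a (m - 1)))\<^sup>2 = (\<rho> (b (m - 1)))\<^sup>2"
      using sq[of "a m"] sq[of "b m"] a[of m] b[of m] by simp
    then have r: "\<rho> (a (m - 1)) = \<rho> (b (m - 1))"
      using pos[of "m - 1"] nn[of "m - 1"] by (simp add: power2_eq_iff_nonneg)
    then have r': "\<rho> (a m) = \<rho> (b m)" using prod_eq pos[of "m - 1"] by simp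
    have "a m = b m" using e1 r pos[of "m - 1"] by simp
    moreover have "a (m - 1) = b (m - 1)" using e3 r' pos[of m] by simp
    ultimately show ?thesis ..
  qed
  show ?thesis
  proof
    fix n
    show "a n = b n"
      using main[of n] main[of "n + 1"] by (cases "even n") auto
  qed
qed

theorem theorem1p4:
  fixes \<alpha> :: "nat \<Rightarrow> complex" and \<mu> :: "complex measure" and A :: "complex set"
    and E :: "(int \<Rightarrow> complex) \<Rightarrow> (int \<Rightarrow> complex)"
  assumes "\<And>n. norm (\<alpha> n) < 1"
    and "spectral_measure (half_line_cmv \<alpha>) \<mu>"
    and "ac_essential_support \<mu> A"
    and "cmv_right_limit \<alpha> E"
  shows "cmv_reflectionless_on E A"
proof -
  from assms(4) obtain a where a: "seq_right_limit \<alpha> a" and E: "E = whole_line_cmv a"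
    unfolding cmv_right_limit_def by blast
  have a1: "\<forall>n. norm (a n) \<le> 1" using a by (simp add: seq_right_limit_def)
  have refl: "seq_reflectionless_on a A"
    by (rule right_limit_reflectionless[OF assms(1-3) a])
  have "seq_reflectionless_on b A" if b: "whole_line_coeffs b E" for b
  proof (cases "\<forall>n. norm (a n) < 1")
    case True
    then have "a = b"
      using b E by (intro whole_line_cmv_inj) (auto simp: whole_line_coeffs_def)
    with refl show ?thesis by simp
  next
    case False
    \<comment> \<open>Other coefficient sequences may exist now, but the identity already proved for
      \<open>a\<close> forces \<open>A\<close> to be a null set, so the condition holds for each of
      them.\<close>
    then obtain n where "norm (a n) = 1" using a1 by (meson linorder_not_less order_antisym)
    from reflectionless_degenerate_null[OF a1 this refl] show ?thesis
      unfolding seq_reflectionless_on_def by (auto elim!: eventually_mono)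
  qed
  with a1 E show ?thesis
    unfolding cmv_reflectionless_on_def whole_line_coeffs_def by blast
qed

end
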